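(* Let $\rho_{AB}$ be a density operator on $\mathcal{H}_A\otimes\mathcal{H}_B$. Then $$\mathrm{CDP}_A(\rho_{AB})\le\min_{\substack{\Lambda\ \text{s.t.}\\ \mathrm{OSR}((\Lambda\otimes\mathrm{id}_B)[\rho_{AB}])<d_A^2}}2D\big(\rho_{AB},(\Lambda\otimes\mathrm{id}_B)[\rho_{AB}]\big)\le\min_{\Pi}\,2D\big(\rho_{AB},(\Pi\otimes\mathrm{id}_B)[\rho_{AB}]\big),$$ where the first minimum is over all quantum channels $\Lambda$ acting on $A$ such that $(\Lambda\otimes\mathrm{id}_B)[\rho_{AB}]$ has operator Schmidt rank strictly smaller than $d_A^2$ (less than maximal), and the second minimum is over all projective measurements $\Pi[L]=\sum_{i}|a_i\rangle\langle a_i|L|a_i\rangle\langle a_i|$, with $\{|a_i\rangle\}$ ranging over orthonormal bases of $\mathcal{H}_A$.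
   Context: All Hilbert spaces are finite dimensional; $d_X=\dim\mathcal{H}_X$, and $\mathcal{L}(\mathcal{H})$ is the space of linear operators on $\mathcal{H}$. The quantity on the far right is a geometric (disturbance-based) quantifier of the quantum discord of $\rho_{AB}$ on $A$. The operator Schmidt rank $\mathrm{OSR}(\rho_{AB})$ is the minimum number of product terms $X\otimes Y$ in a decomposition of $\rho_{AB}$ as a sum of product operators, equivalently the Schmidt rank of $\rho_{AB}$ regarded as a vector in $\mathcal{L}(\mathcal{H}_A)\otimes\mathcal{L}(\mathcal{H}_B)$. A quantum channel is a completely positive trace-preserving linear map. Let $D(\rho,\sigma)=\frac12\|\rho-\sigma\|_1$. For channels $\Lambda_0,\Lambda_1$ with the same input system $S$ and the same output system, $D_\diamond(\Lambda_0,\Lambda_1)=\max_{\rho}D\big((\Lambda_0\otimes\mathrm{id}_{S'})[\rho],(\Lambda_1\otimes\mathrm{id}_{S'})[\rho]\big)$, the maximum being over all density operators on $\mathcal{H}_S\otimes\mathcal{H}_{S'}$, with $S'$ a copy of $S$. The channel discrimination power on $A$ is $$\mathrm{CDP}_A(\rho_{AB})=\inf_{\Lambda_0\neq\Lambda_1}\frac{D\big((\Lambda_0\otimes\mathrm{id}_B)[\rho_{AB}],(\Lambda_1\otimes\mathrm{id}_B)[\rho_{AB}]\big)}{D_\diamond(\Lambda_0,\Lambda_1)},$$ the infimum being over all pairs of distinct channels with input $\mathcal{L}(\mathcal{H}_A)$ and a common output space of arbitrary finite dimension.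
   Formalization: The formal theorem assumes d_A ≥ 2; for d_A = 1 every state has operator Schmidt rank 1 = d_A², so the first minimum is over the empty set, and CDP = 1 while the rightmost term is 0, so the claim fails there. *)

theory Defs
  imports "Jordan_Normal_Form.Schur_Decomposition"
begin

text \<open>Conventions: the Hilbert space of dimension \<open>n\<close> is \<open>carrier_vec n\<close> over the complex
  numbers, its operators are \<open>carrier_mat n n\<close>. The space \<open>H\<^sub>A \<otimes> H\<^sub>B\<close> has dimension \<open>dA * dB\<close>, and
  the product basis vector \<open>e\<^sub>i \<otimes> f\<^sub>j\<close> has index \<open>i * dB + j\<close>.\<close>

definition mat_trace :: "complex mat \<Rightarrow> complex" where
  "mat_trace X = (\<Sum>i<dim_row X. X $$ (i, i))"

text \<open>The order on complex numbers is that of \<^theory>\<open>HOL-Library.Complex_Order\<close>: \<open>0 \<le> z\<close>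
  says that \<open>z\<close> is real and nonnegative. Over the complex numbers the condition below forces
  \<open>X\<close> to be Hermitian.\<close>

definition psd :: "nat \<Rightarrow> complex mat \<Rightarrow> bool" where
  "psd n X \<longleftrightarrow> X \<in> carrier_mat n n \<and> (\<forall>v \<in> carrier_vec n. 0 \<le> (X *\<^sub>v v) \<bullet>c v)"

definition density_operator :: "nat \<Rightarrow> complex mat \<Rightarrow> bool" where
  "density_operator n R \<longleftrightarrow> psd n R \<and> mat_trace R = 1"

definition psd_sqrt :: "complex mat \<Rightarrow> complex mat" where
  "psd_sqrt X = (THE Y. psd (dim_row X) Y \<and> Y * Y = X)"

definition trace_norm :: "complex mat \<Rightarrow> real" where
  "trace_norm X = Re (mat_trace (psd_sqrt (mat_adjoint X * X)))"

definition trace_dist :: "complex mat \<Rightarrow> complex mat \<Rightarrow> real" where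
  "trace_dist R S = trace_norm (R - S) / 2"

definition kron :: "complex mat \<Rightarrow> complex mat \<Rightarrow> complex mat" where
  "kron X Y = mat (dim_row X * dim_row Y) (dim_col X * dim_col Y)
     (\<lambda>(r, c). X $$ (r div dim_row Y, c div dim_col Y) * Y $$ (r mod dim_row Y, c mod dim_col Y))"

text \<open>An operator on \<open>H\<^sub>A \<otimes> H\<^sub>B\<close> is the sum over \<open>j, l\<close> of its blocks \<open>\<langle>f\<^sub>j| X |f\<^sub>l\<rangle>\<close> (operators on
  \<open>H\<^sub>A\<close>) tensored with \<open>|f\<^sub>j\<rangle>\<langle>f\<^sub>l|\<close>, and \<open>\<Lambda> \<otimes> id\<close> applies \<open>\<Lambda>\<close> to every block.\<close>

definition block :: "nat \<Rightarrow> nat \<Rightarrow> complex mat \<Rightarrow> nat \<Rightarrow> nat \<Rightarrow> complex mat" where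
  "block d k X j l = mat d d (\<lambda>(a, b). X $$ (a * k + j, b * k + l))"

definition map_tensor_id ::
    "nat \<Rightarrow> nat \<Rightarrow> nat \<Rightarrow> (complex mat \<Rightarrow> complex mat) \<Rightarrow> complex mat \<Rightarrow> complex mat" where
  "map_tensor_id d d' k \<Lambda> X = mat (d' * k) (d' * k)
     (\<lambda>(r, c). \<Lambda> (block d k X (r mod k) (c mod k)) $$ (r div k, c div k))"

definition linear_op_map :: "nat \<Rightarrow> nat \<Rightarrow> (complex mat \<Rightarrow> complex mat) \<Rightarrow> bool" where
  "linear_op_map d d' \<Lambda> \<longleftrightarrow>
     (\<forall>X \<in> carrier_mat d d. \<Lambda> X \<in> carrier_mat d' d') \<and>
     (\<forall>X \<in> carrier_mat d d. \<forall>Y \<in> carrier_mat d d. \<Lambda> (X + Y) = \<Lambda> X + \<Lambda> Y) \<and>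
     (\<forall>X \<in> carrier_mat d d. \<forall>c. \<Lambda> (c \<cdot>\<^sub>m X) = c \<cdot>\<^sub>m \<Lambda> X)"

lemma map_tensor_id_kron:
  assumes L: "linear_op_map d d' \<Lambda>" and X: "X \<in> carrier_mat d d" and Y: "Y \<in> carrier_mat k k"
  shows "map_tensor_id d d' k \<Lambda> (kron X Y) = kron (\<Lambda> X) Y"
proof -
  have LX: "\<Lambda> X \<in> carrier_mat d' d'" using L X by (auto simp: linear_op_map_def)
  have lt: "a * k + j < d * k" if "a < d" "j < k" for a j
  proof -
    have "a * k + j < Suc a * k" using that by simp
    also have "\<dots> \<le> d * k" using that by (intro mult_right_mono) auto
    finally show ?thesis .
  qed
  have B: "block d k (kron X Y) j l = Y $$ (j, l) \<cdot>\<^sub>m X" if "j < k" "l < k" for j l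
    using that X Y lt by (intro eq_matI) (auto simp: block_def kron_def)
  show ?thesis
  proof (rule eq_matI)
    fix r c assume "r < dim_row (kron (\<Lambda> X) Y)" "c < dim_col (kron (\<Lambda> X) Y)"
    then have r: "r < d' * k" and c: "c < d' * k" using LX Y by (auto simp: kron_def)
    then have k: "0 < k" by (cases k) auto
    have q: "r div k < d'" "c div k < d'"
      using r c k by (auto simp: less_mult_imp_div_less)
    have m: "r mod k < k" "c mod k < k" using k by auto
    have "\<Lambda> (Y $$ (r mod k, c mod k) \<cdot>\<^sub>m X) = Y $$ (r mod k, c mod k) \<cdot>\<^sub>m \<Lambda> X"
      using L X by (auto simp: linear_op_map_def)
    moreover have "map_tensor_id d d' k \<Lambda> (kron X Y) $$ (r, c)
        = \<Lambda> (Y $$ (r mod k, c mod k) \<cdot>\<^sub>m X) $$ (r div k, c div k)"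
      using r c by (simp add: map_tensor_id_def B[OF m])
    ultimately show "map_tensor_id d d' k \<Lambda> (kron X Y) $$ (r, c) = kron (\<Lambda> X) Y $$ (r, c)"
      using r c q LX Y by (simp add: kron_def)
  qed (use LX Y in \<open>auto simp: map_tensor_id_def kron_def\<close>)
qed

definition completely_positive :: "nat \<Rightarrow> nat \<Rightarrow> (complex mat \<Rightarrow> complex mat) \<Rightarrow> bool" where
  "completely_positive d d' \<Lambda> \<longleftrightarrow>
     (\<forall>k X. psd (d * k) X \<longrightarrow> psd (d' * k) (map_tensor_id d d' k \<Lambda> X))"

definition trace_preserving :: "nat \<Rightarrow> (complex mat \<Rightarrow> complex mat) \<Rightarrow> bool" where
  "trace_preserving d \<Lambda> \<longleftrightarrow> (\<forall>X \<in> carrier_mat d d. mat_trace (\<Lambda> X) = mat_trace X)"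

definition channel :: "nat \<Rightarrow> nat \<Rightarrow> (complex mat \<Rightarrow> complex mat) \<Rightarrow> bool" where
  "channel d d' \<Lambda> \<longleftrightarrow>
     linear_op_map d d' \<Lambda> \<and> completely_positive d d' \<Lambda> \<and> trace_preserving d \<Lambda>"

definition operator_Schmidt_rank :: "nat \<Rightarrow> nat \<Rightarrow> complex mat \<Rightarrow> nat" where
  "operator_Schmidt_rank dA dB R = (LEAST r. \<exists>X Y.
     (\<forall>k<r. X k \<in> carrier_mat dA dA \<and> Y k \<in> carrier_mat dB dB) \<and>
     R = mat (dA * dB) (dA * dB) (\<lambda>rc. \<Sum>k<r. kron (X k) (Y k) $$ rc))"

definition diamond_dist ::
    "nat \<Rightarrow> nat \<Rightarrow> (complex mat \<Rightarrow> complex mat) \<Rightarrow> (complex mat \<Rightarrow> complex mat) \<Rightarrow> real" where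
  "diamond_dist d d' \<Lambda>0 \<Lambda>1 = (SUP R \<in> {R. density_operator (d * d) R}.
     trace_dist (map_tensor_id d d' d \<Lambda>0 R) (map_tensor_id d d' d \<Lambda>1 R))"

text \<open>Maps on operators are total functions on \<open>complex mat\<close>; two channels are distinct if they
  differ somewhere on the operators on \<open>H\<^sub>A\<close>. Values elsewhere are irrelevant.\<close>

definition CDP :: "nat \<Rightarrow> nat \<Rightarrow> complex mat \<Rightarrow> real" where
  "CDP dA dB R = Inf {trace_dist (map_tensor_id dA d' dB \<Lambda>0 R) (map_tensor_id dA d' dB \<Lambda>1 R)
        / diamond_dist dA d' \<Lambda>0 \<Lambda>1 | d' \<Lambda>0 \<Lambda>1.
     channel dA d' \<Lambda>0 \<and> channel dA d' \<Lambda>1 \<and> (\<exists>X \<in> carrier_mat dA dA. \<Lambda>0 X \<noteq> \<Lambda>1 X)}"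

text \<open>\<open>n\<close> orthonormal vectors in an \<open>n\<close>-dimensional space form a basis.\<close>

definition orthonormal_basis :: "nat \<Rightarrow> (nat \<Rightarrow> complex vec) \<Rightarrow> bool" where
  "orthonormal_basis n a \<longleftrightarrow> (\<forall>i<n. a i \<in> carrier_vec n) \<and>
     (\<forall>i<n. \<forall>j<n. a i \<bullet>c a j = (if i = j then 1 else 0))"

definition ket_bra :: "complex vec \<Rightarrow> complex mat" where
  "ket_bra v = mat (dim_vec v) (dim_vec v) (\<lambda>(i, j). v $ i * cnj (v $ j))"

definition proj_measurement :: "nat \<Rightarrow> (nat \<Rightarrow> complex vec) \<Rightarrow> complex mat \<Rightarrow> complex mat" where
  "proj_measurement n a L =
     mat n n (\<lambda>rc. \<Sum>i<n. (ket_bra (a i) * L * ket_bra (a i)) $$ rc)"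

end

(* A channel discriminates through the blocks of the state, so the operator Schmidt rank enters as
   follows: the rank of sigma is less than dA^2 iff some K \<noteq> 0 on H_A annihilates sigma, i.e.
   tr_A((K \<otimes> 1) sigma) = 0. For Hermitian sigma one may take K Hermitian with operator norm 1. The two
   measurements with effects (1 + K)/2, (1 - K)/2 in one order and in the other then give the same
   result on sigma, are perfectly distinguished on an eigenvector of K with eigenvalue 1 or -1 (so
   their diamond distance is at least 1), and on rho have trace distance
   ||tr_A((K \<otimes> 1)(rho - sigma))||_1 \<le> ||rho - sigma||_1. Everything about the trace norm is read off
   from the duality ||X||_1 = max {Re tr(C X) | C a Hermitian contraction} for Hermitian X. Duality also
   gives lower semicontinuity, so the minima are attained because channels and orthonormal bases
   form sequentially compact sets and the rank condition is closed under limits. *)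

theory Submission
  imports Defs
begin

section \<open>Compactness and linear systems\<close>

text \<open>The factor 2 arises as follows. The two measurements differ by X \<mapsto> tr(KX) times
  the flag |0><0| - |1><1|. The flag has trace norm 2, which cancels the 1/2 in the trace distance
  of the outputs, so the bound is the full trace norm of rho - sigma, that is 2 D(rho, sigma). The
  obstacle in the rank condition is its closedness: decompositions into few product terms need not
  stay bounded along a convergent sequence of operators. Annihilators can be normalized, so a
  subsequence of them converges to a nonzero annihilator of the limit. The obstacle in the trace
  norm is that \<open>psd_sqrt\<close> is a definite description. It says nothing before existence
  and uniqueness of the positive square root are known, which is why a spectral theorem comes first.
  Once the duality is available, neither square roots nor the definition of the norm have to be
  opened for the estimates.\<close>

lemma Bseq_complex_convergent_subseq:
  fixes f :: "nat \<Rightarrow> complex"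
  assumes "\<And>n. cmod (f n) \<le> B"
  shows "\<exists>r l. strict_mono r \<and> (\<lambda>n. f (r n)) \<longlonglongrightarrow> l"
proof -
  \<comment> \<open>Every real sequence has a monotone subsequence. Thin out for the real parts,
    then once more for the imaginary parts; bounded monotone sequences converge.\<close>
  obtain r :: "nat \<Rightarrow> nat" where r: "strict_mono r" "monoseq (\<lambda>n. Re (f (r n)))"
    using seq_monosub[of "\<lambda>n. Re (f n)"] by auto
  have "Bseq (\<lambda>n. Re (f (r n)))"
    by (rule BseqI'[of _ B]) (use assms in \<open>auto intro: order_trans[OF abs_Re_le_cmod]\<close>)
  then obtain x where x: "(\<lambda>n. Re (f (r n))) \<longlonglongrightarrow> x"
    using Bseq_monoseq_convergent r(2) by (auto simp: convergent_def)
  obtain s :: "nat \<Rightarrow> nat" where s: "strict_mono s" "monoseq (\<lambda>n. Im (f (r (s n))))"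
    using seq_monosub[of "\<lambda>n. Im (f (r n))"] by blast
  have "Bseq (\<lambda>n. Im (f (r (s n))))"
    by (rule BseqI'[of _ B]) (use assms in \<open>auto intro: order_trans[OF abs_Im_le_cmod]\<close>)
  then obtain y where y: "(\<lambda>n. Im (f (r (s n)))) \<longlonglongrightarrow> y"
    using Bseq_monoseq_convergent s(2) by (auto simp: convergent_def)
  have "(\<lambda>n. Re (f (r (s n)))) \<longlonglongrightarrow> x"
    using LIMSEQ_subseq_LIMSEQ[OF x s(1)] by (simp add: o_def)
  with y have "(\<lambda>n. Complex (Re (f (r (s n)))) (Im (f (r (s n))))) \<longlonglongrightarrow> Complex x y"
    by (rule tendsto_Complex[rotated])
  moreover have "strict_mono (r \<circ> s)" using r(1) s(1) by (rule strict_mono_o)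
  ultimately show ?thesis by (intro exI[of _ "r \<circ> s"] exI[of _ "Complex x y"]) (simp add: o_def)
qed

text \<open>With a finite index set, one index after the other can be thinned out and no diagonal
  argument arises. Vectors, bases, annihilators and channels all enter as such finite families of
  entries.\<close>

lemma bounded_family_convergent_subseq:
  fixes f :: "nat \<Rightarrow> 'i \<Rightarrow> complex"
  assumes "finite S" "\<And>n i. i \<in> S \<Longrightarrow> cmod (f n i) \<le> B"
  shows "\<exists>r l. strict_mono (r :: nat \<Rightarrow> nat) \<and> (\<forall>i\<in>S. (\<lambda>n. f (r n) i) \<longlonglongrightarrow> l i)"
  using assms
proof (induction S)
  case empty
  then show ?case by (intro exI[of _ id]) (auto simp: strict_mono_def)
next
  case (insert x S)
  then obtain r l where r: "strict_mono (r :: nat \<Rightarrow> nat)"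
    and l: "\<And>i. i \<in> S \<Longrightarrow> (\<lambda>n. f (r n) i) \<longlonglongrightarrow> l i" by (metis insertCI)
  obtain s y where s: "strict_mono s" and y: "(\<lambda>n. f (r (s n)) x) \<longlonglongrightarrow> y"
    using Bseq_complex_convergent_subseq[of "\<lambda>n. f (r n) x" B] insert.prems by auto
  have "(\<lambda>n. f ((r \<circ> s) n) i) \<longlonglongrightarrow> (l(x := y)) i" if "i \<in> insert x S" for i
  proof (cases "i = x")
    case False
    then show ?thesis
      using LIMSEQ_subseq_LIMSEQ[OF l[of i] s] that by (auto simp: o_def)
  qed (use y in auto)
  moreover have "strict_mono (r \<circ> s)" using r s by (rule strict_mono_o)
  ultimately show ?case by blast
qed

text \<open>The direct method, with compactness and lower semicontinuity merged into the premise
  \<open>lsc\<close>. It serves three times: for the quadratic form, the channels and the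
  bases.\<close>

lemma exists_arg_min_of_seq_lsc:
  fixes f :: "'a \<Rightarrow> real"
  assumes P: "P x0" and lower: "\<And>x. P x \<Longrightarrow> B \<le> f x"
    and lsc: "\<And>s L. (\<And>n::nat. P (s n)) \<Longrightarrow> (\<lambda>n. f (s n)) \<longlonglongrightarrow> L \<Longrightarrow> \<exists>x. P x \<and> f x \<le> L"
  shows "\<exists>x. is_arg_min f P x"
proof -
  let ?I = "Inf (f ` Collect P)"
  have bdd: "bdd_below (f ` Collect P)" using lower by (auto intro!: bdd_belowI[of _ B])
  have ne: "f ` Collect P \<noteq> {}" using P by auto
  have "\<exists>x. P x \<and> f x < ?I + 1 / real (Suc n)" for n
    using cInf_lessD[OF ne, of "?I + 1 / real (Suc n)"] by (auto simp del: of_nat_Suc)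
  then obtain s where s: "\<And>n. P (s n)" "\<And>n. f (s n) < ?I + 1 / real (Suc n)" by metis
  have low: "?I \<le> f x" if "P x" for x using that bdd by (auto intro: cInf_lower)
  have "(\<lambda>n. f (s n)) \<longlonglongrightarrow> ?I"
  proof (rule tendsto_sandwich[of "\<lambda>_. ?I" _ _ "\<lambda>n. ?I + 1 / real (Suc n)"])
    show "(\<lambda>n. ?I + 1 / real (Suc n)) \<longlonglongrightarrow> ?I"
      using tendsto_add[OF tendsto_const[of ?I] LIMSEQ_inverse_real_of_nat]
      by (simp add: inverse_eq_divide)
  qed (use s low in \<open>auto intro!: always_eventually less_imp_le\<close>)
  then obtain x where "P x" "f x \<le> ?I" using lsc s(1) by blast
  then show ?thesis using low by (fastforce simp: is_arg_min_def)
qed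

text \<open>Pad the equations with zero rows to a square matrix. As \<open>m < n\<close>, row
  \<open>m\<close> is zero, so the transpose kills \<open>unit_vec n m\<close> and the determinant
  vanishes.\<close>

lemma exists_nonzero_solution:
  fixes M :: "nat \<Rightarrow> nat \<Rightarrow> complex"
  assumes "m < n"
  shows "\<exists>x. (\<exists>j<n. x j \<noteq> 0) \<and> (\<forall>i<m. (\<Sum>j<n. M i j * x j) = 0)"
proof -
  define A where "A = mat n n (\<lambda>(i, j). if i < m then M i j else 0)"
  have A: "A \<in> carrier_mat n n" by (simp add: A_def)
  have "transpose_mat A *\<^sub>v unit_vec n m = 0\<^sub>v n"
    using assms by (intro eq_vecI) (auto simp: A_def)
  moreover have "unit_vec n m \<noteq> (0\<^sub>v n :: complex vec)"
    using assms by (auto dest: arg_cong[of _ _ "\<lambda>v. v $ m"])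
  ultimately have "det (transpose_mat A) = 0"
    using det_0_iff_vec_prod_zero[of "transpose_mat A" n] A
    by (meson transpose_carrier_mat unit_vec_carrier)
  then have "det A = 0" using det_transpose[OF A] by simp
  then obtain v where v: "v \<in> carrier_vec n" "v \<noteq> 0\<^sub>v n" "A *\<^sub>v v = 0\<^sub>v n"
    using det_0_iff_vec_prod_zero[OF A] by auto
  have "(\<Sum>j<n. M i j * v $ j) = 0" if "i < m" for i
  proof -
    have "(A *\<^sub>v v) $ i = (\<Sum>j<n. M i j * v $ j)"
      using that assms v(1) by (simp add: A_def scalar_prod_def atLeast0LessThan)
    then show ?thesis using v(3) that assms by simp
  qed
  moreover have "\<exists>j<n. v $ j \<noteq> 0" using v(1,2) by (auto intro!: eq_vecI)
  ultimately show ?thesis by blast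
qed

section \<open>The spectral theorem\<close>

text \<open>Vectors are functions of which only the values below \<open>n\<close> count, so slices
  and limits of vectors are plain lambda terms. The first argument is the conjugated one, whereas
  \<open>\<bullet>c\<close> conjugates the second.\<close>

definition cip :: "nat \<Rightarrow> (nat \<Rightarrow> complex) \<Rightarrow> (nat \<Rightarrow> complex) \<Rightarrow> complex" where
  "cip n x y = (\<Sum>r<n. cnj (x r) * y r)"

definition mv :: "nat \<Rightarrow> complex mat \<Rightarrow> (nat \<Rightarrow> complex) \<Rightarrow> nat \<Rightarrow> complex" where
  "mv n X y r = (\<Sum>c<n. X $$ (r, c) * y c)"

definition sesq :: "nat \<Rightarrow> complex mat \<Rightarrow> (nat \<Rightarrow> complex) \<Rightarrow> (nat \<Rightarrow> complex) \<Rightarrow> complex" where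
  "sesq n X x y = (\<Sum>r<n. \<Sum>c<n. cnj (x r) * X $$ (r, c) * y c)"

definition hermitian :: "nat \<Rightarrow> complex mat \<Rightarrow> bool" where
  "hermitian n X \<longleftrightarrow> X \<in> carrier_mat n n \<and> (\<forall>i<n. \<forall>j<n. X $$ (j, i) = cnj (X $$ (i, j)))"

definition onb :: "nat \<Rightarrow> (nat \<Rightarrow> nat \<Rightarrow> complex) \<Rightarrow> bool" where
  "onb n u \<longleftrightarrow> (\<forall>i<n. \<forall>j<n. cip n (u i) (u j) = (if i = j then 1 else 0))"

lemma sesq_eq_cip_mv: "sesq n X x y = cip n x (mv n X y)"
  by (simp add: sesq_def cip_def mv_def sum_distrib_left mult.assoc)

lemma cip_cnj: "cnj (cip n x y) = cip n y x"
  by (simp add: cip_def mult.commute)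

lemma hermitianD: "hermitian n X \<Longrightarrow> r < n \<Longrightarrow> c < n \<Longrightarrow> cnj (X $$ (r, c)) = X $$ (c, r)"
  unfolding hermitian_def by metis

lemma sesq_hermitian:
  assumes "hermitian n X"
  shows "cnj (sesq n X x y) = sesq n X y x"
proof -
  have "cnj (sesq n X x y) = (\<Sum>r<n. \<Sum>c<n. cnj (y c) * X $$ (c, r) * x r)"
    unfolding sesq_def cnj_sum
    by (intro sum.cong refl) (simp add: hermitianD[OF assms] ac_simps)
  also have "\<dots> = sesq n X y x" unfolding sesq_def by (rule sum.swap)
  finally show ?thesis .
qed

lemma cip_add: "cip n x (\<lambda>r. y r + z r) = cip n x y + cip n x z"
    "cip n (\<lambda>r. y r + z r) x = cip n y x + cip n z x"
  by (simp_all add: cip_def algebra_simps sum.distrib)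

lemma cip_scale: "cip n x (\<lambda>r. a * y r) = a * cip n x y"
    "cip n (\<lambda>r. a * y r) x = cnj a * cip n y x"
  by (simp_all add: cip_def algebra_simps sum_distrib_left)

lemma mv_add: "mv n X (\<lambda>r. y r + z r) = (\<lambda>r. mv n X y r + mv n X z r)"
  by (simp add: mv_def algebra_simps sum.distrib fun_eq_iff)

lemma mv_scale: "mv n X (\<lambda>r. a * y r) = (\<lambda>r. a * mv n X y r)"
  by (simp add: mv_def algebra_simps sum_distrib_left fun_eq_iff)

lemma sesq_add: "sesq n X x (\<lambda>r. y r + z r) = sesq n X x y + sesq n X x z"
    "sesq n X (\<lambda>r. y r + z r) x = sesq n X y x + sesq n X z x"
  by (simp_all add: sesq_eq_cip_mv cip_add mv_add)

lemma sesq_scale: "sesq n X x (\<lambda>r. a * y r) = a * sesq n X x y"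
    "sesq n X (\<lambda>r. a * y r) x = cnj a * sesq n X y x"
  by (simp_all add: sesq_eq_cip_mv cip_scale mv_scale)

lemma cip_self: "cip n x x = of_real (\<Sum>r<n. (cmod (x r))\<^sup>2)"
  by (simp add: cip_def complex_norm_square mult.commute del: of_real_power)

lemma Re_cip_self: "Re (cip n x x) = (\<Sum>r<n. (cmod (x r))\<^sup>2)"
  by (simp add: cip_self)

lemma cip_self_eq_0D: "Re (cip n x x) = 0 \<Longrightarrow> r < n \<Longrightarrow> x r = 0"
  by (simp add: Re_cip_self sum_nonneg_eq_0_iff)

lemma cip_normalize:
  assumes "Re (cip n x x) \<noteq> 0"
  defines "s \<equiv> 1 / sqrt (Re (cip n x x))"
  shows "cip n (\<lambda>r. of_real s * x r) (\<lambda>r. of_real s * x r) = 1"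
proof -
  define N where "N = Re (cip n x x)"
  have "0 \<le> N" by (simp add: N_def Re_cip_self sum_nonneg)
  then have N: "0 < N" using assms(1) unfolding N_def by linarith
  have c: "cip n x x = of_real N" by (simp add: N_def cip_self)
  have "s * s * N = 1" using N by (simp add: s_def N_def[symmetric])
  then have "complex_of_real s * (of_real s * of_real N) = 1"
    by (metis mult.assoc of_real_1 of_real_mult)
  then show ?thesis by (simp only: cip_scale complex_cnj_complex_of_real c)
qed

text \<open>The new eigenvector minimizes the quadratic form over the unit vectors orthogonal to the
  given eigenvectors.\<close>

lemma hermitian_next_eigenvector:
  assumes X: "hermitian n X" and k: "k < n"
    and l: "\<And>i r. i < k \<Longrightarrow> r < n \<Longrightarrow> mv n X (u i) r = complex_of_real (l i) * u i r"
  shows "\<exists>v \<mu>. cip n v v = 1 \<and> (\<forall>i<k. cip n (u i) v = 0) \<and>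
     (\<forall>r<n. mv n X v r = complex_of_real \<mu> * v r)"
proof -
  define W where "W x \<longleftrightarrow> (\<forall>i<k. cip n (u i) x = 0)" for x
  define P where "P x \<longleftrightarrow> cip n x x = 1 \<and> W x" for x
  define q where "q x = Re (sesq n X x x)" for x
  have W_add: "W (\<lambda>r. x r + y r)" if "W x" "W y" for x y
    using that by (simp add: W_def cip_add)
  have W_scale: "W (\<lambda>r. a * x r)" if "W x" for x a
    using that by (simp add: W_def cip_scale)
  have normalize: "P (\<lambda>r. of_real (1 / sqrt (Re (cip n x x))) * x r)"
    if "W x" "Re (cip n x x) \<noteq> 0" for x
    using that cip_normalize[of n x] by (simp add: P_def W_scale del: of_real_divide)
  \<comment> \<open>Fewer than \<open>n\<close> orthogonality conditions leave a nonzero vector;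
    normalized, it shows that the set to minimize over is not empty.\<close>
  obtain x0 where x0: "\<exists>r<n. x0 r \<noteq> 0" "\<forall>i<k. (\<Sum>r<n. cnj (u i r) * x0 r) = 0"
    using exists_nonzero_solution[of k n "\<lambda>i r. cnj (u i r)"]
    by (metis k)
  have "P (\<lambda>r. of_real (1 / sqrt (Re (cip n x0 x0))) * x0 r)"
  proof (rule normalize)
    show "W x0" using x0(2) by (simp add: W_def cip_def)
    show "Re (cip n x0 x0) \<noteq> 0" using x0(1) cip_self_eq_0D by metis
  qed
  then obtain x1 where x1: "P x1" by blast
  have le1: "cmod (x r) \<le> 1" if "P x" "r < n" for x r
  proof -
    have "(cmod (x r))\<^sup>2 \<le> (\<Sum>r<n. (cmod (x r))\<^sup>2)" using that by (intro member_le_sum) auto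
    also have "\<dots> = 1" using that Re_cip_self[of n x] by (simp add: P_def)
    finally show ?thesis by (simp add: power_le_one_iff)
  qed
  \<comment> \<open>Entries of unit vectors have modulus at most 1. This gives both the crude lower
    bound and convergent subsequences; the conditions in \<open>P\<close> are equations and survive
    the limit.\<close>
  have "\<exists>x. is_arg_min q P x"
  proof (rule exists_arg_min_of_seq_lsc[where B = "- (\<Sum>r<n. \<Sum>c<n. cmod (X $$ (r, c)))"])
    show "P x1" by (rule x1)
    show "- (\<Sum>r<n. \<Sum>c<n. cmod (X $$ (r, c))) \<le> q x" if x: "P x" for x
    proof -
      have "cmod (sesq n X x x) \<le> (\<Sum>r<n. \<Sum>c<n. cmod (X $$ (r, c)))"
        unfolding sesq_def
      proof (intro order_trans[OF norm_sum] sum_mono)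
        fix r c assume "r \<in> {..<n}" "c \<in> {..<n}"
        then have "cmod (x r) * cmod (x c) \<le> 1" using le1[OF x] by (simp add: mult_le_one)
        then have "cmod (X $$ (r, c)) * (cmod (x r) * cmod (x c)) \<le> cmod (X $$ (r, c))"
          by (simp add: mult_left_le)
        then show "cmod (cnj (x r) * X $$ (r, c) * x c) \<le> cmod (X $$ (r, c))"
          by (simp add: norm_mult ac_simps)
      qed
      then show ?thesis using abs_Re_le_cmod[of "sesq n X x x"] unfolding q_def by linarith
    qed
    fix s L assume s: "\<And>m::nat. P (s m)" and L: "(\<lambda>m. q (s m)) \<longlonglongrightarrow> L"
    obtain f x where f: "strict_mono f" and x: "\<And>r. r < n \<Longrightarrow> (\<lambda>m. s (f m) r) \<longlonglongrightarrow> x r"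
      using bounded_family_convergent_subseq[of "{..<n}" s 1] le1[OF s] by (metis finite_lessThan lessThan_iff)
    have c: "(\<lambda>m. cip n (s (f m)) (s (f m))) \<longlonglongrightarrow> cip n x x"
      unfolding cip_def by (intro tendsto_intros x) auto
    have w: "(\<lambda>m. cip n (u i) (s (f m))) \<longlonglongrightarrow> cip n (u i) x" for i
      unfolding cip_def by (intro tendsto_intros x) auto
    have "(\<lambda>m. q (s (f m))) \<longlonglongrightarrow> q x"
      unfolding q_def sesq_def by (intro tendsto_intros x) auto
    then have "q x = L"
      using LIMSEQ_subseq_LIMSEQ[OF L f] LIMSEQ_unique by (auto simp: o_def)
    moreover have "P x"
    proof -
      have "cip n x x = 1" using c s by (simp add: P_def LIMSEQ_const_iff)
      moreover have "cip n (u i) x = 0" if "i < k" for i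
        using w[of i] s that by (simp add: P_def W_def LIMSEQ_const_iff)
      ultimately show ?thesis by (simp add: P_def W_def)
    qed
    ultimately show "\<exists>x. P x \<and> q x \<le> L" by auto
  qed
  then obtain v where v: "P v" and min: "\<And>x. P x \<Longrightarrow> q v \<le> q x"
    by (auto simp: is_arg_min_linorder)
  define \<mu> where "\<mu> = q v"
  \<comment> \<open>Homogeneity extends the minimality from unit vectors to all of \<open>W\<close>,
    so the perturbed vectors below need no normalization.\<close>
  have min_W: "\<mu> * Re (cip n x x) \<le> q x" if "W x" for x
  proof (cases "Re (cip n x x) = 0")
    case True
    then have "x r = 0" if "r < n" for r using that by (rule cip_self_eq_0D)
    then have "sesq n X x x = 0" by (simp add: sesq_def)
    then show ?thesis using True by (simp add: q_def)
  next
    case False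
    define N where "N = Re (cip n x x)"
    have "0 \<le> N" by (simp add: N_def Re_cip_self sum_nonneg)
    then have N: "0 < N" using False unfolding N_def by linarith
    have "\<mu> \<le> q (\<lambda>r. of_real (1 / sqrt N) * x r)"
      unfolding \<mu>_def N_def by (intro min normalize that False)
    also have "\<dots> = (1 / sqrt N) * (1 / sqrt N) * q x"
      by (simp add: q_def sesq_scale del: of_real_divide)
    also have "\<dots> = q x / N" using N by (simp add: field_simps)
    finally show ?thesis using N by (simp add: N_def[symmetric] field_simps)
  qed
  have sv: "sesq n X v v = of_real \<mu>"
    using sesq_hermitian[OF X, of v v] by (simp add: \<mu>_def q_def complex_eq_iff)
  have vv: "cip n v v = 1" and Wv: "W v" using v by (auto simp: P_def)
  \<comment> \<open>The residual of the eigenvalue equation. It lies in \<open>W\<close> because a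
    Hermitian operator maps the orthogonal complement of eigenvectors into itself, so
    \<open>v\<close> may be perturbed along it.\<close>
  define w where "w r = mv n X v r + (- of_real \<mu>) * v r" for r
  have vw: "cip n v w = 0"
    unfolding w_def cip_add cip_scale using vv sv by (simp add: sesq_eq_cip_mv)
  have "cip n (u i) w = 0" if i: "i < k" for i
  proof -
    have "cip n (u i) (mv n X v) = cnj (sesq n X v (u i))"
      using sesq_hermitian[OF X, of v "u i"] by (simp add: sesq_eq_cip_mv)
    also have "sesq n X v (u i) = l i * cip n v (u i)"
      unfolding sesq_eq_cip_mv cip_def using l[OF i] by (simp add: sum_distrib_left ac_simps)
    finally show ?thesis
      using Wv i cip_cnj[of n v "u i"] unfolding w_def cip_add cip_scale by (simp add: W_def)
  qed
  then have Ww: "W w" by (simp add: W_def)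
  define N where "N = Re (cip n w w)"
  have N0: "0 \<le> N" by (simp add: N_def Re_cip_self sum_nonneg)
  have wXv: "sesq n X w v = of_real N"
  proof -
    have "mv n X v = (\<lambda>r. w r + of_real \<mu> * v r)" by (simp add: w_def fun_eq_iff)
    then have "sesq n X w v = cip n w (\<lambda>r. w r + of_real \<mu> * v r)" by (simp add: sesq_eq_cip_mv)
    also have "\<dots> = cip n w w"
      unfolding cip_add cip_scale using vw cip_cnj[of n v w] by simp
    finally show ?thesis by (simp add: N_def cip_self)
  qed
  \<comment> \<open>First variation: \<open>sesq n X v w\<close> and \<open>sesq n X w v\<close>
    both equal \<open>N\<close>, so the slope at \<open>t = 0\<close> is
    \<open>2 * N\<close>.\<close>
  have perturb: "0 \<le> 2 * t * N + t\<^sup>2 * (q w - \<mu> * N)" for t :: real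
  proof -
    have "W (\<lambda>r. v r + of_real t * w r)" by (intro W_add W_scale Wv Ww)
    from min_W[OF this]
    have "\<mu> * Re (cip n (\<lambda>r. v r + of_real t * w r) (\<lambda>r. v r + of_real t * w r))
        \<le> q (\<lambda>r. v r + of_real t * w r)" .
    moreover have "Re (cip n (\<lambda>r. v r + of_real t * w r) (\<lambda>r. v r + of_real t * w r)) = 1 + t\<^sup>2 * N"
      unfolding cip_add cip_scale using vw cip_cnj[of n v w] vv
      by (simp add: N_def power2_eq_square)
    moreover have "q (\<lambda>r. v r + of_real t * w r) = \<mu> + 2 * t * N + t\<^sup>2 * q w"
    proof -
      have "sesq n X v w = of_real N" using sesq_hermitian[OF X, of w v] wXv by simp
      then show ?thesis
        unfolding q_def sesq_add sesq_scale using wXv sv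
        by (simp add: power2_eq_square algebra_simps)
    qed
    ultimately show ?thesis by (simp add: algebra_simps)
  qed
  have "N = 0"
  proof (rule ccontr)
    assume "N \<noteq> 0"
    then have N: "0 < N" using N0 by simp
    \<comment> \<open>With \<open>C\<close> above the quadratic coefficient,
      \<open>t = - (N / C)\<close> lets the linear term win and contradicts \<open>perturb\<close>.
      The summand 1 keeps \<open>C\<close> positive.\<close>
    define C where "C = \<bar>q w - \<mu> * N\<bar> + 1"
    have C: "0 < C" "q w - \<mu> * N < C" by (auto simp: C_def)
    have "(N / C)\<^sup>2 * (q w - \<mu> * N) < (N / C)\<^sup>2 * C"
      using N C by (intro mult_strict_left_mono) auto
    also have "\<dots> = (N / C) * N" using C by (simp add: power2_eq_square)
    finally have "(N / C)\<^sup>2 * (q w - \<mu> * N) < (N / C) * N" .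
    moreover have "0 \<le> 2 * (- (N / C)) * N + (- (N / C))\<^sup>2 * (q w - \<mu> * N)" by (rule perturb)
    then have "0 \<le> - 2 * ((N / C) * N) + (N / C)\<^sup>2 * (q w - \<mu> * N)"
      by (simp only: power2_minus mult_minus_left mult_minus_right mult.assoc)
    moreover have "0 < (N / C) * N" using N C by simp
    ultimately show False by linarith
  qed
  then have "w r = 0" if "r < n" for r using that cip_self_eq_0D[of n w r] by (simp add: N_def)
  then have ev: "mv n X v r = of_real \<mu> * v r" if "r < n" for r using that by (simp add: w_def)
  show ?thesis using vv Wv ev unfolding W_def by metis
qed

lemma hermitian_eigenvectors:
  assumes X: "hermitian n X" and "k \<le> n"
  shows "\<exists>u l. (\<forall>i<k. \<forall>j<k. cip n (u i) (u j) = (if i = j then 1 else 0)) \<and>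
     (\<forall>i<k. \<forall>r<n. mv n X (u i) r = complex_of_real (l i) * u i r)"
  using assms(2)
proof (induction k)
  case 0
  show ?case by simp
next
  case (Suc k)
  then have k: "k < n" "k \<le> n" by simp_all
  obtain u l where
    u: "\<forall>i<k. \<forall>j<k. cip n (u i) (u j) = (if i = j then 1 else 0)"
    and l: "\<forall>i<k. \<forall>r<n. mv n X (u i) r = complex_of_real (l i) * u i r"
    using Suc.IH[OF k(2)] by (elim exE conjE) (rule that)
  obtain v \<mu> where v: "cip n v v = 1" "\<forall>i<k. cip n (u i) v = 0"
      "\<forall>r<n. mv n X v r = complex_of_real \<mu> * v r"
    using hermitian_next_eigenvector[OF X k(1), of u l] l by (elim meta_impE exE conjE) (simp, rule that)
  have vu: "cip n v (u i) = 0" if "i < k" for i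
    using v(2) that cip_cnj[of n "u i" v] by simp
  let ?u = "u(k := v)" and ?l = "l(k := \<mu>)"
  have "\<forall>i<Suc k. \<forall>j<Suc k. cip n (?u i) (?u j) = (if i = j then 1 else 0)"
    using u v vu by (simp add: less_Suc_eq)
  moreover have "\<forall>i<Suc k. \<forall>r<n. mv n X (?u i) r = complex_of_real (?l i) * ?u i r"
    using l v by (simp add: less_Suc_eq)
  ultimately show ?case by blast
qed

text \<open>The operator with eigenvectors \<open>u i\<close> and eigenvalues \<open>l i\<close>
  when \<open>u\<close> is orthonormal. Squares, absolute values and signs of operators become
  operations on \<open>l\<close>.\<close>

definition spec_mat :: "nat \<Rightarrow> (nat \<Rightarrow> nat \<Rightarrow> complex) \<Rightarrow> (nat \<Rightarrow> real) \<Rightarrow> complex mat" where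
  "spec_mat n u l = mat n n (\<lambda>(r, c). \<Sum>i<n. of_real (l i) * u i r * cnj (u i c))"

lemma spec_mat_carrier [simp]: "spec_mat n u l \<in> carrier_mat n n"
  by (simp add: spec_mat_def)

lemma spec_mat_index:
  "r < n \<Longrightarrow> c < n \<Longrightarrow> spec_mat n u l $$ (r, c) = (\<Sum>i<n. of_real (l i) * u i r * cnj (u i c))"
  by (simp add: spec_mat_def)

lemma sum_delta_lessThan:
  fixes i n :: nat
  shows
  "i < n \<Longrightarrow> (\<Sum>j<n. (if i = j then 1 else 0) * f j) = (f i :: complex)"
  "i < n \<Longrightarrow> (\<Sum>j<n. (if j = i then 1 else 0) * f j) = (f i :: complex)"
  "i < n \<Longrightarrow> (\<Sum>j<n. f j * (if i = j then 1 else 0)) = (f i :: complex)"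
  "i < n \<Longrightarrow> (\<Sum>j<n. f j * (if j = i then 1 else 0)) = (f i :: complex)"
  by (simp_all add: if_distrib[of "\<lambda>x. x * _"] if_distrib[of "\<lambda>x. _ * x"] cong: if_cong)

lemma sum_rotate:
  "(\<Sum>r\<in>A. \<Sum>c\<in>B. \<Sum>i\<in>C. f r c i) = (\<Sum>i\<in>C. \<Sum>r\<in>A. \<Sum>c\<in>B. f r c i)"
proof -
  have "(\<Sum>r\<in>A. \<Sum>c\<in>B. \<Sum>i\<in>C. f r c i) = (\<Sum>r\<in>A. \<Sum>i\<in>C. \<Sum>c\<in>B. f r c i)"
    by (intro sum.cong refl sum.swap)
  also have "\<dots> = (\<Sum>i\<in>C. \<Sum>r\<in>A. \<Sum>c\<in>B. f r c i)" by (rule sum.swap)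
  finally show ?thesis .
qed

lemma onbD: "onb n u \<Longrightarrow> i < n \<Longrightarrow> j < n \<Longrightarrow> cip n (u i) (u j) = (if i = j then 1 else 0)"
  by (simp add: onb_def)

text \<open>Orthonormality is \<open>A * B = 1\<^sub>m n\<close> for two square matrices, and
  completeness is \<open>B * A = 1\<^sub>m n\<close>; a one-sided inverse of a square matrix is
  two-sided.\<close>

lemma onb_complete:
  assumes u: "onb n u" and "r < n" "c < n"
  shows "(\<Sum>i<n. u i r * cnj (u i c)) = (if r = c then 1 else 0)"
proof -
  define A where "A = mat n n (\<lambda>(i, r). cnj (u i r))"
  define B where "B = mat n n (\<lambda>(r, j). u j r)"
  have AB: "A \<in> carrier_mat n n" "B \<in> carrier_mat n n" by (simp_all add: A_def B_def)
  have "A * B = 1\<^sub>m n"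
  proof (rule eq_matI)
    fix i j assume "i < dim_row (1\<^sub>m n :: complex mat)" "j < dim_col (1\<^sub>m n :: complex mat)"
    then have "i < n" "j < n" by simp_all
    then show "(A * B) $$ (i, j) = 1\<^sub>m n $$ (i, j)"
      using onbD[OF u, of i j]
      by (simp add: A_def B_def scalar_prod_def cip_def atLeast0LessThan)
  qed (simp_all add: A_def B_def)
  then have "B * A = 1\<^sub>m n" by (rule mat_mult_left_right_inverse[OF AB])
  then have "(B * A) $$ (r, c) = (if r = c then 1 else 0)" using assms by simp
  then show ?thesis
    using assms by (simp add: A_def B_def scalar_prod_def atLeast0LessThan)
qed

lemma hermitian_spectral:
  assumes X: "hermitian n X"
  shows "\<exists>u l. onb n u \<and> X = spec_mat n u l"
proof -
  obtain u l where u: "onb n u"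
    and l: "\<forall>i<n. \<forall>r<n. mv n X (u i) r = complex_of_real (l i) * u i r"
    using hermitian_eigenvectors[OF X order_refl] unfolding onb_def[symmetric]
    by (elim exE conjE) (rule that)
  have "X $$ (r, c) = spec_mat n u l $$ (r, c)" if rc: "r < n" "c < n" for r c
  proof -
    \<comment> \<open>Insert the resolution of the identity at the column index, then apply the
      eigenvalue equation.\<close>
    have "X $$ (r, c) = (\<Sum>d<n. X $$ (r, d) * (\<Sum>i<n. u i d * cnj (u i c)))"
      using rc by (simp add: onb_complete[OF u] if_distrib[of "\<lambda>x. _ * x"] cong: if_cong)
    also have "\<dots> = (\<Sum>i<n. mv n X (u i) r * cnj (u i c))"
      unfolding mv_def sum_distrib_left sum_distrib_right
      by (subst sum.swap) (simp add: mult.assoc)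
    also have "\<dots> = spec_mat n u l $$ (r, c)"
      using rc l by (simp add: spec_mat_index)
    finally show ?thesis .
  qed
  then have "X = spec_mat n u l"
    using X by (intro eq_matI) (auto simp: hermitian_def spec_mat_def)
  with u show ?thesis by blast
qed

lemma hermitian_spec_mat [simp]: "hermitian n (spec_mat n u l)"
  by (simp add: hermitian_def spec_mat_index ac_simps)

lemma sesq_spec_mat:
  "sesq n (spec_mat n u l) x y = (\<Sum>i<n. of_real (l i) * cip n x (u i) * cip n (u i) y)"
proof -
  have "sesq n (spec_mat n u l) x y =
      (\<Sum>r<n. \<Sum>c<n. \<Sum>i<n. of_real (l i) * (cnj (x r) * u i r) * (cnj (u i c) * y c))"
    unfolding sesq_def
    by (intro sum.cong refl) (simp add: spec_mat_index sum_distrib_left sum_distrib_right ac_simps)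
  also have "\<dots> = (\<Sum>i<n. \<Sum>r<n. \<Sum>c<n. of_real (l i) * (cnj (x r) * u i r) * (cnj (u i c) * y c))"
    by (rule sum_rotate)
  also have "\<dots> = (\<Sum>i<n. of_real (l i) * (cip n x (u i) * cip n (u i) y))"
    unfolding cip_def sum_product by (simp only: sum_distrib_left mult.assoc)
  finally show ?thesis by (simp only: mult.assoc)
qed

text \<open>By completeness the identity operator is \<open>spec_mat\<close> with all eigenvalues 1;
  its sesquilinear form is evaluated in two ways.\<close>

lemma onb_parseval:
  assumes "onb n u"
  shows "(\<Sum>i<n. cip n x (u i) * cip n (u i) y) = cip n x y"
proof -
  have "(\<Sum>i<n. cip n x (u i) * cip n (u i) y) = sesq n (spec_mat n u (\<lambda>_. 1)) x y"
    by (simp add: sesq_spec_mat)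
  also have "\<dots> = (\<Sum>r<n. \<Sum>c<n. cnj (x r) * (if r = c then 1 else 0) * y c)"
    unfolding sesq_def by (intro sum.cong refl) (simp add: spec_mat_index onb_complete[OF assms])
  also have "\<dots> = cip n x y"
    by (simp add: cip_def if_distrib[of "\<lambda>x. x * _"] if_distrib[of "\<lambda>x. _ * x"] cong: if_cong)
  finally show ?thesis .
qed

lemma onb_parseval_norm:
  assumes "onb n u"
  shows "(\<Sum>i<n. (cmod (cip n (u i) x))\<^sup>2) = Re (cip n x x)"
proof -
  have "cip n x (u i) * cip n (u i) x = of_real ((cmod (cip n (u i) x))\<^sup>2)" for i
    using cip_cnj[of n "u i" x] by (simp add: complex_norm_square mult.commute del: of_real_power)
  then have "cip n x x = of_real (\<Sum>i<n. (cmod (cip n (u i) x))\<^sup>2)"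
    using onb_parseval[OF assms, of x x] by (simp del: of_real_power)
  then show ?thesis by simp
qed

lemma sesq_spec_mat_self:
  "sesq n (spec_mat n u l) x x = of_real (\<Sum>i<n. l i * (cmod (cip n (u i) x))\<^sup>2)"
proof -
  have "cip n x (u i) * cip n (u i) x = of_real ((cmod (cip n (u i) x))\<^sup>2)" for i
    using cip_cnj[of n "u i" x] by (simp add: complex_norm_square mult.commute del: of_real_power)
  then show ?thesis by (simp add: sesq_spec_mat mult.assoc del: of_real_power)
qed

lemma sesq_spec_mat_left:
  assumes "onb n u" "i < n"
  shows "sesq n (spec_mat n u l) (u i) y = of_real (l i) * cip n (u i) y"
proof -
  have "sesq n (spec_mat n u l) (u i) y =
      (\<Sum>j<n. (if i = j then 1 else 0) * (of_real (l j) * cip n (u j) y))"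
    unfolding sesq_spec_mat by (intro sum.cong refl) (simp add: onbD[OF assms(1)] assms(2))
  then show ?thesis using assms(2) by (simp only: sum_delta_lessThan)
qed

lemma sesq_spec_mat_right:
  assumes "onb n u" "i < n"
  shows "sesq n (spec_mat n u l) y (u i) = of_real (l i) * cip n y (u i)"
proof -
  have "sesq n (spec_mat n u l) y (u i) =
      (\<Sum>j<n. (of_real (l j) * cip n y (u j)) * (if j = i then 1 else 0))"
    unfolding sesq_spec_mat by (intro sum.cong refl) (simp add: onbD[OF assms(1)] assms(2))
  then show ?thesis using assms(2) by (simp only: sum_delta_lessThan)
qed

lemma mat_eq_if_sesq_eq:
  assumes X: "X \<in> carrier_mat n n" and Y: "Y \<in> carrier_mat n n" and u: "onb n u" and w: "onb n w"
    and eq: "\<And>i j. i < n \<Longrightarrow> j < n \<Longrightarrow> sesq n X (u i) (w j) = sesq n Y (u i) (w j)"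
  shows "X = Y"
proof -
  have expand: "Z $$ (r, c) = (\<Sum>i<n. \<Sum>j<n. u i r * sesq n Z (u i) (w j) * cnj (w j c))"
    if rc: "r < n" "c < n" for Z r c
  proof -
    have 1: "(\<Sum>j<n. sesq n Z x (w j) * cnj (w j c)) = (\<Sum>s<n. cnj (x s) * Z $$ (s, c))" for x
    proof -
      have "(\<Sum>j<n. sesq n Z x (w j) * cnj (w j c)) =
          (\<Sum>j<n. \<Sum>s<n. \<Sum>d<n. (cnj (x s) * Z $$ (s, d)) * (w j d * cnj (w j c)))"
        by (simp add: sesq_def sum_distrib_right mult.assoc)
      also have "\<dots> = (\<Sum>s<n. \<Sum>d<n. \<Sum>j<n. (cnj (x s) * Z $$ (s, d)) * (w j d * cnj (w j c)))"
        by (rule sum_rotate[symmetric])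
      also have "\<dots> = (\<Sum>s<n. \<Sum>d<n. (cnj (x s) * Z $$ (s, d)) * (if d = c then 1 else 0))"
        using rc by (simp add: sum_distrib_left[symmetric] onb_complete[OF w])
      finally show ?thesis using rc by (simp only: sum_delta_lessThan)
    qed
    have "(\<Sum>i<n. \<Sum>j<n. u i r * sesq n Z (u i) (w j) * cnj (w j c)) =
        (\<Sum>i<n. u i r * (\<Sum>s<n. cnj (u i s) * Z $$ (s, c)))"
      by (simp add: 1[symmetric] sum_distrib_left mult.assoc)
    also have "\<dots> = (\<Sum>i<n. \<Sum>s<n. (u i r * cnj (u i s)) * Z $$ (s, c))"
      by (simp add: sum_distrib_left mult.assoc)
    also have "\<dots> = (\<Sum>s<n. (\<Sum>i<n. u i r * cnj (u i s)) * Z $$ (s, c))"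
      by (subst sum.swap) (simp add: sum_distrib_right)
    also have "\<dots> = (\<Sum>s<n. (if r = s then 1 else 0) * Z $$ (s, c))"
      using rc by (simp add: onb_complete[OF u])
    finally show ?thesis using rc by (simp only: sum_delta_lessThan)
  qed
  show ?thesis
  proof (rule eq_matI)
    fix r c assume "r < dim_row Y" "c < dim_col Y"
    then have "r < n" "c < n" using Y by auto
    then show "X $$ (r, c) = Y $$ (r, c)" by (simp add: expand eq)
  qed (use X Y in auto)
qed

text \<open>In the eigenbasis each factor contributes its eigenvalue when moved onto the left vector
  \<open>u i\<close>.\<close>

lemma spec_mat_square:
  assumes "onb n u"
  shows "spec_mat n u l * spec_mat n u l = spec_mat n u (\<lambda>i. (l i)\<^sup>2)"
proof (rule mat_eq_if_sesq_eq[OF _ _ assms assms])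
  fix i j assume ij: "i < n" "j < n"
  let ?S = "spec_mat n u l"
  have mv: "mv n (?S * ?S) y r = mv n ?S (mv n ?S y) r" if "r < n" for y r
  proof -
    have "mv n (?S * ?S) y r = (\<Sum>c<n. \<Sum>k<n. ?S $$ (r, k) * ?S $$ (k, c) * y c)"
      using that unfolding mv_def
      by (intro sum.cong refl)
        (simp add: scalar_prod_def atLeast0LessThan sum_distrib_right spec_mat_def)
    also have "\<dots> = mv n ?S (mv n ?S y) r"
      unfolding mv_def sum_distrib_left by (subst sum.swap) (simp add: mult.assoc)
    finally show ?thesis .
  qed
  have "sesq n (?S * ?S) (u i) (u j) = sesq n ?S (u i) (mv n ?S (u j))"
    unfolding sesq_eq_cip_mv cip_def using mv by simp
  also have "\<dots> = of_real (l i) * sesq n ?S (u i) (u j)"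
    using sesq_spec_mat_left[OF assms ij(1), of l "mv n ?S (u j)"] by (simp only: sesq_eq_cip_mv)
  also have "\<dots> = sesq n (spec_mat n u (\<lambda>i. (l i)\<^sup>2)) (u i) (u j)"
    by (simp add: sesq_spec_mat_left[OF assms ij(1)] power2_eq_square)
  finally show "sesq n (?S * ?S) (u i) (u j) = sesq n (spec_mat n u (\<lambda>i. (l i)\<^sup>2)) (u i) (u j)" .
qed (simp_all add: mult_carrier_mat[of _ n n])

section \<open>Positive operators and the trace norm\<close>

lemma quadratic_form_eq_sesq:
  assumes "X \<in> carrier_mat n n" "v \<in> carrier_vec n"
  shows "(X *\<^sub>v v) \<bullet>c v = sesq n X (\<lambda>i. v $ i) (\<lambda>i. v $ i)"
  using assms unfolding sesq_eq_cip_mv cip_def mv_def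
  by (simp add: scalar_prod_def atLeast0LessThan mult.commute)

lemma psd_iff: "psd n X \<longleftrightarrow> X \<in> carrier_mat n n \<and> (\<forall>x. 0 \<le> sesq n X x x)"
proof (intro iffI conjI allI)
  fix x assume X: "psd n X"
  have "sesq n X (\<lambda>i. vec n x $ i) (\<lambda>i. vec n x $ i) = sesq n X x x"
    unfolding sesq_def by simp
  then show "0 \<le> sesq n X x x"
    using X quadratic_form_eq_sesq[of X n "vec n x"] unfolding psd_def by (metis vec_carrier)
next
  assume "X \<in> carrier_mat n n \<and> (\<forall>x. 0 \<le> sesq n X x x)"
  then show "psd n X" using quadratic_form_eq_sesq[of X n] by (auto simp: psd_def)
qed (auto simp: psd_def)

lemma psd_sesq_nonneg: "psd n X \<Longrightarrow> 0 \<le> sesq n X x x"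
  by (simp add: psd_iff)

lemma sesq_eq_sum_support:
  assumes "S \<subseteq> {..<n}" "\<And>r. r \<notin> S \<Longrightarrow> x r = 0"
  shows "sesq n X x x = (\<Sum>r\<in>S. \<Sum>c\<in>S. cnj (x r) * X $$ (r, c) * x c)"
proof -
  have "sesq n X x x = (\<Sum>r\<in>S. \<Sum>c<n. cnj (x r) * X $$ (r, c) * x c)"
    unfolding sesq_def using assms by (intro sum.mono_neutral_right) auto
  also have "\<dots> = (\<Sum>r\<in>S. \<Sum>c\<in>S. cnj (x r) * X $$ (r, c) * x c)"
    using assms by (intro sum.cong refl sum.mono_neutral_right) auto
  finally show ?thesis .
qed

lemma psd_diag_nonneg:
  assumes "psd n X" "r < n"
  shows "0 \<le> X $$ (r, r)"
proof -
  have "sesq n X (\<lambda>i. if i = r then 1 else 0) (\<lambda>i. if i = r then 1 else 0) = X $$ (r, r)"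
    using assms(2) by (subst sesq_eq_sum_support[of "{r}"]) auto
  then show ?thesis
    using psd_sesq_nonneg[OF assms(1), of "\<lambda>i. if i = r then 1 else 0"] by (simp only:)
qed

text \<open>Positivity tested on e_r + z e_c. The values 1 and \<open>\<i>\<close> of
  \<open>z\<close> give Hermiticity, a suitable phase gives the bound on the entries.\<close>

lemma psd_two_dim:
  assumes "psd n X" "r < n" "c < n" "r \<noteq> c"
  shows "0 \<le> X $$ (r, r) + X $$ (c, c) * (z * cnj z) + (X $$ (r, c) * z + X $$ (c, r) * cnj z)"
proof -
  let ?x = "\<lambda>i. if i = r then 1 else if i = c then z else 0"
  have "sesq n X ?x ?x = (\<Sum>i\<in>{r, c}. \<Sum>j\<in>{r, c}. cnj (?x i) * X $$ (i, j) * ?x j)"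
    using assms by (intro sesq_eq_sum_support) simp_all
  also have "\<dots> = X $$ (r, r) + X $$ (c, c) * (z * cnj z) + (X $$ (r, c) * z + X $$ (c, r) * cnj z)"
    using assms(4) by (simp add: algebra_simps)
  finally show ?thesis using psd_sesq_nonneg[OF assms(1), of ?x] by (simp only:)
qed

lemma psd_hermitian:
  assumes X: "psd n X"
  shows "hermitian n X"
proof -
  have "X $$ (c, r) = cnj (X $$ (r, c))" if rc: "r < n" "c < n" for r c
  proof (cases "r = c")
    case True
    then show ?thesis using psd_diag_nonneg[OF X rc(1)] by (simp add: complex_eq_iff less_eq_complex_def)
  next
    case False
    have "Im (X $$ (r, r)) = 0" "Im (X $$ (c, c)) = 0"
      using psd_diag_nonneg[OF X rc(1)] psd_diag_nonneg[OF X rc(2)] by (auto simp: less_eq_complex_def)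
    \<comment> \<open>\<open>z = 1\<close> shows that the imaginary parts of the two entries cancel,
      \<open>z = \<i>\<close> that the real parts agree.\<close>
    then show ?thesis
      using psd_two_dim[OF X rc False, of 1] psd_two_dim[OF X rc False, of \<i>]
      by (simp add: complex_eq_iff less_eq_complex_def)
  qed
  moreover have "X \<in> carrier_mat n n" using X by (simp add: psd_def)
  ultimately show ?thesis unfolding hermitian_def by blast
qed

text \<open>Applied to Choi operators, whose trace is fixed, this supplies the boundedness behind
  the compactness of the channels.\<close>

lemma psd_entry_bound:
  assumes X: "psd n X" and rc: "r < n" "c < n"
  shows "cmod (X $$ (r, c)) \<le> Re (mat_trace X)"
proof -
  have tr: "Re (mat_trace X) = (\<Sum>i<n. Re (X $$ (i, i)))"
    using X by (auto simp: mat_trace_def psd_iff)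
  have d: "0 \<le> Re (X $$ (i, i))" "cmod (X $$ (i, i)) = Re (X $$ (i, i))" if "i < n" for i
    using psd_diag_nonneg[OF X that] by (auto simp: less_eq_complex_def cmod_eq_Re)
  have le: "Re (X $$ (i, i)) \<le> Re (mat_trace X)" if "i < n" for i
    unfolding tr using that d(1) by (intro member_le_sum) auto
  show ?thesis
  proof (cases "r = c \<or> X $$ (r, c) = 0")
    case True
    then show ?thesis using d[OF rc(1)] le[OF rc(1)] by auto
  next
    case False
    \<comment> \<open>The phase that turns the entry into minus its modulus. Then twice the modulus
      is at most the sum of two diagonal entries, each of which is at most the trace.\<close>
    define z where "z = - cnj (X $$ (r, c)) / cmod (X $$ (r, c))"
    have nz: "cmod (X $$ (r, c)) \<noteq> 0" using False by simp
    have zz: "z * cnj z = 1"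
      using nz unfolding z_def
      by (simp add: complex_norm_square[symmetric] power2_eq_square mult.commute)
    have xz: "X $$ (r, c) * z = - of_real (cmod (X $$ (r, c)))"
      using nz unfolding z_def
      by (simp add: complex_norm_square[symmetric] power2_eq_square)
    have "X $$ (c, r) * cnj z = cnj (X $$ (r, c) * z)"
      using hermitianD[OF psd_hermitian[OF X] rc] by simp
    then have "0 \<le> Re (X $$ (r, r)) + Re (X $$ (c, c)) - 2 * cmod (X $$ (r, c))"
      using psd_two_dim[OF X rc, of z] False unfolding zz xz by (simp add: less_eq_complex_def)
    then show ?thesis using le[OF rc(1)] le[OF rc(2)] by linarith
  qed
qed

lemma psd_spec_mat: "(\<And>i. i < n \<Longrightarrow> 0 \<le> l i) \<Longrightarrow> psd n (spec_mat n u l)"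
  unfolding psd_iff sesq_spec_mat_self by (auto intro!: sum_nonneg simp: less_eq_complex_def)

lemma psd_spectral:
  assumes "psd n X"
  shows "\<exists>u l. onb n u \<and> X = spec_mat n u l \<and> (\<forall>i<n. 0 \<le> l i)"
proof -
  obtain u l where u: "onb n u" and X: "X = spec_mat n u l"
    using hermitian_spectral[OF psd_hermitian[OF assms]] by blast
  have "0 \<le> l i" if "i < n" for i
    using psd_sesq_nonneg[OF assms, of "u i"] onbD[OF u that that]
    unfolding X sesq_spec_mat_left[OF u that] by (simp add: less_eq_complex_def)
  with u X show ?thesis by blast
qed

text \<open>For eigenvectors \<open>u i\<close> of \<open>Y\<close> and \<open>w j\<close> of
  \<open>Z\<close>, equal squares force either a vanishing overlap or equal squared eigenvalues,
  hence equal eigenvalues by positivity. In both cases the matrix elements of \<open>Y\<close> and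
  \<open>Z\<close> between the two vectors agree.\<close>

lemma psd_square_inj:
  assumes Y: "psd n Y" and Z: "psd n Z" and eq: "Y * Y = Z * Z"
  shows "Y = Z"
proof -
  obtain u l where u: "onb n u" and Yu: "Y = spec_mat n u l" and l: "\<forall>i<n. 0 \<le> l i"
    using psd_spectral[OF Y] by blast
  obtain w m where w: "onb n w" and Zw: "Z = spec_mat n w m" and m: "\<forall>i<n. 0 \<le> m i"
    using psd_spectral[OF Z] by blast
  show ?thesis
  proof (rule mat_eq_if_sesq_eq[OF _ _ u w])
    fix i j assume ij: "i < n" "j < n"
    have "of_real ((l i)\<^sup>2) * cip n (u i) (w j) = of_real ((m j)\<^sup>2) * cip n (u i) (w j)"
      using eq unfolding Yu Zw spec_mat_square[OF u] spec_mat_square[OF w]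
      by (metis sesq_spec_mat_left[OF u ij(1)] sesq_spec_mat_right[OF w ij(2)])
    then have "cip n (u i) (w j) = 0 \<or> (l i)\<^sup>2 = (m j)\<^sup>2" by (auto simp del: of_real_power)
    then have "cip n (u i) (w j) = 0 \<or> l i = m j" using l m ij by (auto simp: power2_eq_iff_nonneg)
    then show "sesq n Y (u i) (w j) = sesq n Z (u i) (w j)"
      unfolding Yu Zw sesq_spec_mat_left[OF u ij(1)] sesq_spec_mat_right[OF w ij(2)] by auto
  qed (simp_all add: Yu Zw)
qed

section \<open>The trace norm: eigenvalues and duality with contractions\<close>

lemma mat_trace_spec_mat:
  assumes "onb n u"
  shows "mat_trace (spec_mat n u l) = of_real (\<Sum>i<n. l i)"
proof -
  have "mat_trace (spec_mat n u l) = (\<Sum>r<n. \<Sum>i<n. of_real (l i) * (cnj (u i r) * u i r))"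
    by (simp add: mat_trace_def spec_mat_def ac_simps)
  also have "\<dots> = (\<Sum>i<n. of_real (l i) * cip n (u i) (u i))"
    by (subst sum.swap) (simp add: cip_def sum_distrib_left)
  finally show ?thesis using onbD[OF assms] by simp
qed

lemma mat_adjoint_hermitian:
  assumes "hermitian n X"
  shows "mat_adjoint X = X"
proof (rule eq_matI)
  have X: "X \<in> carrier_mat n n" using assms by (simp add: hermitian_def)
  fix i j assume "i < dim_row X" "j < dim_col X"
  then have ij: "i < n" "j < n" using X by auto
  then have "mat_adjoint X $$ (i, j) = cnj (X $$ (j, i))"
    using X by (simp add: mat_adjoint_def mat_of_rows_def)
  then show "mat_adjoint X $$ (i, j) = X $$ (i, j)" using hermitianD[OF assms] ij by simp
qed (use assms in \<open>auto simp: hermitian_def mat_adjoint_def\<close>)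

text \<open>The operator with the same eigenvectors and eigenvalues \<open>\<bar>l i\<bar>\<close>
  is a positive root of \<open>mat_adjoint X * X\<close>; by uniqueness it is the one that
  \<open>psd_sqrt\<close> describes.\<close>

lemma trace_norm_spec_mat:
  assumes u: "onb n u"
  shows "trace_norm (spec_mat n u l) = (\<Sum>i<n. \<bar>l i\<bar>)"
proof -
  let ?X = "spec_mat n u l" and ?A = "spec_mat n u (\<lambda>i. \<bar>l i\<bar>)"
  have sq: "?A * ?A = mat_adjoint ?X * ?X"
    by (simp add: mat_adjoint_hermitian[OF hermitian_spec_mat] spec_mat_square[OF u])
  have "psd_sqrt (mat_adjoint ?X * ?X) = ?A"
    unfolding psd_sqrt_def
  proof (rule the_equality)
    have dim: "dim_row (mat_adjoint ?X * ?X) = n"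
      unfolding sq[symmetric] by (simp add: spec_mat_def)
    show "psd (dim_row (mat_adjoint ?X * ?X)) ?A \<and> ?A * ?A = mat_adjoint ?X * ?X"
      unfolding dim using sq psd_spec_mat[of n "\<lambda>i. \<bar>l i\<bar>" u] by simp
    show "Y = ?A" if "psd (dim_row (mat_adjoint ?X * ?X)) Y \<and> Y * Y = mat_adjoint ?X * ?X" for Y
      using that psd_square_inj[of n Y ?A] psd_spec_mat[of n "\<lambda>i. \<bar>l i\<bar>" u] sq unfolding dim by simp
  qed
  then show ?thesis by (simp add: trace_norm_def mat_trace_spec_mat[OF u])
qed

text \<open>The trace of \<open>C * X\<close>, written entrywise so that it passes to limits in
  \<open>X\<close> and splits over blocks.\<close>

definition tp :: "nat \<Rightarrow> complex mat \<Rightarrow> complex mat \<Rightarrow> complex" where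
  "tp n C X = (\<Sum>r<n. \<Sum>c<n. C $$ (r, c) * X $$ (c, r))"

text \<open>Hermitian with operator norm at most 1, expressed by quadratic forms as -1 \<le> C \<le>
  1; this form is easy to check for blocks and tensor products.\<close>

definition contraction :: "nat \<Rightarrow> complex mat \<Rightarrow> bool" where
  "contraction n C \<longleftrightarrow> hermitian n C \<and> (\<forall>x. \<bar>Re (sesq n C x x)\<bar> \<le> Re (cip n x x))"

lemma tp_spec_mat: "tp n C (spec_mat n u l) = (\<Sum>i<n. of_real (l i) * sesq n C (u i) (u i))"
proof -
  have "tp n C (spec_mat n u l) =
      (\<Sum>r<n. \<Sum>c<n. \<Sum>i<n. of_real (l i) * (cnj (u i r) * C $$ (r, c) * u i c))"
    unfolding tp_def
    by (intro sum.cong refl) (simp add: spec_mat_index sum_distrib_left ac_simps)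
  also have "\<dots> = (\<Sum>i<n. \<Sum>r<n. \<Sum>c<n. of_real (l i) * (cnj (u i r) * C $$ (r, c) * u i c))"
    by (rule sum_rotate)
  finally show ?thesis by (simp add: sesq_def sum_distrib_left)
qed

text \<open>In an eigenbasis of \<open>X\<close> the pairing is a sum of eigenvalues weighted by
  expectations of \<open>C\<close>, and these weights lie between -1 and 1.\<close>

lemma abs_tp_le_trace_norm:
  assumes X: "hermitian n X" and C: "contraction n C"
  shows "\<bar>Re (tp n C X)\<bar> \<le> trace_norm X"
proof -
  obtain u l where u: "onb n u" and Xu: "X = spec_mat n u l" using hermitian_spectral[OF X] by blast
  have "\<bar>Re (tp n C X)\<bar> \<le> (\<Sum>i<n. \<bar>l i * Re (sesq n C (u i) (u i))\<bar>)"
    by (simp add: Xu tp_spec_mat)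
  also have "\<dots> \<le> (\<Sum>i<n. \<bar>l i\<bar>)"
  proof (rule sum_mono)
    fix i assume "i \<in> {..<n}"
    then have "cip n (u i) (u i) = 1" using onbD[OF u] by simp
    then have "\<bar>Re (sesq n C (u i) (u i))\<bar> \<le> 1" using C unfolding contraction_def by (metis one_complex.sel(1))
    then show "\<bar>l i * Re (sesq n C (u i) (u i))\<bar> \<le> \<bar>l i\<bar>" by (simp add: abs_mult mult_left_le)
  qed
  finally show ?thesis using trace_norm_spec_mat[OF u] Xu by simp
qed

lemma trace_norm_ge: "hermitian n X \<Longrightarrow> contraction n C \<Longrightarrow> Re (tp n C X) \<le> trace_norm X"
  using abs_tp_le_trace_norm[of n X C] by linarith

lemma contraction_spec_mat:
  assumes u: "onb n u" and l: "\<And>i. i < n \<Longrightarrow> \<bar>l i\<bar> \<le> 1"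
  shows "contraction n (spec_mat n u l)"
  unfolding contraction_def
proof (intro conjI allI)
  fix x
  have "\<bar>Re (sesq n (spec_mat n u l) x x)\<bar> \<le> (\<Sum>i<n. \<bar>l i * (cmod (cip n (u i) x))\<^sup>2\<bar>)"
    unfolding sesq_spec_mat_self by simp
  also have "\<dots> \<le> (\<Sum>i<n. (cmod (cip n (u i) x))\<^sup>2)"
    using l by (intro sum_mono) (simp add: abs_mult mult_left_le_one_le)
  finally show "\<bar>Re (sesq n (spec_mat n u l) x x)\<bar> \<le> Re (cip n x x)"
    by (simp add: onb_parseval_norm[OF u])
qed simp

text \<open>The optimal contraction is the sign of \<open>X\<close>, with eigenvalues
  \<open>sgn (l i)\<close> in the eigenbasis of \<open>X\<close>.\<close>

lemma trace_norm_attained: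
  assumes X: "hermitian n X"
  shows "\<exists>C. contraction n C \<and> Re (tp n C X) = trace_norm X"
proof -
  obtain u l where u: "onb n u" and Xu: "X = spec_mat n u l" using hermitian_spectral[OF X] by blast
  have "tp n (spec_mat n u (\<lambda>i. sgn (l i))) X = (\<Sum>i<n. of_real \<bar>l i\<bar>)"
    unfolding Xu tp_spec_mat
    by (intro sum.cong refl)
      (simp add: sesq_spec_mat_left[OF u] onbD[OF u] of_real_mult[symmetric] abs_sgn del: of_real_mult)
  then have "Re (tp n (spec_mat n u (\<lambda>i. sgn (l i))) X) = trace_norm X"
    by (simp add: Xu trace_norm_spec_mat[OF u])
  moreover have "contraction n (spec_mat n u (\<lambda>i. sgn (l i)))"
    by (rule contraction_spec_mat[OF u]) (simp add: abs_sgn_eq)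
  ultimately show ?thesis by blast
qed

lemma trace_norm_nonneg:
  assumes "hermitian n X"
  shows "0 \<le> trace_norm X"
proof -
  obtain u l where u: "onb n u" and "X = spec_mat n u l" using hermitian_spectral[OF assms] by blast
  then show ?thesis by (simp add: trace_norm_spec_mat[OF u] sum_nonneg)
qed

lemma trace_norm_psd:
  assumes "psd n X"
  shows "trace_norm X = Re (mat_trace X)"
proof -
  obtain u l where u: "onb n u" and X: "X = spec_mat n u l" and l: "\<forall>i<n. 0 \<le> l i"
    using psd_spectral[OF assms] by blast
  show ?thesis unfolding X trace_norm_spec_mat[OF u] mat_trace_spec_mat[OF u] using l by simp
qed

lemma hermitian_minus:
  assumes "hermitian n X" "hermitian n Y"
  shows "hermitian n (X - Y)"
proof -
  have XY: "X \<in> carrier_mat n n" "Y \<in> carrier_mat n n" using assms by (simp_all add: hermitian_def)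
  have "(X - Y) $$ (c, r) = cnj ((X - Y) $$ (r, c))" if "r < n" "c < n" for r c
    using XY that by (simp add: hermitianD[OF assms(1)] hermitianD[OF assms(2)])
  moreover have "X - Y \<in> carrier_mat n n" using XY by auto
  ultimately show ?thesis unfolding hermitian_def by blast
qed

lemma tp_minus:
  "X \<in> carrier_mat n n \<Longrightarrow> Y \<in> carrier_mat n n \<Longrightarrow> tp n C (X - Y) = tp n C X - tp n C Y"
  unfolding tp_def by (simp add: algebra_simps sum_subtractf)

text \<open>The contraction that is optimal for the difference is admissible for each of the two
  operators.\<close>

lemma trace_norm_minus_le:
  assumes X: "hermitian n X" and Y: "hermitian n Y"
  shows "trace_norm (X - Y) \<le> trace_norm X + trace_norm Y"
proof -
  obtain C where C: "contraction n C" and eq: "Re (tp n C (X - Y)) = trace_norm (X - Y)"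
    using trace_norm_attained[OF hermitian_minus[OF X Y]] by blast
  have "- Re (tp n C Y) \<le> trace_norm Y" using abs_tp_le_trace_norm[OF Y C] by linarith
  moreover have "Re (tp n C X) \<le> trace_norm X" by (rule trace_norm_ge[OF X C])
  moreover have "tp n C (X - Y) = tp n C X - tp n C Y"
    using X Y by (intro tp_minus) (simp_all add: hermitian_def)
  ultimately show ?thesis using eq by simp
qed

lemma trace_dist_bounds:
  assumes "density_operator n R" "density_operator n S"
  shows "0 \<le> trace_dist R S" "trace_dist R S \<le> 1"
proof -
  have p: "psd n R" "psd n S" "mat_trace R = 1" "mat_trace S = 1"
    using assms by (simp_all add: density_operator_def)
  show "0 \<le> trace_dist R S"
    using trace_norm_nonneg[OF hermitian_minus[OF psd_hermitian[OF p(1)] psd_hermitian[OF p(2)]]]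
    by (simp add: trace_dist_def)
  show "trace_dist R S \<le> 1"
    using trace_norm_minus_le[OF psd_hermitian[OF p(1)] psd_hermitian[OF p(2)]] p(3,4)
    by (simp add: trace_dist_def trace_norm_psd[OF p(1)] trace_norm_psd[OF p(2)])
qed

text \<open>The pairing with the contraction that is optimal for the limit is continuous and bounds
  each norm of the sequence from below.\<close>

lemma trace_norm_lsc:
  assumes X: "\<And>m. hermitian n (X m)" and Y: "hermitian n Y"
    and lim: "\<And>r c. r < n \<Longrightarrow> c < n \<Longrightarrow> (\<lambda>m. X m $$ (r, c)) \<longlonglongrightarrow> Y $$ (r, c)"
    and L: "(\<lambda>m. trace_norm (X m)) \<longlonglongrightarrow> L"
  shows "trace_norm Y \<le> L"
proof -
  obtain C where C: "contraction n C" and eq: "Re (tp n C Y) = trace_norm Y"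
    using trace_norm_attained[OF Y] by blast
  have "(\<lambda>m. Re (tp n C (X m))) \<longlonglongrightarrow> Re (tp n C Y)"
    unfolding tp_def by (intro tendsto_intros lim) auto
  then show ?thesis
    unfolding eq by (rule LIMSEQ_le[OF _ L]) (use trace_norm_ge[OF X C] in auto)
qed

section \<open>Block structure of bipartite operators\<close>

lemma pair_index:
  fixes a j d k :: nat
  assumes "a < d" "j < k"
  shows "a * k + j < d * k" "(a * k + j) div k = a" "(a * k + j) mod k = j"
proof -
  have "a * k + j < Suc a * k" using assms by simp
  also have "\<dots> \<le> d * k" using assms by (intro mult_right_mono) auto
  finally show "a * k + j < d * k" .
qed (use assms in auto)

lemma sum_pair_index:
  fixes f :: "nat \<Rightarrow> 'a::comm_monoid_add"
  shows "(\<Sum>r<d * k. f r) = (\<Sum>a<d. \<Sum>j<k. f (a * k + j))"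
proof -
  have "(\<Sum>r<d * k. f r) = (\<Sum>a<d. sum f {a * k..<a * k + k})"
    by (rule sum.nat_group[symmetric])
  also have "\<dots> = (\<Sum>a<d. \<Sum>j<k. f (a * k + j))"
    by (simp add: sum.atLeastLessThan_shift_0[of f] atLeast0LessThan)
  finally show ?thesis .
qed

text \<open>Moves the indices of the second tensor factor outward, so that the inner double sum
  belongs to a single block.\<close>

lemma sum_regroup4:
  "(\<Sum>a\<in>A. \<Sum>j\<in>J. \<Sum>b\<in>B. \<Sum>l\<in>L. f a j b l) = (\<Sum>j\<in>J. \<Sum>l\<in>L. \<Sum>a\<in>A. \<Sum>b\<in>B. f a j b l)"
proof -
  have "(\<Sum>a\<in>A. \<Sum>j\<in>J. \<Sum>b\<in>B. \<Sum>l\<in>L. f a j b l) = (\<Sum>j\<in>J. \<Sum>a\<in>A. \<Sum>b\<in>B. \<Sum>l\<in>L. f a j b l)"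
    by (rule sum.swap)
  also have "\<dots> = (\<Sum>j\<in>J. \<Sum>l\<in>L. \<Sum>a\<in>A. \<Sum>b\<in>B. f a j b l)"
    by (intro sum.cong refl sum_rotate)
  finally show ?thesis .
qed

lemma pair_eq_matI:
  assumes "X \<in> carrier_mat (d * k) (d * k)" "Y \<in> carrier_mat (d * k) (d * k)"
    and eq: "\<And>a b j l. a < d \<Longrightarrow> b < d \<Longrightarrow> j < k \<Longrightarrow> l < k \<Longrightarrow>
      X $$ (a * k + j, b * k + l) = Y $$ (a * k + j, b * k + l)"
  shows "X = Y"
proof (rule eq_matI)
  fix r c assume "r < dim_row Y" "c < dim_col Y"
  then have rc: "r < d * k" "c < d * k" using assms by auto
  then have k: "0 < k" by (cases k) auto
  have "X $$ (r div k * k + r mod k, c div k * k + c mod k)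
      = Y $$ (r div k * k + r mod k, c div k * k + c mod k)"
    using rc k by (intro eq) (auto simp: less_mult_imp_div_less)
  then show "X $$ (r, c) = Y $$ (r, c)" by simp
qed (use assms in auto)

lemma sesq_pair:
  "sesq (d * k) X x y = (\<Sum>j<k. \<Sum>l<k. \<Sum>a<d. \<Sum>b<d.
     cnj (x (a * k + j)) * X $$ (a * k + j, b * k + l) * y (b * k + l))"
  unfolding sesq_def sum_pair_index by (rule sum_regroup4)

lemma tp_pair:
  "tp (d * k) C X = (\<Sum>j<k. \<Sum>l<k. \<Sum>a<d. \<Sum>b<d.
     C $$ (a * k + j, b * k + l) * X $$ (b * k + l, a * k + j))"
  unfolding tp_def sum_pair_index by (rule sum_regroup4)

lemma cip_pair: "cip (d * k) x y = (\<Sum>a<d. \<Sum>j<k. cnj (x (a * k + j)) * y (a * k + j))"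
  unfolding cip_def sum_pair_index ..

lemma block_carrier [simp]: "block d k X j l \<in> carrier_mat d d"
  by (simp add: block_def)

lemma block_index: "a < d \<Longrightarrow> b < d \<Longrightarrow> block d k X j l $$ (a, b) = X $$ (a * k + j, b * k + l)"
  by (simp add: block_def)

lemma sesq_block:
  "sesq d (block d k X j l) x y = (\<Sum>a<d. \<Sum>b<d. cnj (x a) * X $$ (a * k + j, b * k + l) * y b)"
  unfolding sesq_def by (intro sum.cong refl) (simp add: block_index)

lemma map_tensor_id_carrier [simp]: "map_tensor_id d d' k \<Lambda> X \<in> carrier_mat (d' * k) (d' * k)"
  by (simp add: map_tensor_id_def)

lemma map_tensor_id_index:
  assumes "a < d'" "b < d'" "j < k" "l < k"
  shows "map_tensor_id d d' k \<Lambda> X $$ (a * k + j, b * k + l) = \<Lambda> (block d k X j l) $$ (a, b)"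
  using assms by (simp add: map_tensor_id_def pair_index)

lemma mat_trace_pair:
  assumes "X \<in> carrier_mat (d * k) (d * k)"
  shows "mat_trace X = (\<Sum>j<k. mat_trace (block d k X j j))"
proof -
  have "mat_trace X = (\<Sum>a<d. \<Sum>j<k. X $$ (a * k + j, a * k + j))"
    using assms by (simp add: mat_trace_def sum_pair_index)
  also have "\<dots> = (\<Sum>j<k. \<Sum>a<d. X $$ (a * k + j, a * k + j))" by (rule sum.swap)
  also have "\<dots> = (\<Sum>j<k. mat_trace (block d k X j j))"
    unfolding mat_trace_def by (intro sum.cong refl) (simp_all add: block_def)
  finally show ?thesis .
qed

text \<open>The trace is the sum of the traces of the diagonal blocks, and the channel preserves
  each of them.\<close>

lemma mat_trace_map_tensor_id:
  assumes ch: "channel d d' \<Lambda>" and R: "R \<in> carrier_mat (d * k) (d * k)"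
  shows "mat_trace (map_tensor_id d d' k \<Lambda> R) = mat_trace R"
proof -
  let ?M = "map_tensor_id d d' k \<Lambda> R"
  have L: "\<Lambda> (block d k R j l) \<in> carrier_mat d' d'" for j l
    using ch by (simp add: channel_def linear_op_map_def)
  have "block d' k ?M j j = \<Lambda> (block d k R j j)" if "j < k" for j
    using that L[of j j] by (intro eq_matI) (auto simp: block_index map_tensor_id_index block_def)
  then have "mat_trace ?M = (\<Sum>j<k. mat_trace (\<Lambda> (block d k R j j)))"
    by (simp add: mat_trace_pair[of _ d' k])
  also have "\<dots> = (\<Sum>j<k. mat_trace (block d k R j j))"
    using ch by (simp add: channel_def trace_preserving_def)
  also have "\<dots> = mat_trace R" using R by (simp add: mat_trace_pair)
  finally show ?thesis .
qed

lemma density_operator_map_tensor_id: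
  assumes ch: "channel d d' \<Lambda>" and R: "density_operator (d * k) R"
  shows "density_operator (d' * k) (map_tensor_id d d' k \<Lambda> R)"
  using assms mat_trace_map_tensor_id[OF ch, of R k]
  by (simp add: density_operator_def channel_def completely_positive_def psd_def)

section \<open>Measure-and-prepare channels\<close>

lemma sesq_mat_add: "X \<in> carrier_mat n n \<Longrightarrow> Y \<in> carrier_mat n n \<Longrightarrow>
    sesq n (X + Y) x y = sesq n X x y + sesq n Y x y"
  unfolding sesq_def by (simp add: algebra_simps sum.distrib)

lemma sesq_mat_smult: "X \<in> carrier_mat n n \<Longrightarrow> sesq n (c \<cdot>\<^sub>m X) x y = c * sesq n X x y"
  unfolding sesq_def by (simp add: algebra_simps sum_distrib_left)

text \<open>The map X \<mapsto> \<Sum>m. t_m <u_m|X|u_m> |w_m><w_m|. It covers the projective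
  measurements and the two discriminating measurements alike; the separate weights \<open>t\<close>
  avoid square roots of the effects.\<close>

definition measure_prepare :: "nat \<Rightarrow> nat \<Rightarrow> 'i set \<Rightarrow> ('i \<Rightarrow> real) \<Rightarrow> ('i \<Rightarrow> nat \<Rightarrow> complex) \<Rightarrow>
    ('i \<Rightarrow> nat \<Rightarrow> complex) \<Rightarrow> complex mat \<Rightarrow> complex mat" where
  "measure_prepare d d' M t u w X =
     mat d' d' (\<lambda>(r, c). \<Sum>m\<in>M. of_real (t m) * (w m r * cnj (w m c) * sesq d X (u m) (u m)))"

text \<open>A single outcome pulls the quadratic form at \<open>v\<close> back to that of
  \<open>X\<close> at the product vector of \<open>u\<close> with \<open>y v\<close>, the partial
  inner product of \<open>v\<close> with \<open>w\<close>. Complete positivity follows from this.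
  The quotient \<open>p div k\<close> is the index on the first factor, the remainder that on the
  second.\<close>

lemma sesq_measure_prepare_one:
  assumes Y: "\<And>a b j l. a < d' \<Longrightarrow> b < d' \<Longrightarrow> j < k \<Longrightarrow> l < k \<Longrightarrow>
      Y $$ (a * k + j, b * k + l) = w a * cnj (w b) * sesq d (block d k X j l) u u"
  defines "y \<equiv> (\<lambda>v j. \<Sum>a<d'. cnj (w a) * v (a * k + j))"
  shows "sesq (d' * k) Y v v = sesq (d * k) X (\<lambda>p. u (p div k) * y v (p mod k)) (\<lambda>p. u (p div k) * y v (p mod k))"
proof -
  have "sesq (d' * k) Y v v = (\<Sum>j<k. \<Sum>l<k. cnj (y v j) * y v l * sesq d (block d k X j l) u u)"
    unfolding sesq_pair
  proof (intro sum.cong refl)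
    fix j l assume jl: "j \<in> {..<k}" "l \<in> {..<k}"
    have "(\<Sum>a<d'. \<Sum>b<d'. cnj (v (a * k + j)) * Y $$ (a * k + j, b * k + l) * v (b * k + l)) =
        (\<Sum>a<d'. \<Sum>b<d'. (cnj (cnj (w a) * v (a * k + j)) * (cnj (w b) * v (b * k + l))) *
          sesq d (block d k X j l) u u)"
      using jl by (intro sum.cong refl, subst Y) (simp_all add: ac_simps)
    also have "\<dots> = cnj (y v j) * y v l * sesq d (block d k X j l) u u"
      unfolding y_def cnj_sum sum_product by (simp only: sum_distrib_right)
    finally show "(\<Sum>a<d'. \<Sum>b<d'. cnj (v (a * k + j)) * Y $$ (a * k + j, b * k + l) * v (b * k + l)) =
      cnj (y v j) * y v l * sesq d (block d k X j l) u u" .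
  qed
  also have "\<dots> = sesq (d * k) X (\<lambda>p. u (p div k) * y v (p mod k)) (\<lambda>p. u (p div k) * y v (p mod k))"
    unfolding sesq_pair sesq_block sum_distrib_left
    by (intro sum.cong refl) (simp add: pair_index ac_simps)
  finally show ?thesis .
qed

lemma channel_measure_prepare:
  assumes fin: "finite M" and t: "\<And>m. m \<in> M \<Longrightarrow> 0 \<le> t m"
    and w: "\<And>m. m \<in> M \<Longrightarrow> cip d' (w m) (w m) = 1"
    and u: "\<And>r c. r < d \<Longrightarrow> c < d \<Longrightarrow>
      (\<Sum>m\<in>M. of_real (t m) * (cnj (u m r) * u m c)) = (if r = c then 1 else 0)"
  shows "channel d d' (measure_prepare d d' M t u w)"
  unfolding channel_def
proof (intro conjI)
  let ?L = "measure_prepare d d' M t u w"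
  show "linear_op_map d d' ?L"
    unfolding linear_op_map_def
  proof (intro conjI ballI allI)
    show "?L X \<in> carrier_mat d' d'" for X :: "complex mat" by (simp add: measure_prepare_def)
    show "?L (X + Y) = ?L X + ?L Y" if "X \<in> carrier_mat d d" "Y \<in> carrier_mat d d" for X Y :: "complex mat"
      using that by (intro eq_matI)
        (auto simp: measure_prepare_def sesq_mat_add algebra_simps sum.distrib)
    show "?L (c \<cdot>\<^sub>m X) = c \<cdot>\<^sub>m ?L X" if "X \<in> carrier_mat d d" for X :: "complex mat" and c
      using that by (intro eq_matI)
        (auto simp: measure_prepare_def sesq_mat_smult algebra_simps sum_distrib_left)
  qed
  show "trace_preserving d ?L"
    unfolding trace_preserving_def
  proof
    fix X :: "complex mat" assume X: "X \<in> carrier_mat d d"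
    have "mat_trace (?L X) =
        (\<Sum>r<d'. \<Sum>m\<in>M. of_real (t m) * sesq d X (u m) (u m) * (cnj (w m r) * w m r))"
      by (simp add: mat_trace_def measure_prepare_def ac_simps)
    also have "\<dots> = (\<Sum>m\<in>M. of_real (t m) * sesq d X (u m) (u m) * cip d' (w m) (w m))"
      by (subst sum.swap) (simp add: cip_def sum_distrib_left)
    also have "\<dots> = (\<Sum>m\<in>M. \<Sum>r<d. \<Sum>c<d. X $$ (r, c) * (of_real (t m) * (cnj (u m r) * u m c)))"
      using w by (simp add: sesq_def sum_distrib_left ac_simps)
    also have "\<dots> = (\<Sum>r<d. \<Sum>c<d. \<Sum>m\<in>M. X $$ (r, c) * (of_real (t m) * (cnj (u m r) * u m c)))"
      by (rule sum_rotate[symmetric])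
    also have "\<dots> = (\<Sum>r<d. \<Sum>c<d. X $$ (r, c) * (if r = c then 1 else 0))"
      by (intro sum.cong refl) (simp add: sum_distrib_left[symmetric] u)
    also have "\<dots> = (\<Sum>r<d. X $$ (r, r))"
      by (intro sum.cong refl) (simp add: sum_delta_lessThan)
    finally show "mat_trace (?L X) = mat_trace X" using X by (simp add: mat_trace_def)
  qed
  show "completely_positive d d' ?L"
    unfolding completely_positive_def
  proof (intro allI impI)
    fix k X assume X: "psd (d * k) X"
    \<comment> \<open>The output of the single outcome \<open>m\<close> without its weight; the
      whole output is a combination of these with nonnegative coefficients.\<close>
    define Y where "Y m = mat (d' * k) (d' * k) (\<lambda>(r, c).
      w m (r div k) * cnj (w m (c div k)) * sesq d (block d k X (r mod k) (c mod k)) (u m) (u m))" for m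
    have Y: "Y m $$ (a * k + j, b * k + l) = w m a * cnj (w m b) * sesq d (block d k X j l) (u m) (u m)"
      if "a < d'" "b < d'" "j < k" "l < k" for m a b j l
      using that by (simp add: Y_def pair_index)
    have "0 \<le> sesq (d' * k) (map_tensor_id d d' k ?L X) v v" for v
    proof -
      have "sesq (d' * k) (map_tensor_id d d' k ?L X) v v = (\<Sum>r<d' * k. \<Sum>c<d' * k. \<Sum>m\<in>M.
          of_real (t m) * (cnj (v r) * Y m $$ (r, c) * v c))"
        unfolding sesq_def
        by (intro sum.cong refl)
          (auto simp: map_tensor_id_def measure_prepare_def Y_def less_mult_imp_div_less
            sum_distrib_left sum_distrib_right ac_simps)
      also have "\<dots> = (\<Sum>m\<in>M. of_real (t m) * sesq (d' * k) (Y m) v v)"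
        unfolding sesq_def sum_distrib_left by (rule sum_rotate)
      also have "0 \<le> \<dots>"
      proof (intro sum_nonneg)
        fix m assume "m \<in> M"
        then have "0 \<le> complex_of_real (t m)" using t by (simp add: less_eq_complex_def)
        moreover have "0 \<le> sesq (d' * k) (Y m) v v"
          by (subst sesq_measure_prepare_one[where w = "w m" and u = "u m" and d = d and X = X])
            (use Y psd_sesq_nonneg[OF X] in auto)
        ultimately show "0 \<le> of_real (t m) * sesq (d' * k) (Y m) v v"
          by (simp add: less_eq_complex_def)
      qed
      finally show ?thesis .
    qed
    then show "psd (d' * k) (map_tensor_id d d' k ?L X)" by (simp add: psd_iff)
  qed
qed

lemma map_tensor_id_cong:
  assumes "\<And>X. X \<in> carrier_mat d d \<Longrightarrow> \<Lambda> X = \<Lambda>' X"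
  shows "map_tensor_id d d' k \<Lambda> X = map_tensor_id d d' k \<Lambda>' X"
  unfolding map_tensor_id_def using assms by simp

text \<open>Maps are total functions, and \<open>proj_measurement\<close> is identified with a
  \<open>measure_prepare\<close> map on operators of the right size, so the channel property has to
  transfer along agreement there.\<close>

lemma channel_cong:
  assumes "channel d d' \<Lambda>'" and eq: "\<And>X. X \<in> carrier_mat d d \<Longrightarrow> \<Lambda> X = \<Lambda>' X"
  shows "channel d d' \<Lambda>"
proof -
  have "linear_op_map d d' \<Lambda>"
    using assms(1) unfolding channel_def linear_op_map_def by (simp add: eq)
  then show ?thesis
    using assms(1) unfolding channel_def completely_positive_def trace_preserving_def
    by (simp add: eq map_tensor_id_cong[of d \<Lambda> \<Lambda>', OF eq])
qed

section \<open>Operator Schmidt rank\<close>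

lemma kron_index:
  assumes "X \<in> carrier_mat d d" "Y \<in> carrier_mat k k" "a < d" "b < d" "j < k" "l < k"
  shows "kron X Y $$ (a * k + j, b * k + l) = X $$ (a, b) * Y $$ (j, l)"
  using assms by (auto simp: kron_def pair_index)

text \<open>An arbitrary index set lets pairs of matrix indices label the terms, and the entrywise
  form avoids sums of matrices.\<close>

definition osr_decomposition ::
    "nat \<Rightarrow> nat \<Rightarrow> complex mat \<Rightarrow> 'i set \<Rightarrow> ('i \<Rightarrow> complex mat) \<Rightarrow> ('i \<Rightarrow> complex mat) \<Rightarrow> bool" where
  "osr_decomposition dA dB R S X Y \<longleftrightarrow>
     (\<forall>s\<in>S. X s \<in> carrier_mat dA dA \<and> Y s \<in> carrier_mat dB dB) \<and>
     (\<forall>a<dA. \<forall>b<dA. \<forall>j<dB. \<forall>l<dB. R $$ (a * dB + j, b * dB + l) = (\<Sum>s\<in>S. X s $$ (a, b) * Y s $$ (j, l)))"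

lemma osr_decomposition_iff:
  assumes R: "R \<in> carrier_mat (dA * dB) (dA * dB)"
  shows "((\<forall>k<r. X k \<in> carrier_mat dA dA \<and> Y k \<in> carrier_mat dB dB) \<and>
     R = mat (dA * dB) (dA * dB) (\<lambda>rc. \<Sum>k<r. kron (X k) (Y k) $$ rc)) \<longleftrightarrow>
     osr_decomposition dA dB R {..<r} X Y" (is "?A \<and> R = ?M \<longleftrightarrow> _")
proof -
  have M: "?M $$ (a * dB + j, b * dB + l) = (\<Sum>k<r. X k $$ (a, b) * Y k $$ (j, l))"
    if ?A "a < dA" "b < dA" "j < dB" "l < dB" for a b j l
    using that by (simp add: pair_index kron_index[of _ dA _ dB])
  have "R = ?M" if dec: "osr_decomposition dA dB R {..<r} X Y"
  proof (rule pair_eq_matI[OF R])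
    have A: ?A using dec by (simp add: osr_decomposition_def)
    fix a b j l assume "a < dA" "b < dA" "j < dB" "l < dB"
    then show "R $$ (a * dB + j, b * dB + l) = ?M $$ (a * dB + j, b * dB + l)"
      using M[OF A] dec by (simp add: osr_decomposition_def)
  qed simp
  moreover have "osr_decomposition dA dB R {..<r} X Y" if A: ?A and eq: "R = ?M"
    unfolding osr_decomposition_def using A M[OF A] by (subst eq) auto
  ultimately show ?thesis by (auto simp: osr_decomposition_def)
qed

lemma operator_Schmidt_rank_eq:
  assumes "R \<in> carrier_mat (dA * dB) (dA * dB)"
  shows "operator_Schmidt_rank dA dB R = (LEAST r. \<exists>X Y. osr_decomposition dA dB R {..<r} X Y)"
  unfolding operator_Schmidt_rank_def osr_decomposition_iff[OF assms] ..

lemma osr_decomposition_card: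
  assumes "finite S" and dec: "osr_decomposition dA dB R S X Y"
  shows "\<exists>X Y. osr_decomposition dA dB R {..<card S} X Y"
proof -
  obtain h where h: "bij_betw h {..<card S} S"
    using ex_bij_betw_nat_finite[OF assms(1)] by (auto simp: atLeast0LessThan)
  have "osr_decomposition dA dB R {..<card S} (X \<circ> h) (Y \<circ> h)"
    unfolding osr_decomposition_def
  proof (intro conjI ballI allI impI)
    fix s assume "s \<in> {..<card S}"
    then have "h s \<in> S" using h by (auto simp: bij_betw_def)
    then show "(X \<circ> h) s \<in> carrier_mat dA dA" "(Y \<circ> h) s \<in> carrier_mat dB dB"
      using dec by (auto simp: osr_decomposition_def)
  next
    fix a b j l assume "a < dA" "b < dA" "j < dB" "l < dB"
    then have "R $$ (a * dB + j, b * dB + l) = (\<Sum>s\<in>S. X s $$ (a, b) * Y s $$ (j, l))"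
      using dec by (simp add: osr_decomposition_def)
    also have "\<dots> = (\<Sum>s<card S. X (h s) $$ (a, b) * Y (h s) $$ (j, l))"
      by (rule sum.reindex_bij_betw[OF h, symmetric])
    finally show "R $$ (a * dB + j, b * dB + l) =
        (\<Sum>s<card S. (X \<circ> h) s $$ (a, b) * (Y \<circ> h) s $$ (j, l))" by simp
  qed
  then show ?thesis by blast
qed

definition unit_mat :: "nat \<Rightarrow> nat \<Rightarrow> nat \<Rightarrow> complex mat" where
  "unit_mat d a b = mat d d (\<lambda>(i, j). if i = a \<and> j = b then 1 else 0)"

lemma unit_mat_carrier [simp]: "unit_mat d a b \<in> carrier_mat d d"
  by (simp add: unit_mat_def)

text \<open>Fewer than \<open>dA\<^sup>2\<close> operators on the first factor leave room for a
  \<open>K\<close> that pairs to zero with all of them. Conversely, \<open>K\<close> is a linear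
  relation between the \<open>dA\<^sup>2\<close> blocks, and solving it for one block saves one
  term. \<open>K a b\<close> pairs with the entry at the same indices, so it is the transpose of the
  annihilating operator.\<close>

lemma operator_Schmidt_rank_less_iff:
  assumes R: "R \<in> carrier_mat (dA * dB) (dA * dB)"
  shows "operator_Schmidt_rank dA dB R < dA\<^sup>2 \<longleftrightarrow>
     (\<exists>K. (\<exists>a<dA. \<exists>b<dA. K a b \<noteq> 0) \<and>
       (\<forall>j<dB. \<forall>l<dB. (\<Sum>a<dA. \<Sum>b<dA. K a b * R $$ (a * dB + j, b * dB + l)) = 0))"
    (is "_ \<longleftrightarrow> (\<exists>K. ?Q K)")
proof
  let ?S = "{..<dA} \<times> {..<dA}"
  let ?Y = "\<lambda>(p, q). mat dB dB (\<lambda>(j, l). R $$ (p * dB + j, q * dB + l))"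
  \<comment> \<open>\<open>LEAST\<close> carries information only if some decomposition exists;
    matrix units tensored with the blocks provide one.\<close>
  have "osr_decomposition dA dB R ?S (\<lambda>(p, q). unit_mat dA p q) ?Y"
    unfolding osr_decomposition_def
  proof (intro conjI ballI allI impI)
    fix a b j l assume a: "a < dA" "b < dA" "j < dB" "l < dB"
    have "(\<Sum>s\<in>?S. (case s of (p, q) \<Rightarrow> unit_mat dA p q) $$ (a, b) * ?Y s $$ (j, l)) =
        (\<Sum>s\<in>?S. if s = (a, b) then R $$ (a * dB + j, b * dB + l) else 0)"
      using a by (intro sum.cong refl) (auto simp: unit_mat_def split: prod.splits)
    then show "R $$ (a * dB + j, b * dB + l) =
        (\<Sum>s\<in>?S. (case s of (p, q) \<Rightarrow> unit_mat dA p q) $$ (a, b) * ?Y s $$ (j, l))"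
      using a by simp
  qed (auto split: prod.splits)
  then have "\<exists>X Y. osr_decomposition dA dB R {..<card ?S} X Y"
    by (rule osr_decomposition_card[rotated]) simp
  then have ex: "\<exists>(r::nat) X Y. osr_decomposition dA dB R {..<r} X Y" by (rule exI)
  assume less: "operator_Schmidt_rank dA dB R < dA\<^sup>2"
  define r where "r = operator_Schmidt_rank dA dB R"
  have "\<exists>X Y. osr_decomposition dA dB R {..<r} X Y"
    unfolding r_def operator_Schmidt_rank_eq[OF R] by (rule LeastI_ex[OF ex])
  then obtain X Y where dec: "osr_decomposition dA dB R {..<r} X Y" by blast
  have "r < dA * dA" using less by (simp add: r_def power2_eq_square)
  \<comment> \<open>One equation for each of the \<open>r\<close> factors, in \<open>dA * dA\<close>
    unknowns; the matrix index pair is flattened to \<open>p\<close>.\<close>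
  from exists_nonzero_solution[OF this, of "\<lambda>k p. X k $$ (p div dA, p mod dA)"]
  obtain x where x: "\<exists>p<dA * dA. x p \<noteq> 0"
    and x0: "\<forall>k<r. (\<Sum>p<dA * dA. X k $$ (p div dA, p mod dA) * x p) = 0" by blast
  have sol: "(\<Sum>a<dA. \<Sum>b<dA. X k $$ (a, b) * x (a * dA + b)) = 0" if "k < r" for k
    using x0 that unfolding sum_pair_index by (simp add: pair_index)
  have "?Q (\<lambda>a b. x (a * dA + b))"
  proof (intro conjI allI impI)
    obtain p where p: "p < dA * dA" "x p \<noteq> 0" using x by blast
    then have "0 < dA" by (cases dA) auto
    then show "\<exists>a<dA. \<exists>b<dA. x (a * dA + b) \<noteq> 0"
      using p by (intro exI[of _ "p div dA"] conjI exI[of _ "p mod dA"])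
        (auto simp: less_mult_imp_div_less)
    fix j l assume jl: "j < dB" "l < dB"
    have "(\<Sum>a<dA. \<Sum>b<dA. x (a * dA + b) * R $$ (a * dB + j, b * dB + l)) =
        (\<Sum>a<dA. \<Sum>b<dA. \<Sum>k<r. Y k $$ (j, l) * (X k $$ (a, b) * x (a * dA + b)))"
      using dec jl by (intro sum.cong refl)
        (simp add: osr_decomposition_def sum_distrib_left ac_simps)
    also have "\<dots> = (\<Sum>k<r. Y k $$ (j, l) * (\<Sum>a<dA. \<Sum>b<dA. X k $$ (a, b) * x (a * dA + b)))"
      unfolding sum_distrib_left by (rule sum_rotate)
    also have "\<dots> = 0" using sol by simp
    finally show "(\<Sum>a<dA. \<Sum>b<dA. x (a * dA + b) * R $$ (a * dB + j, b * dB + l)) = 0" .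
  qed
  then show "\<exists>K. ?Q K" by (rule exI[of ?Q "\<lambda>a b. x (a * dA + b)"])
next
  assume "\<exists>K. ?Q K"
  then obtain K a0 b0 where ab0: "a0 < dA" "b0 < dA" "K a0 b0 \<noteq> 0"
    and K: "\<forall>j<dB. \<forall>l<dB. (\<Sum>a<dA. \<Sum>b<dA. K a b * R $$ (a * dB + j, b * dB + l)) = 0"
    by (elim exE conjE) (rule that)
  let ?S = "{..<dA} \<times> {..<dA} - {(a0, b0)}"
  \<comment> \<open>The coefficients of the block at \<open>(a0, b0)\<close> in terms of the others.
    Each remaining factor \<open>?X\<close> is a matrix unit with the extra entry
    \<open>c p q\<close> at the eliminated position.\<close>
  define c where "c p q = - K p q / K a0 b0" for p q
  let ?X = "\<lambda>(p, q). mat dA dA (\<lambda>(a, b). if (a, b) = (p, q) then 1 else if (a, b) = (a0, b0) then c p q else 0)"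
  let ?Y = "\<lambda>(p, q). mat dB dB (\<lambda>(j, l). R $$ (p * dB + j, q * dB + l))"
  have "osr_decomposition dA dB R ?S ?X ?Y"
    unfolding osr_decomposition_def
  proof (intro conjI ballI allI impI)
    fix a b j l assume a: "a < dA" "b < dA" "j < dB" "l < dB"
    show "R $$ (a * dB + j, b * dB + l) = (\<Sum>s\<in>?S. ?X s $$ (a, b) * ?Y s $$ (j, l))"
    proof (cases "(a, b) = (a0, b0)")
      case True
      have "0 = (\<Sum>s\<in>{..<dA} \<times> {..<dA}. K (fst s) (snd s) * R $$ (fst s * dB + j, snd s * dB + l))"
        using K a by (simp add: sum.cartesian_product split_beta)
      also have "\<dots> = K a0 b0 * R $$ (a0 * dB + j, b0 * dB + l) +
          (\<Sum>s\<in>?S. K (fst s) (snd s) * R $$ (fst s * dB + j, snd s * dB + l))"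
        using ab0 by (subst sum.remove[of _ "(a0, b0)"]) auto
      finally have "R $$ (a0 * dB + j, b0 * dB + l) =
          - (\<Sum>s\<in>?S. K (fst s) (snd s) * R $$ (fst s * dB + j, snd s * dB + l)) / K a0 b0"
        using ab0(3) by (simp add: field_simps eq_neg_iff_add_eq_0)
      also have "\<dots> = (\<Sum>s\<in>?S. ?X s $$ (a, b) * ?Y s $$ (j, l))"
        unfolding sum_negf[symmetric] sum_divide_distrib
        using True a by (intro sum.cong refl) (auto simp: c_def split: prod.splits)
      finally show ?thesis using True by simp
    next
      case False
      have "(\<Sum>s\<in>?S. ?X s $$ (a, b) * ?Y s $$ (j, l)) =
          (\<Sum>s\<in>?S. if s = (a, b) then R $$ (a * dB + j, b * dB + l) else 0)"
        using a False by (intro sum.cong refl) (auto split: prod.splits)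
      then show ?thesis using a False by simp
    qed
  qed (auto split: prod.splits)
  then have "\<exists>X Y. osr_decomposition dA dB R {..<card ?S} X Y"
    by (rule osr_decomposition_card[rotated]) simp
  then have "operator_Schmidt_rank dA dB R \<le> card ?S"
    unfolding operator_Schmidt_rank_eq[OF R] by (rule Least_le)
  also have "card ?S < dA\<^sup>2"
    using ab0(1,2) by (simp add: card_Diff_subset power2_eq_square)
  finally show "operator_Schmidt_rank dA dB R < dA\<^sup>2" .
qed

text \<open>Annihilators are scaled to Frobenius norm 1. This bounds them, and since the norm is
  continuous it keeps the limit of a convergent subsequence nonzero; the annihilation equations pass
  to the limit as well.\<close>

lemma operator_Schmidt_rank_less_closed:
  assumes Rm: "\<And>m. Rm m \<in> carrier_mat (dA * dB) (dA * dB)" and R: "R \<in> carrier_mat (dA * dB) (dA * dB)"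
    and less: "\<And>m. operator_Schmidt_rank dA dB (Rm m) < dA\<^sup>2"
    and lim: "\<And>r c. r < dA * dB \<Longrightarrow> c < dA * dB \<Longrightarrow> (\<lambda>m. Rm m $$ (r, c)) \<longlonglongrightarrow> R $$ (r, c)"
  shows "operator_Schmidt_rank dA dB R < dA\<^sup>2"
proof -
  let ?S = "{..<dA} \<times> {..<dA}"
  define Q where "Q m K \<longleftrightarrow> (\<Sum>a<dA. \<Sum>b<dA. (cmod (K a b))\<^sup>2) = 1 \<and>
      (\<forall>j<dB. \<forall>l<dB. (\<Sum>a<dA. \<Sum>b<dA. K a b * Rm m $$ (a * dB + j, b * dB + l)) = 0)" for m K
  have "\<exists>K. Q m K" for m
  proof -
    obtain K a0 b0 where ab0: "a0 < dA" "b0 < dA" "K a0 b0 \<noteq> 0"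
      and K: "\<forall>j<dB. \<forall>l<dB. (\<Sum>a<dA. \<Sum>b<dA. K a b * Rm m $$ (a * dB + j, b * dB + l)) = 0"
      using less[of m] unfolding operator_Schmidt_rank_less_iff[OF Rm]
      by (elim exE conjE) (rule that)
    define N where "N = (\<Sum>a<dA. \<Sum>b<dA. (cmod (K a b))\<^sup>2)"
    have "0 < (cmod (K a0 b0))\<^sup>2" using ab0(3) by simp
    also have "\<dots> \<le> (\<Sum>b<dA. (cmod (K a0 b))\<^sup>2)" using ab0 by (intro member_le_sum) auto
    also have "\<dots> \<le> N" unfolding N_def
      using ab0 by (intro member_le_sum[of a0 _ "\<lambda>a. \<Sum>b<dA. (cmod (K a b))\<^sup>2"]) (auto intro: sum_nonneg)
    finally have N: "0 < N" .
    let ?K = "\<lambda>a b. K a b / of_real (sqrt N)"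
    have "(cmod (?K a b))\<^sup>2 = (cmod (K a b))\<^sup>2 / N" for a b
      using N by (simp add: norm_divide power_divide)
    then have "(\<Sum>a<dA. \<Sum>b<dA. (cmod (?K a b))\<^sup>2) = N / N"
      by (simp only: N_def sum_divide_distrib)
    moreover have "(\<Sum>a<dA. \<Sum>b<dA. ?K a b * Rm m $$ (a * dB + j, b * dB + l)) = 0"
      if "j < dB" "l < dB" for j l
      using K that by (simp add: sum_divide_distrib[symmetric])
    ultimately have "Q m ?K" using N by (simp add: Q_def)
    then show ?thesis by blast
  qed
  then obtain K where Q: "\<And>m. Q m (K m)" by metis
  have K1: "(\<Sum>a<dA. \<Sum>b<dA. (cmod (K m a b))\<^sup>2) = 1" for m
    using Q[of m] by (simp add: Q_def)
  have K: "(\<Sum>a<dA. \<Sum>b<dA. K m a b * Rm m $$ (a * dB + j, b * dB + l)) = 0"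
    if "j < dB" "l < dB" for m j l
    using Q[of m] that by (simp add: Q_def)
  have fin: "finite ?S" by simp
  have bound: "cmod (K m (fst s) (snd s)) \<le> 1" if "s \<in> ?S" for m s
  proof -
    have "(cmod (K m (fst s) (snd s)))\<^sup>2 \<le> (\<Sum>s\<in>?S. (cmod (K m (fst s) (snd s)))\<^sup>2)"
      using that by (intro member_le_sum) auto
    also have "\<dots> = 1" using K1[of m] by (simp add: sum.cartesian_product split_beta)
    finally show ?thesis by (simp add: power_le_one_iff)
  qed
  have "\<exists>f k. strict_mono (f :: nat \<Rightarrow> nat) \<and> (\<forall>s\<in>?S. (\<lambda>m. K (f m) (fst s) (snd s)) \<longlonglongrightarrow> k s)"
    by (rule bounded_family_convergent_subseq[OF fin bound])
  then obtain f k where f: "strict_mono (f :: nat \<Rightarrow> nat)"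
    and k0: "\<forall>s\<in>?S. (\<lambda>m. K (f m) (fst s) (snd s)) \<longlonglongrightarrow> k s"
    by (elim exE conjE) (rule that)
  have k: "(\<lambda>m. K (f m) a b) \<longlonglongrightarrow> k (a, b)" if "a < dA" "b < dA" for a b
    using bspec[OF k0, of "(a, b)"] that by simp
  have limf: "(\<lambda>m. Rm (f m) $$ (r, c)) \<longlonglongrightarrow> R $$ (r, c)" if "r < dA * dB" "c < dA * dB" for r c
    using LIMSEQ_subseq_LIMSEQ[OF lim[OF that] f] by (simp add: o_def)
  have "(\<lambda>m. \<Sum>a<dA. \<Sum>b<dA. (cmod (K (f m) a b))\<^sup>2) \<longlonglongrightarrow> (\<Sum>a<dA. \<Sum>b<dA. (cmod (k (a, b)))\<^sup>2)"
    by (intro tendsto_intros k) auto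
  then have "(\<Sum>a<dA. \<Sum>b<dA. (cmod (k (a, b)))\<^sup>2) = 1" unfolding K1 by (simp add: LIMSEQ_const_iff)
  then have "\<exists>a<dA. \<exists>b<dA. k (a, b) \<noteq> 0"
    by (rule contrapos_pp) simp
  moreover have "(\<Sum>a<dA. \<Sum>b<dA. k (a, b) * R $$ (a * dB + j, b * dB + l)) = 0"
    if "j < dB" "l < dB" for j l
  proof -
    have "(\<lambda>m. \<Sum>a<dA. \<Sum>b<dA. K (f m) a b * Rm (f m) $$ (a * dB + j, b * dB + l))
        \<longlonglongrightarrow> (\<Sum>a<dA. \<Sum>b<dA. k (a, b) * R $$ (a * dB + j, b * dB + l))"
      using that by (intro tendsto_sum tendsto_mult k limf) (auto simp: pair_index)
    then show ?thesis using K that by (simp add: LIMSEQ_const_iff)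
  qed
  ultimately show ?thesis
    unfolding operator_Schmidt_rank_less_iff[OF R]
    by (intro exI[of _ "\<lambda>a b. k (a, b)"] conjI allI impI) simp_all
qed

section \<open>Compactness of the set of channels\<close>

lemma psd_closed:
  assumes "\<And>m. psd n (Y m)" "Z \<in> carrier_mat n n"
    and lim: "\<And>r c. r < n \<Longrightarrow> c < n \<Longrightarrow> (\<lambda>m. Y m $$ (r, c)) \<longlonglongrightarrow> Z $$ (r, c)"
  shows "psd n Z"
proof -
  have "0 \<le> sesq n Z x x" for x
  proof -
    have t: "(\<lambda>m. sesq n (Y m) x x) \<longlonglongrightarrow> sesq n Z x x"
      unfolding sesq_def by (intro tendsto_intros lim) auto
    have Y: "0 \<le> Re (sesq n (Y m) x x)" "Im (sesq n (Y m) x x) = 0" for m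
      using psd_sesq_nonneg[OF assms(1)[of m], of x] by (simp_all add: less_eq_complex_def)
    have "0 \<le> Re (sesq n Z x x)"
      by (rule LIMSEQ_le_const[OF tendsto_Re[OF t]]) (use Y in auto)
    moreover have "Im (sesq n Z x x) = 0"
      using tendsto_Im[OF t] unfolding Y by (simp add: LIMSEQ_const_iff)
    ultimately show ?thesis by (simp add: less_eq_complex_def)
  qed
  then show ?thesis using assms(2) by (simp add: psd_iff)
qed

lemma linear_op_map_expand:
  assumes L: "linear_op_map d d' \<Lambda>" and X: "X \<in> carrier_mat d d" and rc: "r < d'" "c < d'"
  shows "\<Lambda> X $$ (r, c) = (\<Sum>a<d. \<Sum>b<d. X $$ (a, b) * \<Lambda> (unit_mat d a b) $$ (r, c))"
proof -
  \<comment> \<open>The part of \<open>X\<close> supported on the positions in \<open>S\<close>;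
    linearity is used one matrix entry at a time.\<close>
  define P where "P S = mat d d (\<lambda>p. if p \<in> S then X $$ p else 0)" for S
  have LC: "\<Lambda> Y \<in> carrier_mat d' d'" if "Y \<in> carrier_mat d d" for Y
    using L that by (simp add: linear_op_map_def)
  have P: "P S \<in> carrier_mat d d" for S by (simp add: P_def)
  have "\<Lambda> (P S) $$ (r, c) = (\<Sum>p\<in>S. X $$ p * \<Lambda> (unit_mat d (fst p) (snd p)) $$ (r, c))"
    if "finite S" "S \<subseteq> {..<d} \<times> {..<d}" for S
    using that
  proof (induction S)
    case empty
    \<comment> \<open>That zero is mapped to zero comes from homogeneity with the scalar 0.\<close>
    have "P {} = 0 \<cdot>\<^sub>m P {}" by (intro eq_matI) (auto simp: P_def)
    then have "\<Lambda> (P {}) = 0 \<cdot>\<^sub>m \<Lambda> (P {})" using L P unfolding linear_op_map_def by metis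
    then have "\<Lambda> (P {}) $$ (r, c) = (0 \<cdot>\<^sub>m \<Lambda> (P {})) $$ (r, c)" by simp
    then show ?case using LC[OF P, of "{}"] rc by simp
  next
    case (insert p S)
    have "P (insert p S) = P S + X $$ p \<cdot>\<^sub>m unit_mat d (fst p) (snd p)"
      using insert.hyps by (intro eq_matI) (auto simp: P_def unit_mat_def)
    then have "\<Lambda> (P (insert p S)) = \<Lambda> (P S) + X $$ p \<cdot>\<^sub>m \<Lambda> (unit_mat d (fst p) (snd p))"
      using L P[of S] by (simp add: linear_op_map_def)
    then show ?case
      using insert LC[OF P, of S] LC[OF unit_mat_carrier, of "fst p" "snd p"] rc by simp
  qed
  from this[of "{..<d} \<times> {..<d}"] have "\<Lambda> (P ({..<d} \<times> {..<d})) $$ (r, c) =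
      (\<Sum>a<d. \<Sum>b<d. X $$ (a, b) * \<Lambda> (unit_mat d a b) $$ (r, c))"
    by (simp add: sum.cartesian_product split_beta)
  moreover have "P ({..<d} \<times> {..<d}) = X" using X by (intro eq_matI) (auto simp: P_def)
  ultimately show ?thesis by simp
qed

definition rank_one :: "nat \<Rightarrow> (nat \<Rightarrow> complex) \<Rightarrow> complex mat" where
  "rank_one n w = mat n n (\<lambda>(p, q). w p * cnj (w q))"

lemma psd_rank_one: "psd n (rank_one n w)"
proof -
  have "sesq n (rank_one n w) x x = cip n x w * cip n w x" for x
    unfolding sesq_def cip_def sum_product
    by (intro sum.cong refl) (simp add: rank_one_def ac_simps)
  moreover have "cip n x w * cip n w x = of_real ((cmod (cip n w x))\<^sup>2)" for x
    using cip_cnj[of n w x] by (simp add: complex_norm_square mult.commute del: of_real_power)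
  ultimately show ?thesis
    by (simp add: psd_iff rank_one_def less_eq_complex_def del: of_real_power)
qed

lemma mat_trace_rank_one: "mat_trace (rank_one n w) = cip n w w"
  by (simp add: mat_trace_def rank_one_def cip_def mult.commute)

text \<open>The entries \<open>\<Lambda>(|j\<rangle>\<langle>l|)\<close> are those of the Choi operator, which is positive with a fixed trace.\<close>

lemma channel_entries_bounded:
  "\<exists>B. \<forall>\<Lambda>. channel d d' \<Lambda> \<longrightarrow>
     (\<forall>a<d. \<forall>b<d. \<forall>r<d'. \<forall>c<d'. cmod (\<Lambda> (unit_mat d a b) $$ (r, c)) \<le> B)"
proof -
  \<comment> \<open>The unnormalized projector onto the maximally entangled vector. Its blocks are
    the matrix units, so the blocks of its image are the values of the channel on them.\<close>
  define \<Omega> where "\<Omega> = rank_one (d * d) (\<lambda>p. if p div d = p mod d then 1 else 0)"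
  have block: "block d d \<Omega> a b = unit_mat d a b" if "a < d" "b < d" for a b
    using that by (intro eq_matI) (auto simp: block_def unit_mat_def \<Omega>_def rank_one_def pair_index)
  have "cmod (\<Lambda> (unit_mat d a b) $$ (r, c)) \<le> Re (mat_trace \<Omega>)"
    if ch: "channel d d' \<Lambda>" and ab: "a < d" "b < d" "r < d'" "c < d'" for \<Lambda> a b r c
  proof -
    let ?M = "map_tensor_id d d' d \<Lambda> \<Omega>"
    have "psd (d' * d) ?M"
      using ch psd_rank_one by (simp add: channel_def completely_positive_def \<Omega>_def)
    then have "cmod (?M $$ (r * d + a, c * d + b)) \<le> Re (mat_trace ?M)"
      using ab by (intro psd_entry_bound[of "d' * d"]) (auto simp: pair_index)
    moreover have "mat_trace ?M = mat_trace \<Omega>"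
      by (rule mat_trace_map_tensor_id[OF ch]) (simp add: \<Omega>_def rank_one_def)
    ultimately show ?thesis using ab by (simp add: map_tensor_id_index block)
  qed
  then show ?thesis by blast
qed

text \<open>A linear map is fixed by finitely many entries of its values on matrix units, which are
  bounded uniformly over all channels. The limit is defined by linear extension; trace preservation
  is an equation and positivity a closed inequality, so both survive.\<close>

lemma channel_seq_compact:
  assumes s: "\<And>m. channel d d' (s m)"
  shows "\<exists>f \<Lambda>. strict_mono (f :: nat \<Rightarrow> nat) \<and> channel d d' \<Lambda> \<and>
     (\<forall>X\<in>carrier_mat d d. \<forall>r<d'. \<forall>c<d'. (\<lambda>m. s (f m) X $$ (r, c)) \<longlonglongrightarrow> \<Lambda> X $$ (r, c))"
proof -
  let ?S = "({..<d} \<times> {..<d}) \<times> ({..<d'} \<times> {..<d'})"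
  let ?F = "\<lambda>m i. s m (unit_mat d (fst (fst i)) (snd (fst i))) $$ (snd i)"
  have lin: "linear_op_map d d' (s m)" for m using s by (simp add: channel_def)
  obtain B where B: "\<forall>\<Lambda>. channel d d' \<Lambda> \<longrightarrow>
     (\<forall>a<d. \<forall>b<d. \<forall>r<d'. \<forall>c<d'. cmod (\<Lambda> (unit_mat d a b) $$ (r, c)) \<le> B)"
    using channel_entries_bounded by blast
  have fin: "finite ?S" by simp
  have bound: "cmod (?F m i) \<le> B" if "i \<in> ?S" for m i
    using B s[of m] that by (cases i) auto
  have "\<exists>f l. strict_mono (f :: nat \<Rightarrow> nat) \<and> (\<forall>i\<in>?S. (\<lambda>m. ?F (f m) i) \<longlonglongrightarrow> l i)"
    by (rule bounded_family_convergent_subseq[OF fin bound])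
  then obtain f l where f: "strict_mono (f :: nat \<Rightarrow> nat)" and l0: "\<forall>i\<in>?S. (\<lambda>m. ?F (f m) i) \<longlonglongrightarrow> l i"
    by (elim exE conjE) (rule that)
  have l: "(\<lambda>m. s (f m) (unit_mat d a b) $$ (r, c)) \<longlonglongrightarrow> l ((a, b), (r, c))"
    if "a < d" "b < d" "r < d'" "c < d'" for a b r c
    using bspec[OF l0, of "((a, b), (r, c))"] that by simp
  define \<Lambda> where "\<Lambda> X = mat d' d' (\<lambda>(r, c). \<Sum>a<d. \<Sum>b<d. X $$ (a, b) * l ((a, b), (r, c)))" for X
  have \<Lambda>_carrier: "\<Lambda> X \<in> carrier_mat d' d'" for X by (simp add: \<Lambda>_def)
  have conv: "(\<lambda>m. s (f m) X $$ (r, c)) \<longlonglongrightarrow> \<Lambda> X $$ (r, c)"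
    if "X \<in> carrier_mat d d" "r < d'" "c < d'" for X r c
  proof -
    have "(\<lambda>m. \<Sum>a<d. \<Sum>b<d. X $$ (a, b) * s (f m) (unit_mat d a b) $$ (r, c))
        \<longlonglongrightarrow> (\<Sum>a<d. \<Sum>b<d. X $$ (a, b) * l ((a, b), (r, c)))"
      using that by (intro tendsto_intros l) auto
    then show ?thesis using that by (simp add: linear_op_map_expand[OF lin that] \<Lambda>_def)
  qed
  have "linear_op_map d d' \<Lambda>"
    unfolding linear_op_map_def
  proof (intro conjI ballI allI)
    show "\<Lambda> X \<in> carrier_mat d' d'" for X by (rule \<Lambda>_carrier)
    show "\<Lambda> (X + Y) = \<Lambda> X + \<Lambda> Y" if "X \<in> carrier_mat d d" "Y \<in> carrier_mat d d" for X Y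
      using that by (intro eq_matI) (auto simp: \<Lambda>_def algebra_simps sum.distrib)
    show "\<Lambda> (c \<cdot>\<^sub>m X) = c \<cdot>\<^sub>m \<Lambda> X" if "X \<in> carrier_mat d d" for X c
      using that by (intro eq_matI) (auto simp: \<Lambda>_def sum_distrib_left algebra_simps)
  qed
  moreover have "trace_preserving d \<Lambda>"
    unfolding trace_preserving_def
  proof
    fix X :: "complex mat" assume X: "X \<in> carrier_mat d d"
    have dim: "dim_row (s m X) = d'" for m using lin[of m] X by (auto simp: linear_op_map_def)
    have "(\<lambda>m. mat_trace (s (f m) X)) \<longlonglongrightarrow> mat_trace (\<Lambda> X)"
      unfolding mat_trace_def dim using \<Lambda>_carrier[of X] X by (auto intro!: tendsto_sum conv)
    moreover have "mat_trace (s m X) = mat_trace X" for m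
      using s[of m] X by (simp add: channel_def trace_preserving_def)
    ultimately show "mat_trace (\<Lambda> X) = mat_trace X" by (simp add: LIMSEQ_const_iff)
  qed
  moreover have "completely_positive d d' \<Lambda>"
    unfolding completely_positive_def
  proof (intro allI impI)
    fix k X assume X: "psd (d * k) X"
    show "psd (d' * k) (map_tensor_id d d' k \<Lambda> X)"
    proof (rule psd_closed[of _ "\<lambda>m. map_tensor_id d d' k (s (f m)) X"])
      show "psd (d' * k) (map_tensor_id d d' k (s (f m)) X)" for m
        using s[of "f m"] X by (simp add: channel_def completely_positive_def)
      fix r c assume "r < d' * k" "c < d' * k"
      then show "(\<lambda>m. map_tensor_id d d' k (s (f m)) X $$ (r, c)) \<longlonglongrightarrow> map_tensor_id d d' k \<Lambda> X $$ (r, c)"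
        by (simp add: map_tensor_id_def conv less_mult_imp_div_less)
    qed simp
  qed
  ultimately have "channel d d' \<Lambda>" by (simp add: channel_def)
  then show ?thesis
    using f conv by (intro exI[of _ f] exI[of _ \<Lambda>] conjI ballI allI impI)
qed

section \<open>Existence of the minima\<close>

lemma hermitian_density: "density_operator n R \<Longrightarrow> hermitian n R"
  by (simp add: density_operator_def psd_hermitian)

lemma density_carrier: "density_operator n R \<Longrightarrow> R \<in> carrier_mat n n"
  by (simp add: density_operator_def psd_def)

lemma trace_dist_lsc:
  assumes R: "density_operator n R" and S: "\<And>m. density_operator n (S m)" and T: "density_operator n T"
    and lim: "\<And>r c. r < n \<Longrightarrow> c < n \<Longrightarrow> (\<lambda>m. S m $$ (r, c)) \<longlonglongrightarrow> T $$ (r, c)"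
    and L: "(\<lambda>m. 2 * trace_dist R (S m)) \<longlonglongrightarrow> L"
  shows "2 * trace_dist R T \<le> L"
proof -
  have "trace_norm (R - T) \<le> L"
  proof (rule trace_norm_lsc[of n "\<lambda>m. R - S m"])
    show "hermitian n (R - S m)" "hermitian n (R - T)" for m
      using hermitian_density R S T hermitian_minus by blast+
    fix r c assume rc: "r < n" "c < n"
    have "(R - S m) $$ (r, c) = R $$ (r, c) - S m $$ (r, c)" for m
      using density_carrier[OF S, of m] rc by auto
    then show "(\<lambda>m. (R - S m) $$ (r, c)) \<longlonglongrightarrow> (R - T) $$ (r, c)"
      using density_carrier[OF T] rc by (auto intro!: tendsto_diff lim)
  qed (use L in \<open>simp add: trace_dist_def\<close>)
  then show ?thesis by (simp add: trace_dist_def)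
qed

text \<open>A feasible \<open>\<Lambda>0\<close> is a premise because a minimum over an empty set is
  not attained; a projective measurement will supply it. Convergence on operators of the first
  factor applies to each block, hence to the output state.\<close>

lemma exists_optimal_channel:
  assumes \<rho>: "density_operator (dA * dB) \<rho>"
    and ex: "channel dA dA \<Lambda>0 \<and> operator_Schmidt_rank dA dB (map_tensor_id dA dA dB \<Lambda>0 \<rho>) < dA ^ 2"
  shows "\<exists>\<Lambda>. is_arg_min (\<lambda>\<Lambda>'. 2 * trace_dist \<rho> (map_tensor_id dA dA dB \<Lambda>' \<rho>))
      (\<lambda>\<Lambda>'. channel dA dA \<Lambda>' \<and>
         operator_Schmidt_rank dA dB (map_tensor_id dA dA dB \<Lambda>' \<rho>) < dA ^ 2) \<Lambda>"
proof (rule exists_arg_min_of_seq_lsc[where B = 0])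
  show "channel dA dA \<Lambda>0 \<and> operator_Schmidt_rank dA dB (map_tensor_id dA dA dB \<Lambda>0 \<rho>) < dA ^ 2"
    by (rule ex)
  note den = density_operator_map_tensor_id[OF _ \<rho>]
  show "0 \<le> 2 * trace_dist \<rho> (map_tensor_id dA dA dB \<Lambda>' \<rho>)"
    if "channel dA dA \<Lambda>' \<and> operator_Schmidt_rank dA dB (map_tensor_id dA dA dB \<Lambda>' \<rho>) < dA ^ 2" for \<Lambda>'
    using trace_dist_bounds(1)[OF \<rho> den[of dA \<Lambda>']] that by simp
  fix s :: "nat \<Rightarrow> complex mat \<Rightarrow> complex mat" and L :: real
  assume s: "\<And>m. channel dA dA (s m) \<and> operator_Schmidt_rank dA dB (map_tensor_id dA dA dB (s m) \<rho>) < dA ^ 2"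
    and L: "(\<lambda>m. 2 * trace_dist \<rho> (map_tensor_id dA dA dB (s m) \<rho>)) \<longlonglongrightarrow> L"
  have ch: "channel dA dA (s m)" for m using s by blast
  obtain f \<Lambda> where f: "strict_mono (f :: nat \<Rightarrow> nat)" and \<Lambda>: "channel dA dA \<Lambda>"
    and lim: "\<forall>X\<in>carrier_mat dA dA. \<forall>r<dA. \<forall>c<dA. (\<lambda>m. s (f m) X $$ (r, c)) \<longlonglongrightarrow> \<Lambda> X $$ (r, c)"
    using channel_seq_compact[of dA dA s, OF ch] by (elim exE conjE) (rule that)
  have conv: "(\<lambda>m. map_tensor_id dA dA dB (s (f m)) \<rho> $$ (r, c)) \<longlonglongrightarrow> map_tensor_id dA dA dB \<Lambda> \<rho> $$ (r, c)"
    if "r < dA * dB" "c < dA * dB" for r c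
    using that lim by (simp add: map_tensor_id_def less_mult_imp_div_less)
  have "operator_Schmidt_rank dA dB (map_tensor_id dA dA dB \<Lambda> \<rho>) < dA\<^sup>2"
    by (rule operator_Schmidt_rank_less_closed[of "\<lambda>m. map_tensor_id dA dA dB (s (f m)) \<rho>"])
      (use s conv in auto)
  moreover have "2 * trace_dist \<rho> (map_tensor_id dA dA dB \<Lambda> \<rho>) \<le> L"
    using LIMSEQ_subseq_LIMSEQ[OF L f]
    by (intro trace_dist_lsc[OF \<rho> den[OF ch] den[OF \<Lambda>] conv]) (auto simp: o_def)
  ultimately show "\<exists>\<Lambda>. (channel dA dA \<Lambda> \<and> operator_Schmidt_rank dA dB (map_tensor_id dA dA dB \<Lambda> \<rho>) < dA ^ 2) \<and>
      2 * trace_dist \<rho> (map_tensor_id dA dA dB \<Lambda> \<rho>) \<le> L"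
    using \<Lambda> by blast
qed

section \<open>Projective measurements: channel property, rank deficiency and an optimal
  basis\<close>

lemma orthonormal_basis_iff_onb:
  "orthonormal_basis n a \<longleftrightarrow> (\<forall>i<n. a i \<in> carrier_vec n) \<and> onb n (\<lambda>i r. a i $ r)"
proof (cases "\<forall>i<n. a i \<in> carrier_vec n")
  case True
  then have eq: "a i \<bullet>c a j = cip n (\<lambda>r. a j $ r) (\<lambda>r. a i $ r)" if "i < n" "j < n" for i j
    using that by (auto simp: scalar_prod_def cip_def atLeast0LessThan mult.commute)
  show ?thesis
  proof
    assume a: "orthonormal_basis n a"
    have "cip n (\<lambda>r. a i $ r) (\<lambda>r. a j $ r) = (if i = j then 1 else 0)" if "i < n" "j < n" for i j
      using a that unfolding orthonormal_basis_def eq[OF that(2,1), symmetric] by simp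
    with True show "(\<forall>i<n. a i \<in> carrier_vec n) \<and> onb n (\<lambda>i r. a i $ r)" by (simp add: onb_def)
  next
    assume u: "(\<forall>i<n. a i \<in> carrier_vec n) \<and> onb n (\<lambda>i r. a i $ r)"
    have "a i \<bullet>c a j = (if i = j then 1 else 0)" if "i < n" "j < n" for i j
      using u that unfolding onb_def eq[OF that] by simp
    with True show "orthonormal_basis n a" by (simp add: orthonormal_basis_def)
  qed
qed (auto simp: orthonormal_basis_def)

lemma ket_bra_sandwich:
  assumes "v \<in> carrier_vec n" "X \<in> carrier_mat n n" "r < n" "c < n"
  shows "(ket_bra v * X * ket_bra v) $$ (r, c) = v $ r * cnj (v $ c) * sesq n X (\<lambda>i. v $ i) (\<lambda>i. v $ i)"
proof -
  have "(ket_bra v * X * ket_bra v) $$ (r, c) =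
      (\<Sum>q<n. \<Sum>p<n. v $ r * cnj (v $ c) * (cnj (v $ p) * X $$ (p, q) * v $ q))"
    using assms
    by (simp add: ket_bra_def scalar_prod_def atLeast0LessThan sum_distrib_left sum_distrib_right ac_simps)
  also have "\<dots> = (\<Sum>p<n. \<Sum>q<n. v $ r * cnj (v $ c) * (cnj (v $ p) * X $$ (p, q) * v $ q))"
    by (rule sum.swap)
  finally show ?thesis by (simp add: sesq_def sum_distrib_left)
qed

lemma proj_measurement_eq:
  assumes "orthonormal_basis n a" "X \<in> carrier_mat n n"
  shows "proj_measurement n a X =
    measure_prepare n n {..<n} (\<lambda>_. 1) (\<lambda>i r. a i $ r) (\<lambda>i r. a i $ r) X"
  using assms
  by (intro eq_matI) (auto simp: proj_measurement_def measure_prepare_def orthonormal_basis_def ket_bra_sandwich[of _ n])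

lemma channel_proj_measurement:
  assumes "orthonormal_basis n a"
  shows "channel n n (proj_measurement n a)"
proof (rule channel_cong[OF channel_measure_prepare proj_measurement_eq[OF assms]])
  have u: "onb n (\<lambda>i r. a i $ r)" using assms by (simp add: orthonormal_basis_iff_onb)
  show "cip n (\<lambda>r. a m $ r) (\<lambda>r. a m $ r) = 1" if "m \<in> {..<n}" for m
    using onbD[OF u, of m m] that by simp
  show "(\<Sum>m<n. of_real 1 * (cnj (a m $ r) * a m $ c)) = (if r = c then 1 else 0)"
    if "r < n" "c < n" for r c
    using onb_complete[OF u that(2,1)] by (simp add: mult.commute)
qed auto

lemma map_tensor_id_proj_measurement_index:
  assumes "orthonormal_basis n a" "r < n * k" "c < n * k"
  shows "map_tensor_id n n k (proj_measurement n a) X $$ (r, c) =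
    (\<Sum>i<n. a i $ (r div k) * cnj (a i $ (c div k)) *
      sesq n (block n k X (r mod k) (c mod k)) (\<lambda>s. a i $ s) (\<lambda>s. a i $ s))"
  using assms by (simp add: map_tensor_id_def proj_measurement_eq measure_prepare_def less_mult_imp_div_less)

text \<open>After the measurement every block is diagonal in the basis \<open>u\<close>. As
  \<open>2 \<le> d\<close> there are two different basis vectors, and their off-diagonal matrix
  element, read as the functional \<open>K\<close>, annihilates the output.\<close>

lemma operator_Schmidt_rank_proj_measurement:
  assumes d: "2 \<le> d" and a: "orthonormal_basis d a"
  shows "operator_Schmidt_rank d k (map_tensor_id d d k (proj_measurement d a) X) < d\<^sup>2"
proof -
  let ?M = "map_tensor_id d d k (proj_measurement d a) X"
  define u where "u = (\<lambda>i r. a i $ r)"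
  have u: "onb d u" using a unfolding orthonormal_basis_iff_onb u_def by simp
  have ne: "\<exists>r<d. u i r \<noteq> 0" if "i < d" for i
  proof (rule ccontr)
    assume "\<not> ?thesis"
    then have "cip d (u i) (u i) = 0" by (simp add: cip_def)
    then show False using onbD[OF u that that] by simp
  qed
  obtain p q where pq: "p < d" "q < d" "u 0 p \<noteq> 0" "u 1 q \<noteq> 0" using ne[of 0] ne[of 1] d by auto
  define K where "K b c = cnj (u 0 b) * u 1 c" for b c
  have "(\<Sum>b<d. \<Sum>c<d. K b c * ?M $$ (b * k + j, c * k + l)) = 0" if jl: "j < k" "l < k" for j l
  proof -
    define S where "S i = sesq d (block d k X j l) (u i) (u i)" for i
    have "(\<Sum>b<d. \<Sum>c<d. K b c * ?M $$ (b * k + j, c * k + l)) =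
        (\<Sum>b<d. \<Sum>c<d. \<Sum>i<d. S i * ((cnj (u 0 b) * u i b) * (cnj (u i c) * u 1 c)))"
      using jl by (intro sum.cong refl, subst map_tensor_id_proj_measurement_index[OF a pair_index(1) pair_index(1)])
        (simp_all add: pair_index K_def S_def u_def sum_distrib_left ac_simps)
    also have "\<dots> = (\<Sum>i<d. \<Sum>b<d. \<Sum>c<d. S i * ((cnj (u 0 b) * u i b) * (cnj (u i c) * u 1 c)))"
      by (rule sum_rotate)
    also have "\<dots> = (\<Sum>i<d. S i * (cip d (u 0) (u i) * cip d (u i) (u 1)))"
      unfolding cip_def sum_product by (simp only: sum_distrib_left)
    also have "\<dots> = 0" using d by (intro sum.neutral) (simp add: onbD[OF u])
    finally show ?thesis .
  qed
  moreover have "K p q \<noteq> 0" using pq by (simp add: K_def)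
  ultimately show ?thesis
    unfolding operator_Schmidt_rank_less_iff[OF map_tensor_id_carrier]
    using pq(1,2) by (intro exI[of _ K] conjI allI impI) auto
qed

text \<open>Basis vectors have bounded entries, orthonormality is a system of equations between
  finite sums, and the measured state is a polynomial in the entries and their conjugates, so all of
  it passes to limits.\<close>

lemma exists_optimal_basis:
  assumes \<rho>: "density_operator (n * k) \<rho>"
  shows "\<exists>a. is_arg_min (\<lambda>b. 2 * trace_dist \<rho> (map_tensor_id n n k (proj_measurement n b) \<rho>))
      (orthonormal_basis n) a"
proof (rule exists_arg_min_of_seq_lsc[where B = 0])
  note den = density_operator_map_tensor_id[OF channel_proj_measurement \<rho>]
  show "orthonormal_basis n (unit_vec n)"
    unfolding orthonormal_basis_iff_onb onb_def cip_def
    by (auto simp: if_distrib[of cnj] if_distrib[of "\<lambda>x. x * _"] cong: if_cong)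
  show "0 \<le> 2 * trace_dist \<rho> (map_tensor_id n n k (proj_measurement n b) \<rho>)"
    if "orthonormal_basis n b" for b
    using trace_dist_bounds(1)[OF \<rho> den[OF that]] by simp
  fix s :: "nat \<Rightarrow> nat \<Rightarrow> complex vec" and L :: real
  assume s: "\<And>m. orthonormal_basis n (s m)"
    and L: "(\<lambda>m. 2 * trace_dist \<rho> (map_tensor_id n n k (proj_measurement n (s m)) \<rho>)) \<longlonglongrightarrow> L"
  let ?S = "{..<n} \<times> {..<n}"
  have u: "onb n (\<lambda>i r. s m i $ r)" for m using s by (simp add: orthonormal_basis_iff_onb)
  have fin: "finite ?S" by simp
  have bound: "cmod (s m (fst p) $ snd p) \<le> 1" if "p \<in> ?S" for m p
  proof -
    have "(cmod (s m (fst p) $ snd p))\<^sup>2 \<le> (\<Sum>r<n. (cmod (s m (fst p) $ r))\<^sup>2)"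
      using that by (intro member_le_sum) auto
    also have "\<dots> = Re (cip n (\<lambda>r. s m (fst p) $ r) (\<lambda>r. s m (fst p) $ r))" by (simp add: Re_cip_self)
    also have "\<dots> = 1" using onbD[OF u, of "fst p" "fst p" m] that by auto
    finally show ?thesis by (simp add: power_le_one_iff)
  qed
  have "\<exists>f l. strict_mono (f :: nat \<Rightarrow> nat) \<and> (\<forall>p\<in>?S. (\<lambda>m. s (f m) (fst p) $ snd p) \<longlonglongrightarrow> l p)"
    by (rule bounded_family_convergent_subseq[OF fin bound])
  then obtain f l where f: "strict_mono (f :: nat \<Rightarrow> nat)"
    and l: "\<forall>p\<in>?S. (\<lambda>m. s (f m) (fst p) $ snd p) \<longlonglongrightarrow> l p"
    by (elim exE conjE) (rule that)
  define a where "a i = vec n (\<lambda>r. l (i, r))" for i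
  have lim: "(\<lambda>m. s (f m) i $ r) \<longlonglongrightarrow> a i $ r" if "i < n" "r < n" for i r
    using bspec[OF l, of "(i, r)"] that by (simp add: a_def)
  have a: "orthonormal_basis n a"
    unfolding orthonormal_basis_iff_onb onb_def
  proof (intro conjI allI impI)
    fix i j assume ij: "i < n" "j < n"
    have "(\<lambda>m. cip n (\<lambda>r. s (f m) i $ r) (\<lambda>r. s (f m) j $ r)) \<longlonglongrightarrow> cip n (\<lambda>r. a i $ r) (\<lambda>r. a j $ r)"
      unfolding cip_def using ij by (intro tendsto_intros lim) auto
    then show "cip n (\<lambda>r. a i $ r) (\<lambda>r. a j $ r) = (if i = j then 1 else 0)"
      unfolding onbD[OF u ij] by (simp only: LIMSEQ_const_iff)
  qed (simp add: a_def)
  have conv: "(\<lambda>m. map_tensor_id n n k (proj_measurement n (s (f m))) \<rho> $$ (r, c))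
      \<longlonglongrightarrow> map_tensor_id n n k (proj_measurement n a) \<rho> $$ (r, c)" if rc: "r < n * k" "c < n * k" for r c
    unfolding map_tensor_id_proj_measurement_index[OF s rc] map_tensor_id_proj_measurement_index[OF a rc] sesq_def
    using rc by (intro tendsto_intros lim) (auto simp: less_mult_imp_div_less)
  have "2 * trace_dist \<rho> (map_tensor_id n n k (proj_measurement n a) \<rho>) \<le> L"
    using LIMSEQ_subseq_LIMSEQ[OF L f]
    by (intro trace_dist_lsc[OF \<rho> den[OF s] den[OF a] conv]) (auto simp: o_def)
  with a show "\<exists>a. orthonormal_basis n a \<and>
      2 * trace_dist \<rho> (map_tensor_id n n k (proj_measurement n a) \<rho>) \<le> L" by blast
qed

section \<open>The discriminating pair of channels\<close>

text \<open>The annihilator is delivered in diagonal form because the measurements need its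
  eigenvectors. The bound 1 on \<open>\<mu>\<close> makes the effects positive, and an eigenvalue of
  modulus 1 makes the two measurements perfectly distinguishable on some input.\<close>

lemma osr_less_hermitian_annihilator:
  assumes \<sigma>: "hermitian (dA * dB) \<sigma>" and less: "operator_Schmidt_rank dA dB \<sigma> < dA\<^sup>2"
  shows "\<exists>u \<mu>. onb dA u \<and> (\<forall>i<dA. \<bar>\<mu> i\<bar> \<le> 1) \<and> (\<exists>i<dA. \<bar>\<mu> i\<bar> = 1) \<and>
    (\<forall>j<dB. \<forall>l<dB. (\<Sum>i<dA. of_real (\<mu> i) * sesq dA (block dA dB \<sigma> j l) (u i) (u i)) = 0)"
proof -
  have carr: "\<sigma> \<in> carrier_mat (dA * dB) (dA * dB)" using \<sigma> by (simp add: hermitian_def)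
  define Ann where "Ann K \<longleftrightarrow> (\<forall>j<dB. \<forall>l<dB. (\<Sum>a<dA. \<Sum>b<dA. K a b * \<sigma> $$ (a * dB + j, b * dB + l)) = 0)"
    for K :: "nat \<Rightarrow> nat \<Rightarrow> complex"
  obtain K a0 b0 where K: "Ann K" and ab0: "a0 < dA" "b0 < dA" "K a0 b0 \<noteq> 0"
    using less[unfolded operator_Schmidt_rank_less_iff[OF carr], folded Ann_def]
    by (elim exE conjE) (rule that)
  \<comment> \<open>Conjugating the equation for the block \<open>(l, j)\<close> of the Hermitian
    \<open>\<sigma>\<close> gives the equation of the adjoint of \<open>K\<close> for
    \<open>(j, l)\<close>.\<close>
  have K': "Ann (\<lambda>a b. cnj (K b a))"
    unfolding Ann_def
  proof (intro allI impI)
    fix j l assume jl: "j < dB" "l < dB"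
    have "(\<Sum>a<dA. \<Sum>b<dA. cnj (K b a) * \<sigma> $$ (a * dB + j, b * dB + l)) =
        (\<Sum>a<dA. \<Sum>b<dA. cnj (K b a * \<sigma> $$ (b * dB + l, a * dB + j)))"
      using jl by (intro sum.cong refl) (simp add: hermitianD[OF \<sigma>] pair_index)
    also have "\<dots> = (\<Sum>b<dA. \<Sum>a<dA. cnj (K b a * \<sigma> $$ (b * dB + l, a * dB + j)))"
      by (rule sum.swap)
    also have "\<dots> = cnj (\<Sum>b<dA. \<Sum>a<dA. K b a * \<sigma> $$ (b * dB + l, a * dB + j))"
      by simp
    also have "\<dots> = 0" using K jl by (simp add: Ann_def)
    finally show "(\<Sum>a<dA. \<Sum>b<dA. cnj (K b a) * \<sigma> $$ (a * dB + j, b * dB + l)) = 0" .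
  qed
  have comb: "Ann (\<lambda>a b. x * K a b + y * cnj (K b a))" for x y
    unfolding Ann_def
  proof (intro allI impI)
    fix j l assume jl: "j < dB" "l < dB"
    have "(\<Sum>a<dA. \<Sum>b<dA. (x * K a b + y * cnj (K b a)) * \<sigma> $$ (a * dB + j, b * dB + l)) =
      x * (\<Sum>a<dA. \<Sum>b<dA. K a b * \<sigma> $$ (a * dB + j, b * dB + l)) +
      y * (\<Sum>a<dA. \<Sum>b<dA. cnj (K b a) * \<sigma> $$ (a * dB + j, b * dB + l))"
      by (simp add: sum_distrib_left sum.distrib algebra_simps)
    also have "\<dots> = 0" using K K' jl by (simp add: Ann_def)
    finally show "(\<Sum>a<dA. \<Sum>b<dA. (x * K a b + y * cnj (K b a)) * \<sigma> $$ (a * dB + j, b * dB + l)) = 0" .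
  qed
  \<comment> \<open>Up to factors, the Hermitian and anti-Hermitian parts of \<open>K\<close>. If
    the sum with the adjoint vanishes at \<open>(a0, b0)\<close>, then \<open>\<i>\<close> times the
    difference does not.\<close>
  have "\<exists>G. Ann G \<and> (\<forall>a b. G b a = cnj (G a b)) \<and> G a0 b0 \<noteq> 0"
  proof (cases "K a0 b0 + cnj (K b0 a0) = 0")
    case False
    then show ?thesis using comb[of 1 1] by (intro exI[of _ "\<lambda>a b. 1 * K a b + 1 * cnj (K b a)"]) simp
  next
    case True
    then have "\<i> * K a0 b0 + (- \<i>) * cnj (K b0 a0) = 2 * \<i> * K a0 b0"
      by (simp add: add_eq_0_iff)
    then have "\<i> * K a0 b0 + (- \<i>) * cnj (K b0 a0) \<noteq> 0" using ab0(3) by simp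
    then show ?thesis using comb[of \<i> "- \<i>"]
      by (intro exI[of _ "\<lambda>a b. \<i> * K a b + (- \<i>) * cnj (K b a)"]) simp
  qed
  then obtain G where G: "Ann G" "\<And>a b. cnj (G a b) = G b a" "G a0 b0 \<noteq> 0" by metis
  \<comment> \<open>The transpose, since \<open>G\<close> pairs equal indices whereas the trace of a
    product pairs opposite ones.\<close>
  define H where "H = mat dA dA (\<lambda>(p, q). G q p)"
  have "hermitian dA H" unfolding hermitian_def H_def by (simp add: G(2))
  then obtain u \<kappa> where u: "onb dA u" and Hu: "H = spec_mat dA u \<kappa>" using hermitian_spectral by blast
  have HG: "(\<Sum>i<dA. of_real (\<kappa> i) * u i b * cnj (u i a)) = G a b" if "a < dA" "b < dA" for a b
    using spec_mat_index[OF that(2,1), of u \<kappa>] that unfolding Hu[symmetric] H_def by simp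
  \<comment> \<open>The operator norm of \<open>H\<close>, by which the eigenvalues are
    divided.\<close>
  define m where "m = Max ((\<lambda>i. \<bar>\<kappa> i\<bar>) ` {..<dA})"
  have fin: "finite ((\<lambda>i. \<bar>\<kappa> i\<bar>) ` {..<dA})" "(\<lambda>i. \<bar>\<kappa> i\<bar>) ` {..<dA} \<noteq> {}" using ab0 by auto
  have le: "\<bar>\<kappa> i\<bar> \<le> m" if "i < dA" for i unfolding m_def using that by (intro Max_ge) auto
  obtain i0 where i0: "i0 < dA" "\<bar>\<kappa> i0\<bar> = m" using Max_in[OF fin] unfolding m_def[symmetric] by auto
  have "m \<noteq> 0"
  proof
    assume "m = 0"
    then have "\<kappa> i = 0" if "i < dA" for i using le[OF that] by simp
    then have "G a0 b0 = 0" using HG[OF ab0(1,2)] by simp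
    then show False using G(3) by simp
  qed
  then have m: "0 < m" using i0(2) by linarith
  define \<mu> where "\<mu> i = \<kappa> i / m" for i
  have "(\<Sum>i<dA. of_real (\<mu> i) * sesq dA (block dA dB \<sigma> j l) (u i) (u i)) = 0"
    if jl: "j < dB" "l < dB" for j l
  proof -
    have "(\<Sum>i<dA. of_real (\<kappa> i) * sesq dA (block dA dB \<sigma> j l) (u i) (u i)) =
        (\<Sum>i<dA. \<Sum>a<dA. \<Sum>b<dA. (of_real (\<kappa> i) * u i b * cnj (u i a)) * \<sigma> $$ (a * dB + j, b * dB + l))"
      unfolding sesq_block by (simp add: sum_distrib_left ac_simps)
    also have "\<dots> = (\<Sum>a<dA. \<Sum>b<dA. \<Sum>i<dA. (of_real (\<kappa> i) * u i b * cnj (u i a)) * \<sigma> $$ (a * dB + j, b * dB + l))"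
      by (rule sum_rotate[symmetric])
    also have "\<dots> = (\<Sum>a<dA. \<Sum>b<dA. G a b * \<sigma> $$ (a * dB + j, b * dB + l))"
      by (intro sum.cong refl) (simp add: sum_distrib_right[symmetric] HG)
    also have "\<dots> = 0" using G(1) jl by (simp add: Ann_def)
    finally have "(\<Sum>i<dA. of_real (\<kappa> i) * sesq dA (block dA dB \<sigma> j l) (u i) (u i)) = 0" .
    moreover have "(\<Sum>i<dA. of_real (\<mu> i) * sesq dA (block dA dB \<sigma> j l) (u i) (u i)) =
        (\<Sum>i<dA. of_real (\<kappa> i) * sesq dA (block dA dB \<sigma> j l) (u i) (u i)) / of_real m"
      unfolding sum_divide_distrib by (simp add: \<mu>_def)
    ultimately show ?thesis by simp
  qed
  moreover have "\<bar>\<mu> i\<bar> \<le> 1" if "i < dA" for i using le[OF that] m by (simp add: \<mu>_def abs_divide)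
  moreover have "\<bar>\<mu> i0\<bar> = 1" using i0(2) m by (simp add: \<mu>_def abs_divide)
  ultimately show ?thesis
    using u i0(1) by (intro exI[of _ u] exI[of _ \<mu>] conjI allI impI exI[of _ i0]) simp_all
qed

section \<open>Contractions on tensor products\<close>

lemma hermitian_kron:
  assumes "hermitian d X" "hermitian k Y"
  shows "hermitian (d * k) (kron X Y)"
proof -
  have XY: "X \<in> carrier_mat d d" "Y \<in> carrier_mat k k" using assms by (simp_all add: hermitian_def)
  have "kron X Y $$ (c, r) = cnj (kron X Y $$ (r, c))" if rc: "r < d * k" "c < d * k" for r c
  proof -
    have "0 < k" using rc by (cases k) auto
    then show ?thesis
      using XY rc by (simp add: kron_def less_mult_imp_div_less hermitianD[OF assms(1)] hermitianD[OF assms(2)])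
  qed
  then show ?thesis using XY unfolding hermitian_def by (auto simp: kron_def)
qed

text \<open>Expanding \<open>v\<close> in the eigenbasis \<open>u\<close> on the first factor splits
  the form into forms of \<open>M\<close> with coefficients \<open>\<mu> i\<close>. Each is bounded
  separately, and Parseval reassembles the norm of \<open>v\<close>.\<close>

lemma contraction_kron_spec_mat:
  assumes u: "onb d u" and \<mu>: "\<And>i. i < d \<Longrightarrow> \<bar>\<mu> i\<bar> \<le> 1" and M: "contraction k M"
  shows "contraction (d * k) (kron (spec_mat d u \<mu>) M)"
  unfolding contraction_def
proof (intro conjI allI)
  have MM: "M \<in> carrier_mat k k" using M by (simp add: contraction_def hermitian_def)
  show "hermitian (d * k) (kron (spec_mat d u \<mu>) M)"
    using M by (intro hermitian_kron) (simp_all add: contraction_def)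
  fix v
  define z where "z i j = cip d (u i) (\<lambda>a. v (a * k + j))" for i j
  have "sesq (d * k) (kron (spec_mat d u \<mu>) M) v v =
      (\<Sum>j<k. \<Sum>l<k. M $$ (j, l) * sesq d (spec_mat d u \<mu>) (\<lambda>a. v (a * k + j)) (\<lambda>a. v (a * k + l)))"
    unfolding sesq_pair sesq_def[of d] sum_distrib_left
    by (intro sum.cong refl, subst kron_index[OF spec_mat_carrier MM]) (simp_all add: ac_simps)
  also have "\<dots> = (\<Sum>j<k. \<Sum>l<k. \<Sum>i<d. of_real (\<mu> i) * (cnj (z i j) * M $$ (j, l) * z i l))"
    unfolding sesq_spec_mat z_def cip_cnj sum_distrib_left by (intro sum.cong refl) (simp add: ac_simps)
  also have "\<dots> = (\<Sum>i<d. \<Sum>j<k. \<Sum>l<k. of_real (\<mu> i) * (cnj (z i j) * M $$ (j, l) * z i l))"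
    by (rule sum_rotate)
  also have "\<dots> = (\<Sum>i<d. of_real (\<mu> i) * sesq k M (z i) (z i))"
    by (simp add: sesq_def sum_distrib_left)
  finally have eq: "sesq (d * k) (kron (spec_mat d u \<mu>) M) v v = (\<Sum>i<d. of_real (\<mu> i) * sesq k M (z i) (z i))" .
  have "\<bar>Re (sesq (d * k) (kron (spec_mat d u \<mu>) M) v v)\<bar> \<le> (\<Sum>i<d. \<bar>\<mu> i * Re (sesq k M (z i) (z i))\<bar>)"
    unfolding eq by simp
  also have "\<dots> \<le> (\<Sum>i<d. Re (cip k (z i) (z i)))"
  proof (rule sum_mono)
    fix i assume i: "i \<in> {..<d}"
    have "\<bar>\<mu> i * Re (sesq k M (z i) (z i))\<bar> \<le> \<bar>Re (sesq k M (z i) (z i))\<bar>"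
      using \<mu>[of i] i by (simp add: abs_mult mult_left_le_one_le)
    also have "\<dots> \<le> Re (cip k (z i) (z i))" using M by (simp add: contraction_def)
    finally show "\<bar>\<mu> i * Re (sesq k M (z i) (z i))\<bar> \<le> Re (cip k (z i) (z i))" .
  qed
  also have "\<dots> = (\<Sum>j<k. \<Sum>i<d. (cmod (cip d (u i) (\<lambda>a. v (a * k + j))))\<^sup>2)"
    unfolding Re_cip_self z_def by (rule sum.swap)
  also have "\<dots> = (\<Sum>j<k. \<Sum>a<d. (cmod (v (a * k + j)))\<^sup>2)"
    by (simp add: onb_parseval_norm[OF u] Re_cip_self)
  also have "\<dots> = Re (cip (d * k) v v)"
    unfolding Re_cip_self sum_pair_index by (rule sum.swap)
  finally show "\<bar>Re (sesq (d * k) (kron (spec_mat d u \<mu>) M) v v)\<bar> \<le> Re (cip (d * k) v v)" .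
qed

text \<open>The diagonal blocks of \<open>C\<close> are compressions of a contraction, hence
  contractions, and half the difference of two contractions is again one. Only this combination is
  visible when \<open>C\<close> is paired with an operator of the form flag times
  \<open>D\<close>.\<close>

lemma contraction_half_block_diff:
  assumes C: "contraction (2 * k) C"
  shows "contraction k (mat k k (\<lambda>(j, l). (C $$ (j, l) - C $$ (k + j, k + l)) / 2))"
    (is "contraction k ?M")
  unfolding contraction_def
proof (intro conjI allI)
  have Ch: "hermitian (2 * k) C" using C by (simp add: contraction_def)
  show "hermitian k ?M" unfolding hermitian_def by (simp add: hermitianD[OF Ch])
  fix y :: "nat \<Rightarrow> complex"
  \<comment> \<open>The vector e_s tensored with \<open>y\<close>, which selects the diagonal block
    \<open>s\<close> and has the norm of \<open>y\<close>.\<close>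
  define z where "z s p = (if p div k = s then y (p mod k) else 0)" for s p :: nat
  have two: "(\<Sum>a<2::nat. f a) = f 0 + f 1" for f :: "nat \<Rightarrow> complex" by (simp add: numeral_2_eq_2)
  have sz: "sesq (2 * k) C (z s) (z s) = (\<Sum>j<k. \<Sum>l<k. cnj (y j) * C $$ (s * k + j, s * k + l) * y l)"
    if "s < 2" for s
    unfolding sesq_pair
  proof (intro sum.cong refl)
    fix j l assume "j \<in> {..<k}" "l \<in> {..<k}"
    then have "z s (a * k + j) = (if a = s then y j else 0)" "z s (a * k + l) = (if a = s then y l else 0)" for a
      by (auto simp: z_def)
    then show "(\<Sum>a<2::nat. \<Sum>b<2. cnj (z s (a * k + j)) * C $$ (a * k + j, b * k + l) * z s (b * k + l)) =
        cnj (y j) * C $$ (s * k + j, s * k + l) * y l"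
      using that by (auto simp: two less_2_cases_iff)
  qed
  have cz: "cip (2 * k) (z s) (z s) = cip k y y" if "s < 2" for s
    unfolding cip_pair using that by (auto simp: two less_2_cases_iff z_def cip_def)
  have s0: "sesq (2 * k) C (z 0) (z 0) = (\<Sum>j<k. \<Sum>l<k. cnj (y j) * C $$ (j, l) * y l)"
    using sz[of 0] by simp
  have s1: "sesq (2 * k) C (z 1) (z 1) = (\<Sum>j<k. \<Sum>l<k. cnj (y j) * C $$ (k + j, k + l) * y l)"
    using sz[of 1] by simp
  have eq: "sesq k ?M y y = (sesq (2 * k) C (z 0) (z 0) - sesq (2 * k) C (z 1) (z 1)) / 2"
    unfolding s0 s1
    by (simp add: sesq_def[of k] sum_subtractf[symmetric] sum_divide_distrib algebra_simps diff_divide_distrib)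
  have re: "Re (sesq k ?M y y) = (Re (sesq (2 * k) C (z 0) (z 0)) - Re (sesq (2 * k) C (z 1) (z 1))) / 2"
    unfolding eq by simp
  have le: "\<bar>Re (sesq (2 * k) C (z s) (z s))\<bar> \<le> Re (cip k y y)" if "s < 2" for s
    using C unfolding contraction_def cz[OF that, symmetric] by blast
  have lt: "(0::nat) < 2" "(1::nat) < 2" by simp_all
  have avg: "\<bar>(p - q) / 2\<bar> \<le> r" if "\<bar>p\<bar> \<le> r" "\<bar>q\<bar> \<le> r" for p q r :: real
    using that unfolding abs_le_iff by (simp add: field_simps)
  show "\<bar>Re (sesq k ?M y y)\<bar> \<le> Re (cip k y y)"
    unfolding re by (rule avg[OF le[OF lt(1)] le[OF lt(2)]])
qed

text \<open>For a Hermitian \<open>K = \<Sum>\<^sub>i \<mu>\<^sub>i |u\<^sub>i\<rangle>\<langle>u\<^sub>i|\<close> and a sign \<open>\<epsilon>\<close>, this is the two-outcome measurement with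
  effects \<open>(1 \<plusminus> \<epsilon>K)/2\<close>; the channels for \<open>\<epsilon> = 1\<close> and \<open>\<epsilon> = -1\<close> differ by
  \<open>X \<mapsto> tr(KX) (|0\<rangle>\<langle>0| - |1\<rangle>\<langle>1|)\<close>.\<close>

definition effect_channel :: "nat \<Rightarrow> (nat \<Rightarrow> nat \<Rightarrow> complex) \<Rightarrow> (nat \<Rightarrow> real) \<Rightarrow> real \<Rightarrow> complex mat \<Rightarrow> complex mat" where
  "effect_channel d u \<mu> \<epsilon> = measure_prepare d 2 ({..<2::nat} \<times> {..<d})
     (\<lambda>(s, i). (1 + \<epsilon> * (if s = 0 then 1 else - 1) * \<mu> i) / 2) (\<lambda>(s, i). u i)
     (\<lambda>(s, i) r. if r = s then 1 else 0)"

lemma channel_effect_channel: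
  assumes u: "onb d u" and \<mu>: "\<And>i. i < d \<Longrightarrow> \<bar>\<mu> i\<bar> \<le> 1" and \<epsilon>: "\<bar>\<epsilon>\<bar> = 1"
  shows "channel d 2 (effect_channel d u \<mu> \<epsilon>)"
  unfolding effect_channel_def
proof (rule channel_measure_prepare)
  fix m :: "nat \<times> nat" assume m: "m \<in> {..<2} \<times> {..<d}"
  have "\<bar>\<epsilon> * (if fst m = 0 then 1 else - 1) * \<mu> (snd m)\<bar> \<le> 1"
    using \<mu>[of "snd m"] m \<epsilon> by (auto simp: abs_mult)
  then show "0 \<le> (case m of (s, i) \<Rightarrow> (1 + \<epsilon> * (if s = 0 then 1 else - 1) * \<mu> i) / 2)"
    by (auto simp: split_beta abs_le_iff)
  show "cip 2 ((case m of (s, i) \<Rightarrow> \<lambda>r. if r = s then 1 else 0)) ((case m of (s, i) \<Rightarrow> \<lambda>r. if r = s then 1 else 0)) = 1"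
    using m by (auto simp: cip_def split_beta numeral_2_eq_2 less_Suc_eq)
next
  fix r c assume rc: "r < d" "c < d"
  have two: "(\<Sum>s<2::nat. f s) = f 0 + f 1" for f :: "nat \<Rightarrow> complex" by (simp add: numeral_2_eq_2)
  let ?t = "\<lambda>s i. complex_of_real ((1 + \<epsilon> * (if s = (0::nat) then 1 else - 1) * \<mu> i) / 2)"
  have "(\<Sum>m\<in>{..<2::nat} \<times> {..<d}. of_real (case m of (s, i) \<Rightarrow> (1 + \<epsilon> * (if s = 0 then 1 else - 1) * \<mu> i) / 2) *
      (cnj ((case m of (s, i) \<Rightarrow> u i) r) * (case m of (s, i) \<Rightarrow> u i) c)) =
      (\<Sum>s<2::nat. \<Sum>i<d. ?t s i * (cnj (u i r) * u i c))"
    unfolding sum.cartesian_product by (simp only: case_prod_unfold)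
  also have "\<dots> = (\<Sum>i<d. (?t 0 i + ?t 1 i) * (cnj (u i r) * u i c))"
    unfolding two by (simp only: sum.distrib distrib_right)
  \<comment> \<open>The weights of the two outcomes add up to 1, since the terms with
    \<open>\<epsilon>\<close> cancel.\<close>
  also have "\<dots> = (\<Sum>i<d. u i c * cnj (u i r))"
    by (intro sum.cong refl) (simp add: complex_eq_iff field_simps)
  also have "\<dots> = (if r = c then 1 else 0)" using onb_complete[OF u rc(2,1)] by auto
  finally show "(\<Sum>m\<in>{..<2::nat} \<times> {..<d}. of_real (case m of (s, i) \<Rightarrow> (1 + \<epsilon> * (if s = 0 then 1 else - 1) * \<mu> i) / 2) *
      (cnj ((case m of (s, i) \<Rightarrow> u i) r) * (case m of (s, i) \<Rightarrow> u i) c)) = (if r = c then 1 else 0)" .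
qed simp

lemma effect_channel_index:
  assumes "r < 2" "c < 2"
  shows "effect_channel d u \<mu> \<epsilon> X $$ (r, c) = (if r = c then
    (\<Sum>i<d. of_real ((1 + \<epsilon> * (if r = 0 then 1 else - 1) * \<mu> i) / 2) * sesq d X (u i) (u i)) else 0)"
proof -
  have "effect_channel d u \<mu> \<epsilon> X $$ (r, c) = (\<Sum>s<2::nat. \<Sum>i<d.
      of_real ((1 + \<epsilon> * (if s = 0 then 1 else - 1) * \<mu> i) / 2) *
      ((if r = s then 1 else 0) * cnj (if c = s then 1 else 0) * sesq d X (u i) (u i)))"
    using assms unfolding effect_channel_def measure_prepare_def sum.cartesian_product
    by (simp add: case_prod_unfold)
  also have "\<dots> = (\<Sum>s<2::nat. if s = r then (if r = c then
    (\<Sum>i<d. of_real ((1 + \<epsilon> * (if r = 0 then 1 else - 1) * \<mu> i) / 2) * sesq d X (u i) (u i)) else 0) else 0)"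
    by (intro sum.cong refl) auto
  finally show ?thesis using assms(1) by simp
qed

text \<open>The constant part 1/2 of the effects cancels; what is left is the partial pairing with
  \<open>\<mu>\<close>, signed by the outcome.\<close>

lemma effect_channel_diff_index:
  assumes ab: "a < 2" "b < 2" and jl: "j < k" "l < k"
  shows "(map_tensor_id d 2 k (effect_channel d u \<mu> 1) X - map_tensor_id d 2 k (effect_channel d u \<mu> (- 1)) X)
      $$ (a * k + j, b * k + l) = (if a = b then (if a = 0 then 1 else - 1) *
        (\<Sum>i<d. of_real (\<mu> i) * sesq d (block d k X j l) (u i) (u i)) else 0)"
proof -
  have e: "complex_of_real ((1 + (if a = 0 then 1 else - 1) * \<mu> i) / 2)
      - of_real ((1 - (if a = 0 then 1 else - 1) * \<mu> i) / 2) = (if a = 0 then 1 else - 1) * of_real (\<mu> i)" for i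
    by (simp add: complex_eq_iff field_simps)
  have "(map_tensor_id d 2 k (effect_channel d u \<mu> 1) X - map_tensor_id d 2 k (effect_channel d u \<mu> (- 1)) X)
      $$ (a * k + j, b * k + l) = effect_channel d u \<mu> 1 (block d k X j l) $$ (a, b)
        - effect_channel d u \<mu> (- 1) (block d k X j l) $$ (a, b)"
    using pair_index(1)[OF ab(1) jl(1)] pair_index(1)[OF ab(2) jl(2)] assms
    by (simp add: map_tensor_id_index map_tensor_id_def[of d 2 k "effect_channel d u \<mu> (- 1)"])
  also have "\<dots> = (if a = b then (\<Sum>i<d. (complex_of_real ((1 + (if a = 0 then 1 else - 1) * \<mu> i) / 2)
      - of_real ((1 - (if a = 0 then 1 else - 1) * \<mu> i) / 2)) * sesq d (block d k X j l) (u i) (u i)) else 0)"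
    by (simp add: effect_channel_index[OF ab] sum_subtractf[symmetric] left_diff_distrib)
  also have "\<dots> = (if a = b then (if a = 0 then 1 else - 1) *
        (\<Sum>i<d. of_real (\<mu> i) * sesq d (block d k X j l) (u i) (u i)) else 0)"
    unfolding e sum_distrib_left by (simp add: mult.assoc)
  finally show ?thesis .
qed

text \<open>A contraction \<open>C\<close> that is optimal for the output difference is pulled back
  to the contraction \<open>spec_mat d u \<mu>\<close> tensored with \<open>M\<close> on the
  original space. The flag yields a factor 2, so the output trace norm is at most twice that of
  \<open>\<rho> - \<sigma>\<close>.\<close>

lemma trace_dist_effect_channels_le:
  assumes u: "onb d u" and \<mu>: "\<And>i. i < d \<Longrightarrow> \<bar>\<mu> i\<bar> \<le> 1"
    and \<rho>: "density_operator (d * k) \<rho>" and \<sigma>: "density_operator (d * k) \<sigma>"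
    and ann: "\<And>j l. j < k \<Longrightarrow> l < k \<Longrightarrow>
      (\<Sum>i<d. of_real (\<mu> i) * sesq d (block d k \<sigma> j l) (u i) (u i)) = 0"
  shows "trace_dist (map_tensor_id d 2 k (effect_channel d u \<mu> 1) \<rho>)
    (map_tensor_id d 2 k (effect_channel d u \<mu> (- 1)) \<rho>) \<le> 2 * trace_dist \<rho> \<sigma>"
proof -
  let ?G = "map_tensor_id d 2 k (effect_channel d u \<mu> 1) \<rho> - map_tensor_id d 2 k (effect_channel d u \<mu> (- 1)) \<rho>"
  let ?X = "\<rho> - \<sigma>"
  have ch: "channel d 2 (effect_channel d u \<mu> \<epsilon>)" if "\<bar>\<epsilon>\<bar> = 1" for \<epsilon>
    using u \<mu> that by (rule channel_effect_channel)
  have G: "hermitian (2 * k) ?G"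
    by (intro hermitian_minus hermitian_density density_operator_map_tensor_id ch \<rho>) simp_all
  have X: "hermitian (d * k) ?X" by (intro hermitian_minus hermitian_density \<rho> \<sigma>)
  have carr: "\<rho> \<in> carrier_mat (d * k) (d * k)" "\<sigma> \<in> carrier_mat (d * k) (d * k)"
    using \<rho> \<sigma> by (simp_all add: density_carrier)
  \<comment> \<open>The entries of the partial trace of K times \<open>\<rho> - \<sigma>\<close>.
    Since \<open>\<sigma>\<close> contributes nothing, they coincide with those for
    \<open>\<rho>\<close> alone, which is how \<open>\<sigma>\<close> enters the estimate.\<close>
  define D where "D j l = (\<Sum>i<d. of_real (\<mu> i) * sesq d (block d k ?X j l) (u i) (u i))" for j l
  have D: "(\<Sum>i<d. of_real (\<mu> i) * sesq d (block d k \<rho> j l) (u i) (u i)) = D j l" if jl: "j < k" "l < k" for j l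
  proof -
    have "sesq d (block d k ?X j l) (u i) (u i) =
        sesq d (block d k \<rho> j l) (u i) (u i) - sesq d (block d k \<sigma> j l) (u i) (u i)" for i
    proof -
      have "?X $$ (a * k + j, b * k + l) = \<rho> $$ (a * k + j, b * k + l) - \<sigma> $$ (a * k + j, b * k + l)"
        if "a < d" "b < d" for a b
        using pair_index(1)[OF that(1) jl(1)] pair_index(1)[OF that(2) jl(2)] carr by simp
      then show ?thesis
        unfolding sesq_block sum_subtractf[symmetric]
        by (intro sum.cong refl) (simp add: left_diff_distrib right_diff_distrib)
    qed
    then show ?thesis using ann[OF jl] by (simp add: D_def right_diff_distrib sum_subtractf)
  qed
  obtain C where C: "contraction (2 * k) C" and CG: "Re (tp (2 * k) C ?G) = trace_norm ?G"
    using trace_norm_attained[OF G] by blast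
  \<comment> \<open>The division by 2 makes \<open>M\<close> a contraction and is paid back by the
    factor 2 in the next equation.\<close>
  define M where "M = mat k k (\<lambda>(j, l). (C $$ (j, l) - C $$ (k + j, k + l)) / 2)"
  have M: "contraction k M" unfolding M_def by (rule contraction_half_block_diff[OF C])
  have MM: "M \<in> carrier_mat k k" by (simp add: M_def)
  have two: "(\<Sum>a<2::nat. f a) = f 0 + f 1" for f :: "nat \<Rightarrow> complex" by (simp add: numeral_2_eq_2)
  have "tp (2 * k) C ?G = (\<Sum>j<k. \<Sum>l<k. 2 * (M $$ (j, l) * D l j))"
    unfolding tp_pair
  proof (intro sum.cong refl)
    fix j l assume "j \<in> {..<k}" "l \<in> {..<k}"
    then have jl: "j < k" "l < k" by simp_all
    have "(\<Sum>a<2::nat. \<Sum>b<2. C $$ (a * k + j, b * k + l) * ?G $$ (b * k + l, a * k + j)) =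
        (\<Sum>a<2::nat. \<Sum>b<2. C $$ (a * k + j, b * k + l) *
          (if b = a then (if b = 0 then 1 else - 1) * D l j else 0))"
      using jl by (intro sum.cong refl, subst effect_channel_diff_index) (simp_all add: D)
    also have "\<dots> = 2 * (M $$ (j, l) * D l j)"
      using jl unfolding two by (simp add: M_def algebra_simps)
    finally show "(\<Sum>a<2::nat. \<Sum>b<2. C $$ (a * k + j, b * k + l) * ?G $$ (b * k + l, a * k + j)) =
        2 * (M $$ (j, l) * D l j)" .
  qed
  also have "\<dots> = 2 * (\<Sum>j<k. \<Sum>l<k. M $$ (j, l) * D l j)" by (simp add: sum_distrib_left)
  \<comment> \<open>Pairing \<open>M\<close> with a partial trace is pairing the tensor product with
    the whole operator.\<close>
  also have "(\<Sum>j<k. \<Sum>l<k. M $$ (j, l) * D l j) = tp (d * k) (kron (spec_mat d u \<mu>) M) ?X"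
    unfolding tp_pair
  proof (intro sum.cong refl)
    fix j l assume "j \<in> {..<k}" "l \<in> {..<k}"
    then have jl: "j < k" "l < k" by simp_all
    have "(\<Sum>a<d. \<Sum>b<d. kron (spec_mat d u \<mu>) M $$ (a * k + j, b * k + l) * ?X $$ (b * k + l, a * k + j)) =
        (\<Sum>a<d. \<Sum>b<d. \<Sum>i<d. M $$ (j, l) * (of_real (\<mu> i) *
          (cnj (u i b) * ?X $$ (b * k + l, a * k + j) * u i a)))"
      using jl by (intro sum.cong refl)
        (subst kron_index[OF spec_mat_carrier MM],
          simp_all add: spec_mat_index sum_distrib_left sum_distrib_right ac_simps)
    also have "\<dots> = (\<Sum>i<d. \<Sum>a<d. \<Sum>b<d. M $$ (j, l) * (of_real (\<mu> i) *
          (cnj (u i b) * ?X $$ (b * k + l, a * k + j) * u i a)))"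
      by (rule sum_rotate)
    also have "\<dots> = (\<Sum>i<d. \<Sum>b<d. \<Sum>a<d. M $$ (j, l) * (of_real (\<mu> i) *
          (cnj (u i b) * ?X $$ (b * k + l, a * k + j) * u i a)))"
      by (intro sum.cong refl sum.swap)
    also have "\<dots> = M $$ (j, l) * D l j"
      unfolding D_def sesq_block sum_distrib_left ..
    finally show "M $$ (j, l) * D l j =
        (\<Sum>a<d. \<Sum>b<d. kron (spec_mat d u \<mu>) M $$ (a * k + j, b * k + l) * ?X $$ (b * k + l, a * k + j))" ..
  qed
  finally have "trace_norm ?G = 2 * Re (tp (d * k) (kron (spec_mat d u \<mu>) M) ?X)"
    using CG by simp
  also have "\<dots> \<le> 2 * trace_norm ?X"
    using trace_norm_ge[OF X contraction_kron_spec_mat[OF u \<mu> M]] by simp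
  finally show ?thesis by (simp add: trace_dist_def)
qed

section \<open>Lower bound on the diamond distance of the pair\<close>

lemma contraction_diagonal:
  assumes "\<And>r. r < n \<Longrightarrow> \<bar>l r\<bar> \<le> 1"
  shows "contraction n (mat n n (\<lambda>(r, c). if r = c then complex_of_real (l r) else 0))" (is "contraction n ?L")
  unfolding contraction_def
proof (intro conjI allI)
  show "hermitian n ?L" by (simp add: hermitian_def)
  fix x
  have "sesq n ?L x x = (\<Sum>r<n. \<Sum>c<n. if r = c then of_real (l r) * (cnj (x r) * x r) else 0)"
    unfolding sesq_def by (intro sum.cong refl) auto
  also have "\<dots> = of_real (\<Sum>r<n. l r * (cmod (x r))\<^sup>2)"
    by (simp add: complex_norm_square mult.commute del: of_real_power)
  finally have "\<bar>Re (sesq n ?L x x)\<bar> \<le> (\<Sum>r<n. \<bar>l r * (cmod (x r))\<^sup>2\<bar>)" by simp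
  also have "\<dots> \<le> (\<Sum>r<n. (cmod (x r))\<^sup>2)"
    using assms by (intro sum_mono) (simp add: abs_mult mult_left_le_one_le)
  finally show "\<bar>Re (sesq n ?L x x)\<bar> \<le> Re (cip n x x)" by (simp add: Re_cip_self)
qed

lemma density_operator_rank_one: "cip n w w = 1 \<Longrightarrow> density_operator n (rank_one n w)"
  by (simp add: density_operator_def psd_rank_one mat_trace_rank_one)

text \<open>The supremum dominates its members because trace distances of states never exceed
  1.\<close>

lemma diamond_dist_upper:
  assumes "channel d d' \<Lambda>0" "channel d d' \<Lambda>1" "density_operator (d * d) R"
  shows "trace_dist (map_tensor_id d d' d \<Lambda>0 R) (map_tensor_id d d' d \<Lambda>1 R) \<le> diamond_dist d d' \<Lambda>0 \<Lambda>1"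
  unfolding diamond_dist_def
proof (rule cSUP_upper)
  show "bdd_above ((\<lambda>R. trace_dist (map_tensor_id d d' d \<Lambda>0 R) (map_tensor_id d d' d \<Lambda>1 R)) `
      {R. density_operator (d * d) R})"
    using assms(1,2) by (intro bdd_aboveI2[of _ _ 1] trace_dist_bounds(2)[of "d' * d"])
      (auto intro: density_operator_map_tensor_id)
qed (use assms in simp)

text \<open>\<open>0 < d\<close> guarantees that some input state exists; its distance is a
  nonnegative lower bound of the supremum.\<close>

lemma diamond_dist_nonneg:
  assumes "0 < d" "channel d d' \<Lambda>0" "channel d d' \<Lambda>1"
  shows "0 \<le> diamond_dist d d' \<Lambda>0 \<Lambda>1"
proof -
  have "cip (d * d) (\<lambda>p. if p = 0 then 1 else 0) (\<lambda>p. if p = 0 then 1 else 0) = 1"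
    using assms(1) by (simp add: cip_def if_distrib[of cnj] if_distrib[of "\<lambda>x. x * _"] cong: if_cong)
  then have R: "density_operator (d * d) (rank_one (d * d) (\<lambda>p. if p = 0 then 1 else 0))" (is "density_operator _ ?R")
    by (rule density_operator_rank_one)
  have "0 \<le> trace_dist (map_tensor_id d d' d \<Lambda>0 ?R) (map_tensor_id d d' d \<Lambda>1 ?R)"
    using assms R by (intro trace_dist_bounds(1)[of "d' * d"]) (auto intro: density_operator_map_tensor_id)
  also have "\<dots> \<le> diamond_dist d d' \<Lambda>0 \<Lambda>1" by (rule diamond_dist_upper[OF assms(2,3) R])
  finally show ?thesis .
qed

text \<open>The input is a product of the eigenvector \<open>u i0\<close> with the first basis
  vector of the reference copy, so the output difference is diagonal with entries
  \<open>\<mu> i0\<close> and its negative.\<close>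

lemma effect_channel_diff_eigenstate:
  assumes u: "onb d u" and i0: "i0 < d" and ab: "a < 2" "b < 2" "j < d" "l < d"
  defines "R \<equiv> rank_one (d * d) (\<lambda>p. if p mod d = 0 then u i0 (p div d) else 0)"
  shows "(map_tensor_id d 2 d (effect_channel d u \<mu> 1) R - map_tensor_id d 2 d (effect_channel d u \<mu> (- 1)) R)
      $$ (a * d + j, b * d + l) = (if a = b \<and> j = 0 \<and> l = 0 then (if a = 0 then 1 else - 1) * of_real (\<mu> i0) else 0)"
proof -
  have R: "R $$ (p * d + j, q * d + l) = (if j = 0 \<and> l = 0 then u i0 p * cnj (u i0 q) else 0)"
    if "p < d" "q < d" for p q
    using ab that by (simp add: R_def rank_one_def pair_index)
  have "sesq d (block d d R j l) (u i) (u i) = (if j = 0 \<and> l = 0 then (if i = i0 then 1 else 0) else 0)"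
    if i: "i < d" for i
  proof -
    have "sesq d (block d d R j l) (u i) (u i) =
        (\<Sum>p<d. \<Sum>q<d. if j = 0 \<and> l = 0 then (cnj (u i p) * u i0 p) * (cnj (u i0 q) * u i q) else 0)"
      unfolding sesq_block by (intro sum.cong refl) (simp add: R mult.assoc)
    also have "\<dots> = (if j = 0 \<and> l = 0 then cip d (u i) (u i0) * cip d (u i0) (u i) else 0)"
      by (simp add: cip_def sum_product)
    finally show ?thesis using i i0 by (simp add: onbD[OF u])
  qed
  then have "(\<Sum>i<d. of_real (\<mu> i) * sesq d (block d d R j l) (u i) (u i)) =
      (if j = 0 \<and> l = 0 then (\<Sum>i<d. of_real (\<mu> i) * (if i = i0 then 1 else 0)) else 0)" by simp
  also have "\<dots> = (if j = 0 \<and> l = 0 then of_real (\<mu> i0) else 0)"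
    using sum_delta_lessThan(4)[OF i0, of "\<lambda>i. of_real (\<mu> i)"] by simp
  finally have eq: "(\<Sum>i<d. of_real (\<mu> i) * sesq d (block d d R j l) (u i) (u i)) =
      (if j = 0 \<and> l = 0 then of_real (\<mu> i0) else 0)" .
  show ?thesis unfolding effect_channel_diff_index[OF ab] eq by simp
qed

lemma diamond_dist_effect_channels:
  assumes u: "onb d u" and \<mu>: "\<And>i. i < d \<Longrightarrow> \<bar>\<mu> i\<bar> \<le> 1" and i0: "i0 < d" "\<bar>\<mu> i0\<bar> = 1"
  shows "1 \<le> diamond_dist d 2 (effect_channel d u \<mu> 1) (effect_channel d u \<mu> (- 1))"
proof -
  have ch: "channel d 2 (effect_channel d u \<mu> \<epsilon>)" if "\<bar>\<epsilon>\<bar> = 1" for \<epsilon>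
    using u \<mu> that by (rule channel_effect_channel)
  let ?w = "\<lambda>p. if p mod d = 0 then u i0 (p div d) else 0"
  let ?R = "rank_one (d * d) ?w"
  have "cip (d * d) ?w ?w = (\<Sum>a<d. \<Sum>j<d. if j = 0 then cnj (u i0 a) * u i0 a else 0)"
    unfolding cip_pair by (intro sum.cong refl) (auto simp: pair_index)
  also have "\<dots> = cip d (u i0) (u i0)" using i0(1) by (simp add: cip_def)
  finally have R: "density_operator (d * d) ?R"
    using onbD[OF u i0(1) i0(1)] by (intro density_operator_rank_one) simp
  let ?G = "map_tensor_id d 2 d (effect_channel d u \<mu> 1) ?R - map_tensor_id d 2 d (effect_channel d u \<mu> (- 1)) ?R"
  have G: "hermitian (2 * d) ?G"
    by (intro hermitian_minus hermitian_density density_operator_map_tensor_id ch R) simp_all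
  \<comment> \<open>The sign of the output difference: the sign of the flag times
    \<open>\<mu> i0\<close>, which is itself 1 or -1. The two nonzero entries then contribute 1
    each.\<close>
  define L where "L = mat (2 * d) (2 * d) (\<lambda>(r, c). if r = c then complex_of_real ((if r div d = 0 then 1 else - 1) * \<mu> i0) else 0)"
  have L: "contraction (2 * d) L"
    unfolding L_def using i0(2) by (intro contraction_diagonal) (simp add: abs_mult)
  have sq: "of_real (\<mu> i0) * of_real (\<mu> i0) = (1 :: complex)"
    using i0(2) by (metis abs_mult_self_eq mult_1 of_real_1 of_real_mult)
  have "tp (2 * d) L ?G = (\<Sum>r<2 * d. \<Sum>c<2 * d. if r = c then
      complex_of_real ((if r div d = 0 then 1 else - 1) * \<mu> i0) * ?G $$ (r, r) else 0)"
    unfolding tp_def by (intro sum.cong refl) (simp add: L_def)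
  also have "\<dots> = (\<Sum>r<2 * d. complex_of_real ((if r div d = 0 then 1 else - 1) * \<mu> i0) * ?G $$ (r, r))"
    by simp
  also have "\<dots> = (\<Sum>a<2::nat. \<Sum>j<d. if j = 0 then 1 else 0)"
    unfolding sum_pair_index
  proof (intro sum.cong refl)
    fix a j :: nat assume "a \<in> {..<2}" "j \<in> {..<d}"
    then have aj: "a < 2" "j < d" by simp_all
    show "complex_of_real ((if (a * d + j) div d = 0 then 1 else - 1) * \<mu> i0) * ?G $$ (a * d + j, a * d + j) =
        (if j = 0 then 1 else 0)"
      unfolding effect_channel_diff_eigenstate[OF u i0(1) aj(1) aj(1) aj(2) aj(2)] pair_index(2)[OF aj]
      by (simp add: sq)
  qed
  also have "\<dots> = 2" using i0(1) by simp
  finally have "2 \<le> trace_norm ?G" using trace_norm_ge[OF G L] by simp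
  then have "1 \<le> trace_dist (map_tensor_id d 2 d (effect_channel d u \<mu> 1) ?R)
      (map_tensor_id d 2 d (effect_channel d u \<mu> (- 1)) ?R)" by (simp add: trace_dist_def)
  also have "\<dots> \<le> diamond_dist d 2 (effect_channel d u \<mu> 1) (effect_channel d u \<mu> (- 1))"
    by (intro diamond_dist_upper ch R) simp_all
  finally show ?thesis .
qed

section \<open>From the discriminating pair to the bound on the discrimination power\<close>

lemma CDP_le_ratio:
  assumes "0 < dA" and \<rho>: "density_operator (dA * dB) \<rho>"
    and "channel dA d' \<Lambda>0" "channel dA d' \<Lambda>1" "X \<in> carrier_mat dA dA" "\<Lambda>0 X \<noteq> \<Lambda>1 X"
  shows "CDP dA dB \<rho> \<le> trace_dist (map_tensor_id dA d' dB \<Lambda>0 \<rho>) (map_tensor_id dA d' dB \<Lambda>1 \<rho>)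
        / diamond_dist dA d' \<Lambda>0 \<Lambda>1"
  unfolding CDP_def
proof (rule cInf_lower)
  show "bdd_below {trace_dist (map_tensor_id dA d' dB \<Lambda>0 \<rho>) (map_tensor_id dA d' dB \<Lambda>1 \<rho>)
        / diamond_dist dA d' \<Lambda>0 \<Lambda>1 | d' \<Lambda>0 \<Lambda>1.
     channel dA d' \<Lambda>0 \<and> channel dA d' \<Lambda>1 \<and> (\<exists>X \<in> carrier_mat dA dA. \<Lambda>0 X \<noteq> \<Lambda>1 X)}"
    \<comment> \<open>Numerators and denominators are nonnegative, and a zero denominator would give
      the value 0, so 0 bounds the ratios from below.\<close>
    using assms(1) density_operator_map_tensor_id[OF _ \<rho>]
    by (intro bdd_belowI[of _ 0]) (auto intro!: divide_nonneg_nonneg trace_dist_bounds(1) diamond_dist_nonneg)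
qed (use assms in blast)

lemma CDP_le_trace_dist:
  assumes dA: "0 < dA" and \<rho>: "density_operator (dA * dB) \<rho>" and \<sigma>: "density_operator (dA * dB) \<sigma>"
    and less: "operator_Schmidt_rank dA dB \<sigma> < dA\<^sup>2"
  shows "CDP dA dB \<rho> \<le> 2 * trace_dist \<rho> \<sigma>"
proof -
  obtain u \<mu> i0 where u: "onb dA u" and \<mu>: "\<forall>i<dA. \<bar>\<mu> i\<bar> \<le> 1" and i0: "i0 < dA" "\<bar>\<mu> i0\<bar> = 1"
    and ann: "\<forall>j<dB. \<forall>l<dB. (\<Sum>i<dA. of_real (\<mu> i) * sesq dA (block dA dB \<sigma> j l) (u i) (u i)) = 0"
    using osr_less_hermitian_annihilator[OF hermitian_density[OF \<sigma>] less] by (elim exE conjE) (rule that)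
  let ?p = "effect_channel dA u \<mu> 1" and ?m = "effect_channel dA u \<mu> (- 1)"
  have ch: "channel dA 2 ?p" "channel dA 2 ?m" using u \<mu> by (auto intro!: channel_effect_channel)
  have D1: "1 \<le> diamond_dist dA 2 ?p ?m"
    using \<mu> by (intro diamond_dist_effect_channels[of dA u \<mu> i0] u i0) simp
  \<comment> \<open>Distinctness is read off from the diamond distance: maps that agree on all
    operators of the first factor have equal extensions, so every distance in the supremum would be
    0.\<close>
  have ne: "\<exists>X\<in>carrier_mat dA dA. ?p X \<noteq> ?m X"
  proof (rule ccontr)
    assume "\<not> ?thesis"
    then have "map_tensor_id dA 2 dA ?p R = map_tensor_id dA 2 dA ?m R" for R
      by (intro map_tensor_id_cong) blast
    moreover have "trace_dist S S = 0" if "density_operator (2 * dA) S" for S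
    proof -
      \<comment> \<open>The zero operator is put in spectral form so that its trace norm can be
        computed.\<close>
      have "S - S = spec_mat (2 * dA) (\<lambda>i r. if i = r then 1 else 0) (\<lambda>_. 0)"
        using density_carrier[OF that] by (intro eq_matI) (auto simp: spec_mat_def)
      moreover have "onb (2 * dA) (\<lambda>i r. if i = r then 1 else 0)"
        unfolding onb_def cip_def by (auto simp: if_distrib[of cnj] if_distrib[of "\<lambda>x. x * _"] cong: if_cong)
      ultimately show ?thesis by (simp add: trace_dist_def trace_norm_spec_mat)
    qed
    ultimately have "trace_dist (map_tensor_id dA 2 dA ?p R) (map_tensor_id dA 2 dA ?m R) = 0"
      if "density_operator (dA * dA) R" for R
      using density_operator_map_tensor_id[OF ch(2) that] by simp
    then have "diamond_dist dA 2 ?p ?m \<le> 0"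
      unfolding diamond_dist_def
      using density_operator_rank_one[of "dA * dA" "\<lambda>p. if p = 0 then 1 else 0"] dA
      by (intro cSUP_least) (auto simp: cip_def if_distrib[of cnj] if_distrib[of "\<lambda>x. x * _"] cong: if_cong)
    then show False using D1 by simp
  qed
  then obtain X where X: "X \<in> carrier_mat dA dA" "?p X \<noteq> ?m X" by blast
  have nn: "0 \<le> trace_dist (map_tensor_id dA 2 dB ?p \<rho>) (map_tensor_id dA 2 dB ?m \<rho>)"
    by (intro trace_dist_bounds(1)[of "2 * dB"] density_operator_map_tensor_id ch \<rho>)
  have "CDP dA dB \<rho> \<le> trace_dist (map_tensor_id dA 2 dB ?p \<rho>) (map_tensor_id dA 2 dB ?m \<rho>) / diamond_dist dA 2 ?p ?m"
    by (rule CDP_le_ratio[OF dA \<rho> ch X])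
  \<comment> \<open>The numerator is nonnegative, so the denominator, being at least 1, may be
    replaced by 1.\<close>
  also have "\<dots> \<le> trace_dist (map_tensor_id dA 2 dB ?p \<rho>) (map_tensor_id dA 2 dB ?m \<rho>) / 1"
    using D1 nn by (intro divide_left_mono) auto
  also have "\<dots> \<le> 2 * trace_dist \<rho> \<sigma>"
    using trace_dist_effect_channels_le[OF u _ \<rho> \<sigma>] \<mu> ann by simp
  finally show ?thesis .
qed

text \<open>Each minimum is given by an element that attains it, so the inequalities compare true
  minima and not default values of an infimum. For \<open>dA = 1\<close> rank less than 1 would make
  the output zero, against trace 1, and the first set would be empty; hence
  \<open>2 \<le> dA\<close>.\<close>

theorem mainTheorem5:
  fixes dA dB :: nat and \<rho> :: "complex mat"
  assumes "2 \<le> dA"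
    and "density_operator (dA * dB) \<rho>"
  shows "\<exists>\<Lambda> a.
    is_arg_min (\<lambda>\<Lambda>'. 2 * trace_dist \<rho> (map_tensor_id dA dA dB \<Lambda>' \<rho>))
      (\<lambda>\<Lambda>'. channel dA dA \<Lambda>' \<and>
         operator_Schmidt_rank dA dB (map_tensor_id dA dA dB \<Lambda>' \<rho>) < dA ^ 2) \<Lambda> \<and>
    is_arg_min (\<lambda>b. 2 * trace_dist \<rho> (map_tensor_id dA dA dB (proj_measurement dA b) \<rho>))
      (orthonormal_basis dA) a \<and>
    CDP dA dB \<rho> \<le> 2 * trace_dist \<rho> (map_tensor_id dA dA dB \<Lambda> \<rho>) \<and>
    2 * trace_dist \<rho> (map_tensor_id dA dA dB \<Lambda> \<rho>)
      \<le> 2 * trace_dist \<rho> (map_tensor_id dA dA dB (proj_measurement dA a) \<rho>)"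
proof -
  obtain a where a: "is_arg_min (\<lambda>b. 2 * trace_dist \<rho> (map_tensor_id dA dA dB (proj_measurement dA b) \<rho>))
      (orthonormal_basis dA) a"
    using exists_optimal_basis[OF assms(2)] by blast
  then have onb: "orthonormal_basis dA a" by (simp add: is_arg_min_def)
  \<comment> \<open>The optimal measurement is itself a feasible channel. This gives the second
    inequality and the feasibility needed for the first minimum.\<close>
  have proj: "channel dA dA (proj_measurement dA a) \<and>
      operator_Schmidt_rank dA dB (map_tensor_id dA dA dB (proj_measurement dA a) \<rho>) < dA ^ 2"
    using channel_proj_measurement[OF onb] operator_Schmidt_rank_proj_measurement[OF assms(1) onb] by blast
  obtain \<Lambda> where \<Lambda>: "is_arg_min (\<lambda>\<Lambda>'. 2 * trace_dist \<rho> (map_tensor_id dA dA dB \<Lambda>' \<rho>))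
      (\<lambda>\<Lambda>'. channel dA dA \<Lambda>' \<and>
         operator_Schmidt_rank dA dB (map_tensor_id dA dA dB \<Lambda>' \<rho>) < dA ^ 2) \<Lambda>"
    using exists_optimal_channel[OF assms(2) proj] by blast
  then have ch: "channel dA dA \<Lambda>"
    and osr: "operator_Schmidt_rank dA dB (map_tensor_id dA dA dB \<Lambda> \<rho>) < dA\<^sup>2"
    and le: "2 * trace_dist \<rho> (map_tensor_id dA dA dB \<Lambda> \<rho>)
      \<le> 2 * trace_dist \<rho> (map_tensor_id dA dA dB (proj_measurement dA a) \<rho>)"
    using proj unfolding is_arg_min_linorder by blast+
  have "CDP dA dB \<rho> \<le> 2 * trace_dist \<rho> (map_tensor_id dA dA dB \<Lambda> \<rho>)"
    using assms osr
    by (intro CDP_le_trace_dist density_operator_map_tensor_id[OF ch]) auto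
  with \<Lambda> a le show ?thesis by blast
qed

end
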